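(* Let $K$ be a subfield of $\mathbb{C}$ and let $X$ be a curve of genus two over $K$ that is the normalization of the (projective closure of the) curve given by the affine equation $$y^2=x^6+a_5x^5+a_4x^4+a_3x^3+a_2x^2+a_1x+a_0,\qquad a_0,\dots,a_5\in K.$$ Let $w$ be the hyperelliptic involution, and let $P_0$ be the point at infinity of $X$ with $\left(\frac{y}{x^3}\right)(P_0)=1$. Then the functions $f_3,f_4,f_5\in K(X)$ defined by $$f_3=\frac{8a_3-4a_4a_5+a_5^3}{32}+\frac{4a_4-a_5^2}{16}\,x+\frac{a_5}{4}\,x^2+\frac12\,x^3+\frac12\,y,$$ $$f_4=\frac{64a_2-16a_4^2-32a_3a_5+24a_4a_5^2-5a_5^4}{256}+x\,f_3,$$ $$f_5=\frac{128a_1-64a_3a_4-64a_2a_5+48a_4^2a_5+48a_3a_5^2-40a_4a_5^3+7a_5^5}{512}+x\,f_4$$ vanish at $w(P_0)$ and satisfy $\operatorname{div}^{-}f_i=i\,P_0$ for all $i\in\{3,4,5\}$. In particular, $\mathcal{L}_3=\langle 1,f_3\rangle$, $\mathcal{L}_4=\langle 1,f_3,f_4\rangle$ and $\mathcal{L}_5=\langle 1,f_3,f_4,f_5\rangle$ (spans over $K$).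
   Context: $X$ has exactly two points at infinity $P_0$ and $P_1=w(P_0)$ (the points over the singularity at infinity of the plane model); both are defined over $K$, are not Weierstrass points, and satisfy $\left(\frac{y}{x^3}\right)^2(P_i)=1$; they are labelled so that $\left(\frac{y}{x^3}\right)(P_0)=1$ and $\left(\frac{y}{x^3}\right)(P_1)=-1$. The involution $w$ is $(x,y)\mapsto(x,-y)$. For an integer $n\ge 1$, $\mathcal{L}_n=\{f\in K(X): \operatorname{div}(f)\ge -n\,P_0\}$ (with $0\in\mathcal{L}_n$), a $K$-vector space. For a nonzero function $f$, $\operatorname{div}^{-}f$ denotes the polar part (divisor of poles, counted with positive multiplicities) of $\operatorname{div} f$, so $\operatorname{div} f+\operatorname{div}^{-}f\ge 0$. *)

theory Defs
  imports
    "HOL-Algebra.Algebraic_Closure_Type"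
    "HOL-Computational_Algebra.Fraction_Field"
begin

section \<open>Points and divisors of the normal projective curve with a given function field\<close>

text \<open>
  Here \<open>L\<close> is a function field in one variable over its subfield \<open>k\<close> of constants. The closed
  points of the normal projective curve with function field \<open>L\<close> are in bijection with the
  normalized discrete valuations of \<open>L\<close> that are trivial on \<open>k\<close>, a point corresponding to its
  order function. A point is therefore represented by its order function, defined on the nonzero
  functions only and set to \<open>undefined\<close> elsewhere, so that equality of points is equality in HOL.
\<close>

definition points :: "('a, 'm) ring_scheme \<Rightarrow> 'a set \<Rightarrow> ('a \<Rightarrow> int) set" where
  "points L k = {v \<in> (carrier L - {\<zero>\<^bsub>L\<^esub>}) \<rightarrow>\<^sub>E UNIV.
     v ` (carrier L - {\<zero>\<^bsub>L\<^esub>}) = UNIV \<and>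
     (\<forall>f \<in> carrier L - {\<zero>\<^bsub>L\<^esub>}. \<forall>g \<in> carrier L - {\<zero>\<^bsub>L\<^esub>}. v (f \<otimes>\<^bsub>L\<^esub> g) = v f + v g) \<and>
     (\<forall>f \<in> carrier L - {\<zero>\<^bsub>L\<^esub>}. \<forall>g \<in> carrier L - {\<zero>\<^bsub>L\<^esub>}.
        f \<oplus>\<^bsub>L\<^esub> g \<noteq> \<zero>\<^bsub>L\<^esub> \<longrightarrow> min (v f) (v g) \<le> v (f \<oplus>\<^bsub>L\<^esub> g)) \<and>
     (\<forall>c \<in> k - {\<zero>\<^bsub>L\<^esub>}. v c = 0)}"

definition vanishes_at :: "('a, 'm) ring_scheme \<Rightarrow> ('a \<Rightarrow> int) \<Rightarrow> 'a \<Rightarrow> bool" where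
  "vanishes_at L P f \<longleftrightarrow> f = \<zero>\<^bsub>L\<^esub> \<or> P f > 0"

text \<open>The function \<open>f\<close> is regular at \<open>P\<close> with value the constant \<open>c\<close>.\<close>

definition has_value_at :: "('a, 'm) ring_scheme \<Rightarrow> ('a \<Rightarrow> int) \<Rightarrow> 'a \<Rightarrow> 'a \<Rightarrow> bool" where
  "has_value_at L P f c \<longleftrightarrow> vanishes_at L P (f \<ominus>\<^bsub>L\<^esub> c)"

definition divisors :: "('a, 'm) ring_scheme \<Rightarrow> 'a set \<Rightarrow> (('a \<Rightarrow> int) \<Rightarrow> int) set" where
  "divisors L k = {D. finite {P. D P \<noteq> 0} \<and> {P. D P \<noteq> 0} \<subseteq> points L k}"

definition multiple_of_point :: "int \<Rightarrow> ('a \<Rightarrow> int) \<Rightarrow> ('a \<Rightarrow> int) \<Rightarrow> int" where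
  "multiple_of_point n P = (\<lambda>Q. if Q = P then n else 0)"

definition div_of :: "('a, 'm) ring_scheme \<Rightarrow> 'a set \<Rightarrow> 'a \<Rightarrow> ('a \<Rightarrow> int) \<Rightarrow> int" where
  "div_of L k f = (\<lambda>P. if P \<in> points L k then P f else 0)"

definition polar_part :: "(('a \<Rightarrow> int) \<Rightarrow> int) \<Rightarrow> ('a \<Rightarrow> int) \<Rightarrow> int" where
  "polar_part D = (\<lambda>P. max 0 (- D P))"

definition riemann_roch_space ::
    "('a, 'm) ring_scheme \<Rightarrow> 'a set \<Rightarrow> (('a \<Rightarrow> int) \<Rightarrow> int) \<Rightarrow> 'a set" where
  "riemann_roch_space L k D =
     {f \<in> carrier L. f = \<zero>\<^bsub>L\<^esub> \<or> (\<lambda>P. - D P) \<le> div_of L k f}"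


section \<open>Genus\<close>

text \<open>
  The degree weights every point by one, which is correct when \<open>k\<close> is algebraically closed;
  the genus is accordingly only used for curves over the complex numbers.
\<close>

definition degree_of :: "(('a \<Rightarrow> int) \<Rightarrow> int) \<Rightarrow> int" where
  "degree_of D = (\<Sum>P | D P \<noteq> 0. D P)"

text \<open>The genus is the maximum of \<open>deg D - l(D) + 1\<close> over all divisors \<open>D\<close>.\<close>

definition has_genus :: "('a, 'm) ring_scheme \<Rightarrow> 'a set \<Rightarrow> nat \<Rightarrow> bool" where
  "has_genus L k g \<longleftrightarrow> field L \<and> subfield k L \<and>
     (\<forall>D \<in> divisors L k. degree_of D - int (ring.dim L k (riemann_roch_space L k D)) + 1 \<le> int g) \<and>
     (\<exists>D \<in> divisors L k. degree_of D - int (ring.dim L k (riemann_roch_space L k D)) + 1 = int g)"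


section \<open>The function field of \<open>y\<^sup>2 = F(x)\<close>\<close>

type_synonym double_cover_function = "complex poly fract \<times> complex poly fract"

definition rational_functions :: "complex set \<Rightarrow> complex poly fract set" where
  "rational_functions K =
     {Fraction_Field.Fract p q | p q. q \<noteq> 0 \<and> range (coeff p) \<subseteq> K \<and> range (coeff q) \<subseteq> K}"

text \<open>
  \<open>K(x)[y]/(y\<^sup>2 - F)\<close>, the pair \<open>(A, B)\<close> standing for \<open>A + B y\<close>. This is a field exactly if
  \<open>F\<close> is not a square in \<open>K(x)\<close>, that is, if the affine curve is irreducible over \<open>K\<close>.
\<close>

definition function_field :: "complex set \<Rightarrow> complex poly \<Rightarrow> double_cover_function ring" where
  "function_field K F =
     \<lparr> carrier = rational_functions K \<times> rational_functions K,
       monoid.mult = (\<lambda>(A, B) (C, D). (A * C + B * D * Fraction_Field.Fract F 1, A * D + B * C)),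
       one = (1, 0),
       ring.zero = (0, 0),
       add = (\<lambda>(A, B) (C, D). (A + C, B + D)) \<rparr>"

definition const :: "complex \<Rightarrow> double_cover_function" where
  "const c = (Fraction_Field.Fract [:c:] 1, 0)"

definition coord_x :: double_cover_function where
  "coord_x = (Fraction_Field.Fract [:0, 1:] 1, 0)"

definition coord_y :: double_cover_function where
  "coord_y = (0, 1)"

definition is_at_infinity :: "(double_cover_function \<Rightarrow> int) \<Rightarrow> bool" where
  "is_at_infinity P \<longleftrightarrow> P coord_x < 0 \<or> P coord_y < 0"

text \<open>
  The involution \<open>(x, y) \<mapsto> (x, - y)\<close>, first on functions and then on points: the order of \<open>f\<close>
  at \<open>w(P)\<close> is the order of \<open>f \<circ> w\<close> at \<open>P\<close>.
\<close>

definition involution_fun :: "double_cover_function \<Rightarrow> double_cover_function" where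
  "involution_fun = (\<lambda>(A, B). (A, - B))"

definition involution ::
    "(double_cover_function \<Rightarrow> int) \<Rightarrow> double_cover_function \<Rightarrow> int" where
  "involution P = (\<lambda>f. P (involution_fun f))"

end

theory Submission
  imports Defs "HOL-Computational_Algebra.Computational_Algebra"
begin

text \<open>
  Write \<open>f3 = p + y / 2\<close>, where \<open>2 p\<close> is the polynomial part of the square root of \<open>F\<close> at infinity.
  Then \<open>f3\<close> and its conjugate \<open>p - y / 2\<close> have a product of degree at most two in \<open>x\<close>; as \<open>f3\<close> has order
  \<open>-3\<close> at \<open>P0\<close>, the conjugate vanishes there. Multiplying by \<open>x\<close> and subtracting the value
  gives \<open>f4\<close> and then \<open>f5\<close>. A function with poles only at \<open>P0\<close> is \<open>A + B y\<close> with polynomials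
  \<open>A\<close> and \<open>B\<close> because \<open>F\<close> is squarefree; combinations of the \<open>f\<^sub>i\<close> remove \<open>B\<close>, and what remains is a
  polynomial in \<open>x\<close> regular at \<open>w(P0)\<close>, hence constant. That \<open>F\<close> is squarefree follows from
  genus two: a double root \<open>a\<close> makes \<open>y / (x - a)\<close> integral over the affine line, and then
  every divisor satisfies \<open>l(D) \<ge> deg D\<close>.

  The function field is embedded into the Laurent series in \<open>1 / x\<close>, a field in the sense of type
  classes. Other embeddings, with \<open>x = a + t\<^sup>2\<close>, supply points above each finite value of \<open>x\<close>; the
  square makes the order of \<open>F(x)\<close> even, so that \<open>y\<close> exists.
\<close>

section \<open>Evaluation of polynomials at Laurent series and valuations\<close>

text \<open>Points are abstract valuations, so nothing about them is known in advance: neither which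
  of them lie at infinity nor that any lies over a given value of \<open>x\<close>. Uniqueness comes
  from computing the order of \<open>a + b y\<close> out of rational data. For a parameter
  \<open>u\<close> (\<open>1 / x\<close> or \<open>x - c\<close>), the leading terms in
  \<open>u\<close> of \<open>a\<close>, \<open>b\<close> and the norm are the same for every
  valuation with \<open>v u > 0\<close>. Hence two points coincide if both give \<open>u\<close>
  positive order and a suitable multiple of \<open>y\<close> the same nonzero residue, or an order
  that is the same odd multiple of half the order of \<open>u\<close>. Existence comes from Laurent
  parametrizations: a negative order along one of them yields a point at which the function has a
  pole. The inequality between \<open>l(D)\<close> and \<open>deg D\<close> is visible for multiples
  of full fibres of \<open>x\<close>, which have degree at most two and carry many explicit
  functions. It descends to smaller divisors because one more point raises the dimension by at most
  one. This last fact needs complex residues, so the genus is treated over the complex numbers,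
  while the spans are computed over \<open>K\<close>.\<close>

definition eval_fls :: "complex fls \<Rightarrow> complex poly \<Rightarrow> complex fls" where
  "eval_fls u p = poly (map_poly fls_const p) u"

lemma eval_fls_0 [simp]: "eval_fls u 0 = 0"
  by (simp add: eval_fls_def)

lemma eval_fls_pCons [simp]: "eval_fls u (pCons a p) = fls_const a + u * eval_fls u p"
  by (simp add: eval_fls_def map_poly_pCons)

lemma eval_fls_1 [simp]: "eval_fls u 1 = 1"
  by (simp add: one_pCons)

lemma eval_fls_add: "eval_fls u (p + q) = eval_fls u p + eval_fls u q"
proof (induction p arbitrary: q)
  case (pCons a p)
  then show ?case
    by (cases q) (simp add: fls_plus_const [symmetric] algebra_simps)
qed simp

lemma eval_fls_smult: "eval_fls u (smult c p) = fls_const c * eval_fls u p"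
  by (induction p) (simp_all add: algebra_simps flip: fls_const_mult_const)

lemma eval_fls_uminus: "eval_fls u (- p) = - eval_fls u p"
  using eval_fls_smult[of u "-1" p] by simp

lemma eval_fls_diff: "eval_fls u (p - q) = eval_fls u p - eval_fls u q"
  using eval_fls_add[of u p "- q"] by (simp add: eval_fls_uminus)

lemma eval_fls_mult: "eval_fls u (p * q) = eval_fls u p * eval_fls u q"
  by (induction p) (simp_all add: eval_fls_add eval_fls_smult algebra_simps)

lemma eval_fls_power: "eval_fls u (p ^ n) = eval_fls u p ^ n"
  by (induction n) (simp_all add: eval_fls_mult)

lemma eval_fls_pcompose: "eval_fls u (pcompose p q) = eval_fls (eval_fls u q) p"
  by (induction p) (simp_all add: pcompose_pCons eval_fls_add eval_fls_mult)

text \<open>Pulling out the top power turns evaluation at a pole of \<open>u\<close> into evaluation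
  of the reversed polynomial at a zero, whose constant term is the old leading coefficient.\<close>

lemma eval_fls_reflect:
  assumes "u \<noteq> 0"
  shows "eval_fls u p = u ^ degree p * eval_fls (inverse u) (reflect_poly p)"
proof -
  have m: "map_poly fls_const (reflect_poly p) = reflect_poly (map_poly fls_const p)"
    by (rule poly_eqI) (simp add: coeff_map_poly coeff_reflect_poly degree_map_poly)
  have d: "degree (map_poly fls_const p) = degree p"
    by (rule degree_map_poly) simp
  have "poly (reflect_poly (map_poly fls_const p)) (inverse u)
      = inverse u ^ degree p * poly (map_poly fls_const p) u"
    using poly_reflect_poly_nz[of "inverse u" "map_poly fls_const p"] assms d by simp
  then show ?thesis
    using assms by (simp add: eval_fls_def m field_simps)
qed

section \<open>Polynomials and rational functions over a subfield of the complex numbers\<close>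

definition poly_over :: "complex set \<Rightarrow> complex poly \<Rightarrow> bool" where
  "poly_over K p \<longleftrightarrow> range (coeff p) \<subseteq> K"

locale constants =
  fixes K :: "complex set"
  assumes K_1: "1 \<in> K"
    and K_diff: "\<And>a b. a \<in> K \<Longrightarrow> b \<in> K \<Longrightarrow> a - b \<in> K"
    and K_mult: "\<And>a b. a \<in> K \<Longrightarrow> b \<in> K \<Longrightarrow> a * b \<in> K"
    and K_inverse: "\<And>a. a \<in> K \<Longrightarrow> inverse a \<in> K"
begin

lemma K_0: "0 \<in> K"
  using K_diff[OF K_1 K_1] by simp

lemma K_uminus: "a \<in> K \<Longrightarrow> - a \<in> K"
  using K_diff[OF K_0] by force

lemma K_add: "a \<in> K \<Longrightarrow> b \<in> K \<Longrightarrow> a + b \<in> K"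
  using K_diff[OF _ K_uminus] by force

lemma K_divide: "a \<in> K \<Longrightarrow> b \<in> K \<Longrightarrow> a / b \<in> K"
  using K_mult[OF _ K_inverse] by (simp add: divide_inverse)

lemma K_power: "a \<in> K \<Longrightarrow> a ^ n \<in> K"
  by (induction n) (auto intro: K_1 K_mult)

lemma K_of_nat: "of_nat n \<in> K"
  by (induction n) (auto intro: K_0 K_1 K_add)

lemma K_numeral: "numeral n \<in> K"
  using K_of_nat[of "numeral n"] by simp

lemma K_sum: "(\<And>i. i \<in> A \<Longrightarrow> f i \<in> K) \<Longrightarrow> sum f A \<in> K"
  by (induction A rule: infinite_finite_induct) (auto intro: K_0 K_add)

lemmas K_closed = K_0 K_1 K_add K_diff K_uminus K_mult K_inverse K_divide K_power K_numeral K_sum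

lemma poly_over_0: "poly_over K 0"
  by (simp add: poly_over_def K_0)

lemma poly_over_pCons: "poly_over K (pCons a p) \<longleftrightarrow> a \<in> K \<and> poly_over K p"
  by (auto simp: poly_over_def image_subset_iff coeff_pCons split: nat.splits)

lemma poly_over_1: "poly_over K 1"
  by (simp add: one_pCons poly_over_pCons K_1 poly_over_0)

lemma poly_over_add: "poly_over K p \<Longrightarrow> poly_over K q \<Longrightarrow> poly_over K (p + q)"
  and poly_over_diff: "poly_over K p \<Longrightarrow> poly_over K q \<Longrightarrow> poly_over K (p - q)"
  and poly_over_uminus: "poly_over K p \<Longrightarrow> poly_over K (- p)"
  by (auto simp: poly_over_def image_subset_iff intro: K_closed)

lemma poly_over_mult: "poly_over K p \<Longrightarrow> poly_over K q \<Longrightarrow> poly_over K (p * q)"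
  by (auto simp: poly_over_def image_subset_iff coeff_mult intro!: K_closed)

lemma poly_over_reflect: "poly_over K p \<Longrightarrow> poly_over K (reflect_poly p)"
  by (auto simp: poly_over_def image_subset_iff coeff_reflect_poly K_0)

text \<open>The leading coefficient of \<open>h\<close> is a quotient of two leading coefficients in
  \<open>K\<close>; subtracting the leading monomial of \<open>h\<close> lowers its degree. This
  descent is what later shows that polynomials and constants found over the complex numbers are
  defined over \<open>K\<close>.\<close>

lemma poly_over_factor:
  assumes "poly_over K q" "q \<noteq> 0" "poly_over K (q * h)"
  shows "poly_over K h"
  using assms(3)
\<comment> \<open>The measure separates the zero polynomial from nonzero constants, so that removing
  the last monomial also counts as a decrease.\<close>
proof (induction h rule: measure_induct_rule[of "\<lambda>h. if h = 0 then 0 else Suc (degree h)"])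
  case (less h)
  show ?case
  proof (cases "h = 0")
    case True
    then show ?thesis by (simp add: poly_over_0)
  next
    case False
    define c where "c = lead_coeff h"
    have "lead_coeff (q * h) = lead_coeff q * c"
      by (simp add: lead_coeff_mult c_def)
    moreover have "lead_coeff (q * h) \<in> K" "lead_coeff q \<in> K"
      using less.prems assms(1) by (auto simp: poly_over_def)
    ultimately have c: "c \<in> K"
      using K_divide[of "lead_coeff (q * h)" "lead_coeff q"] assms(2) by simp
    define m where "m = monom c (degree h)"
    have m: "poly_over K m"
      by (auto simp: poly_over_def m_def c K_0)
    have "coeff (h - m) i = 0" if "i \<ge> degree h" for i
      using that by (cases "i = degree h") (auto simp: m_def c_def coeff_eq_0)
    then have "h - m = 0 \<or> degree (h - m) < degree h"
      by (metis leading_coeff_0_iff not_le)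
    moreover have "poly_over K (q * (h - m))"
      using less.prems assms(1) m
      by (simp add: right_diff_distrib poly_over_diff poly_over_mult)
    ultimately have "poly_over K (h - m)"
      using less.IH[of "h - m"] False by (auto simp: poly_over_0)
    then show ?thesis
      using poly_over_add[OF _ m, of "h - m"] by simp
  qed
qed

text \<open>The field \<open>K(u)\<close> inside the Laurent series. The condition is on the value
  of the denominator, so the set makes sense without knowing that \<open>u\<close> is
  transcendental.\<close>

definition Rat :: "complex fls \<Rightarrow> complex fls set" where
  "Rat u = {eval_fls u p / eval_fls u q | p q. poly_over K p \<and> poly_over K q \<and> eval_fls u q \<noteq> 0}"

lemma RatI:
  "poly_over K p \<Longrightarrow> poly_over K q \<Longrightarrow> eval_fls u q \<noteq> 0 \<Longrightarrow> eval_fls u p / eval_fls u q \<in> Rat u"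
  unfolding Rat_def by blast

lemma RatE:
  assumes "a \<in> Rat u"
  obtains p q where "poly_over K p" "poly_over K q" "eval_fls u q \<noteq> 0" "a = eval_fls u p / eval_fls u q"
  using assms unfolding Rat_def by blast

lemma Rat_eval: "poly_over K p \<Longrightarrow> eval_fls u p \<in> Rat u"
  using RatI[of p 1 u] by (simp add: poly_over_1)

lemma Rat_const: "c \<in> K \<Longrightarrow> fls_const c \<in> Rat u"
  using Rat_eval[of "[:c:]" u] by (simp add: poly_over_pCons poly_over_0)

lemma Rat_self: "u \<in> Rat u"
  using Rat_eval[of "[:0, 1:]" u] by (simp add: poly_over_pCons poly_over_0 K_closed)

lemma Rat_mult: "a \<in> Rat u \<Longrightarrow> b \<in> Rat u \<Longrightarrow> a * b \<in> Rat u"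
  by (elim RatE) (metis RatI eval_fls_mult mult_eq_0_iff poly_over_mult times_divide_times_eq)

lemma Rat_diff:
  assumes "a \<in> Rat u" "b \<in> Rat u"
  shows "a - b \<in> Rat u"
proof -
  obtain p q where pq: "poly_over K p" "poly_over K q" "eval_fls u q \<noteq> 0" "a = eval_fls u p / eval_fls u q"
    using assms(1) by (rule RatE)
  obtain r s where rs: "poly_over K r" "poly_over K s" "eval_fls u s \<noteq> 0" "b = eval_fls u r / eval_fls u s"
    using assms(2) by (rule RatE)
  have "a - b = eval_fls u (p * s - r * q) / eval_fls u (q * s)"
    unfolding pq(4) rs(4) eval_fls_mult eval_fls_diff by (rule diff_frac_eq) (use pq rs in simp_all)
  moreover have "\<dots> \<in> Rat u"
    using pq rs by (intro RatI poly_over_diff poly_over_mult) (simp_all add: eval_fls_mult)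
  ultimately show ?thesis by simp
qed

lemma Rat_0: "0 \<in> Rat u" and Rat_1: "1 \<in> Rat u"
  using Rat_const[of 0 u] Rat_const[of 1 u] by (simp_all add: K_closed)

lemma Rat_add: "a \<in> Rat u \<Longrightarrow> b \<in> Rat u \<Longrightarrow> a + b \<in> Rat u"
  using Rat_diff[of a u "0 - b"] Rat_diff[OF Rat_0, of b] by simp

lemma Rat_inverse: "a \<in> Rat u \<Longrightarrow> inverse a \<in> Rat u"
proof (elim RatE)
  fix p q
  assume "poly_over K p" "poly_over K q" "eval_fls u q \<noteq> 0" "a = eval_fls u p / eval_fls u q"
  then show ?thesis
    using RatI[of q p u] Rat_0[of u] by (cases "eval_fls u p = 0") auto
qed

lemma Rat_divide: "a \<in> Rat u \<Longrightarrow> b \<in> Rat u \<Longrightarrow> a / b \<in> Rat u"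
  by (simp add: divide_inverse Rat_mult Rat_inverse)

lemma Rat_power: "a \<in> Rat u \<Longrightarrow> a ^ n \<in> Rat u"
  by (induction n) (auto intro: Rat_1 Rat_mult)

lemma eval_in_Rat: "poly_over K p \<Longrightarrow> w \<in> Rat u \<Longrightarrow> eval_fls w p \<in> Rat u"
  by (induction p) (auto simp: poly_over_pCons intro: Rat_0 Rat_add Rat_mult Rat_const)

text \<open>Lets functions of \<open>x\<close> be rewritten as functions of a local parameter such
  as \<open>1 / x\<close> or \<open>x - c\<close>.\<close>

lemma Rat_trans: "a \<in> Rat w \<Longrightarrow> w \<in> Rat u \<Longrightarrow> a \<in> Rat u"
  by (elim RatE[of a]) (simp add: Rat_divide eval_in_Rat)

end

section \<open>Fields with a valuation that is trivial on the constants\<close>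

locale valued = constants +
  fixes E :: "complex fls set" and v :: "complex fls \<Rightarrow> int"
  assumes E_const: "c \<in> K \<Longrightarrow> fls_const c \<in> E"
    and E_diff: "a \<in> E \<Longrightarrow> b \<in> E \<Longrightarrow> a - b \<in> E"
    and E_mult: "a \<in> E \<Longrightarrow> b \<in> E \<Longrightarrow> a * b \<in> E"
    and E_inverse: "a \<in> E \<Longrightarrow> inverse a \<in> E"
    and v_mult: "a \<in> E \<Longrightarrow> b \<in> E \<Longrightarrow> a \<noteq> 0 \<Longrightarrow> b \<noteq> 0 \<Longrightarrow> v (a * b) = v a + v b"
    and v_add: "a \<in> E \<Longrightarrow> b \<in> E \<Longrightarrow> a \<noteq> 0 \<Longrightarrow> b \<noteq> 0 \<Longrightarrow> a + b \<noteq> 0 \<Longrightarrow> min (v a) (v b) \<le> v (a + b)"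
    and v_const: "c \<in> K \<Longrightarrow> c \<noteq> 0 \<Longrightarrow> v (fls_const c) = 0"
begin

lemma E_0: "0 \<in> E" and E_1: "1 \<in> E"
  using E_const[OF K_0] E_const[OF K_1] by simp_all

lemma E_uminus: "a \<in> E \<Longrightarrow> - a \<in> E"
  using E_diff[OF E_0] by force

lemma E_add: "a \<in> E \<Longrightarrow> b \<in> E \<Longrightarrow> a + b \<in> E"
  using E_diff[OF _ E_uminus] by force

lemma E_divide: "a \<in> E \<Longrightarrow> b \<in> E \<Longrightarrow> a / b \<in> E"
  using E_mult[OF _ E_inverse] by (simp add: divide_inverse)

lemma E_power: "a \<in> E \<Longrightarrow> a ^ n \<in> E"
  by (induction n) (auto intro: E_1 E_mult)

lemma E_powi: "a \<in> E \<Longrightarrow> a powi n \<in> E"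
  by (simp add: power_int_def E_power E_inverse)

lemmas E_closed = E_0 E_1 E_add E_diff E_uminus E_mult E_inverse E_divide E_power E_powi E_const

lemma v_1: "v 1 = 0"
  using v_const[OF K_1] by simp

lemma v_uminus: "a \<in> E \<Longrightarrow> v (- a) = v a"
  using v_mult[of "- 1" a] v_const[OF K_uminus[OF K_1]] E_uminus[OF E_1]
  by (cases "a = 0") auto

lemma v_inverse: "a \<in> E \<Longrightarrow> a \<noteq> 0 \<Longrightarrow> v (inverse a) = - v a"
  using v_mult[of a "inverse a"] by (simp add: E_inverse v_1)

lemma v_divide: "a \<in> E \<Longrightarrow> b \<in> E \<Longrightarrow> a \<noteq> 0 \<Longrightarrow> b \<noteq> 0 \<Longrightarrow> v (a / b) = v a - v b"
  by (simp add: divide_inverse v_mult v_inverse E_inverse)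

lemma v_power: "a \<in> E \<Longrightarrow> a \<noteq> 0 \<Longrightarrow> v (a ^ n) = int n * v a"
  by (induction n) (simp_all add: v_1 v_mult E_power algebra_simps)

lemma v_powi: "a \<in> E \<Longrightarrow> a \<noteq> 0 \<Longrightarrow> v (a powi n) = n * v a"
  by (simp add: power_int_def v_power v_inverse E_inverse)

text \<open>Zero counts as having infinite order, and membership in \<open>E\<close> is included;
  sums and products can then be estimated without distinguishing whether they vanish.\<close>

definition vge :: "int \<Rightarrow> complex fls \<Rightarrow> bool" where
  "vge n a \<longleftrightarrow> a \<in> E \<and> (a = 0 \<or> n \<le> v a)"

lemma vge_E: "vge n a \<Longrightarrow> a \<in> E"
  by (simp add: vge_def)

lemma vge_0: "vge n 0"
  by (simp add: vge_def E_0)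

lemma vge_mono: "vge n a \<Longrightarrow> m \<le> n \<Longrightarrow> vge m a"
  by (auto simp: vge_def)

lemma vge_self: "a \<in> E \<Longrightarrow> n \<le> v a \<Longrightarrow> vge n a"
  by (simp add: vge_def)

lemma vge_const: "c \<in> K \<Longrightarrow> n \<le> 0 \<Longrightarrow> vge n (fls_const c)"
  using v_const[of c] by (cases "c = 0") (auto simp: vge_def E_const E_0)

lemma vge_uminus: "vge n a \<Longrightarrow> vge n (- a)"
  by (auto simp: vge_def E_uminus v_uminus)

lemma vge_add: "vge n a \<Longrightarrow> vge n b \<Longrightarrow> vge n (a + b)"
  using v_add[of a b] by (cases "a = 0"; cases "b = 0"; cases "a + b = 0") (auto simp: vge_def E_add E_0)

lemma vge_diff: "vge n a \<Longrightarrow> vge n b \<Longrightarrow> vge n (a - b)"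
  using vge_add[OF _ vge_uminus, of n a b] by simp

lemma vge_mult: "vge m a \<Longrightarrow> vge n b \<Longrightarrow> vge (m + n) (a * b)"
  using v_mult[of a b] by (cases "a = 0"; cases "b = 0") (auto simp: vge_def E_mult)

lemma vge_divide: "vge m a \<Longrightarrow> b \<in> E \<Longrightarrow> b \<noteq> 0 \<Longrightarrow> vge (m - v b) (a / b)"
  using v_divide[of a b] by (cases "a = 0") (auto simp: vge_def E_divide)

lemma vge_power: "vge m a \<Longrightarrow> vge (int n * m) (a ^ n)"
  by (cases "a = 0"; cases "n = 0")
    (auto simp: vge_def E_closed v_1 v_power mult_left_mono zero_power)

text \<open>The strict case of the ultrametric inequality: otherwise \<open>a = (a + b) - b\<close>
  would have order above its own.\<close>

lemma v_add_eq:
  assumes "a \<in> E" "a \<noteq> 0" "vge (v a + 1) b"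
  shows "a + b \<noteq> 0" "v (a + b) = v a"
proof -
  show nz: "a + b \<noteq> 0"
  proof
    assume "a + b = 0"
    then have "b = - a" by (simp add: add_eq_0_iff)
    then show False using assms v_uminus[of a] by (auto simp: vge_def)
  qed
  have "vge (v a) (a + b)"
    using assms by (intro vge_add) (auto intro: vge_self vge_mono)
  then have "v a \<le> v (a + b)" using nz by (simp add: vge_def)
  moreover have "\<not> v a < v (a + b)"
  proof
    assume "v a < v (a + b)"
    then have "vge (v a + 1) (a + b - b)"
      using assms by (intro vge_diff) (auto simp: vge_def E_closed)
    then show False using assms by (simp add: vge_def)
  qed
  ultimately show "v (a + b) = v a" by simp
qed

text \<open>No residue field is constructed: \<open>vge 1 (a - fls_const c)\<close> says that
  \<open>a\<close> has residue \<open>c\<close>, and a nonzero residue makes \<open>a\<close> a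
  unit.\<close>

lemma v_unit:
  assumes "c \<in> K" "c \<noteq> 0" "vge 1 (a - fls_const c)"
  shows "a \<noteq> 0" "v a = 0" "a \<in> E"
  using v_add_eq[of "fls_const c" "a - fls_const c"] assms E_add[OF vge_E[OF assms(3)] E_const[of c]]
  by (simp_all add: v_const E_const)

lemma vge_of_residue: "c \<in> K \<Longrightarrow> vge 1 (a - fls_const c) \<Longrightarrow> vge 0 a"
  using vge_add[OF vge_mono[of 1 "a - fls_const c" 0] vge_const[of c 0]] by simp

lemma residue_mult:
  assumes "c \<in> K" "d \<in> K" "vge 1 (a - fls_const c)" "vge 1 (b - fls_const d)"
  shows "vge 1 (a * b - fls_const (c * d))"
proof -
  have "a * b - fls_const (c * d) = a * (b - fls_const d) + fls_const d * (a - fls_const c)"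
    by (simp add: algebra_simps flip: fls_const_mult_const)
  moreover have "vge (0 + 1) (a * (b - fls_const d))" "vge (0 + 1) (fls_const d * (a - fls_const c))"
    by (intro vge_mult vge_const vge_of_residue[OF assms(1,3)] assms order_refl)+
  ultimately show ?thesis by (metis vge_add add_0)
qed

lemma residue_add:
  assumes "vge 1 (a - fls_const c)" "vge 1 (b - fls_const d)"
  shows "vge 1 (a + b - fls_const (c + d))"
  using vge_add[OF assms] by (simp add: algebra_simps flip: fls_plus_const)

lemma residue_inverse:
  assumes "c \<in> K" "c \<noteq> 0" "vge 1 (a - fls_const c)"
  shows "vge 1 (inverse a - fls_const (inverse c))"
proof -
  note a = v_unit[OF assms]
  have "fls_const (inverse c) * fls_const c = 1"
    using assms by (simp del: fls_const_mult_const add: fls_const_mult_const)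
  then have "inverse a - fls_const (inverse c) = (fls_const (- inverse c) * (a - fls_const c)) / a"
    using a by (simp add: field_simps del: fls_const_mult_const)
  moreover have "vge (0 + 1 - v a) ((fls_const (- inverse c) * (a - fls_const c)) / a)"
    using a assms by (intro vge_divide vge_mult vge_const K_closed) auto
  ultimately show ?thesis using a by simp
qed

text \<open>All terms but the constant one contain a factor \<open>u\<close>. The induction also
  carries \<open>vge 0\<close>, which is needed for the cofactor of \<open>u\<close>.\<close>

lemma residue_eval:
  assumes "poly_over K p" "vge 1 u"
  shows "vge 1 (eval_fls u p - fls_const (coeff p 0))"
proof -
  have "vge 1 (eval_fls u p - fls_const (coeff p 0))" "vge 0 (eval_fls u p)"
    using assms(1)
  proof (induction p)
    case 0
    case 1 show ?case by (simp add: vge_0)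
    case 2 show ?case by (simp add: vge_0)
  next
    case (pCons a p)
    {
      case 1
      have "vge (1 + 0) (u * eval_fls u p)"
        using pCons 1 assms by (intro vge_mult) (auto simp: poly_over_pCons)
      then show ?case by simp
    } note * = this
    case 2
    then show ?case using * by (intro vge_of_residue[of a]) (auto simp: poly_over_pCons)
  qed
  then show ?thesis by simp
qed

text \<open>A monomial of degree \<open>i\<close> with \<open>i \<le> n\<close> has order
  \<open>i * v x\<close>, which is at least \<open>n * v x\<close> because \<open>v x\<close> is not
  positive.\<close>

lemma vge_eval_neg:
  assumes "poly_over K p" "degree p \<le> n" "x \<in> E" "v x \<le> 0" "x \<noteq> 0"
  shows "vge (int n * v x) (eval_fls x p)"
  using assms(1,2)
proof (induction p arbitrary: n)
  case 0
  then show ?case by (simp add: vge_0)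
next
  case (pCons a p)
  have a: "vge (int n * v x) (fls_const a)"
    using pCons assms by (intro vge_const) (auto simp: poly_over_pCons mult_nonneg_nonpos)
  show ?case
  proof (cases "p = 0")
    case True
    with a show ?thesis by simp
  next
    case False
    then obtain m where m: "n = Suc m" "degree p \<le> m"
      using pCons by (cases n) auto
    then have "vge (v x + int m * v x) (x * eval_fls x p)"
      using pCons assms by (intro vge_mult) (auto simp: vge_def poly_over_pCons)
    then show ?thesis
      using a m by (auto intro!: vge_add simp: algebra_simps)
  qed
qed

end

section \<open>Orders of functions at ramified and unramified places\<close>

context valued
begin

lemma eval_in_E: "poly_over K p \<Longrightarrow> u \<in> E \<Longrightarrow> eval_fls u p \<in> E"
  by (induction p) (auto simp: poly_over_pCons E_closed)

lemma Rat_in_E: "a \<in> Rat u \<Longrightarrow> u \<in> E \<Longrightarrow> a \<in> E"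
  by (elim RatE) (simp add: eval_in_E E_divide)

end

context constants
begin

text \<open>Expresses \<open>a = r u^m + higher terms\<close>. Quantifying over all valuations with
  \<open>v u > 0\<close> makes \<open>m\<close> and \<open>r\<close> depend on \<open>a\<close> and
  \<open>u\<close> only, which is what allows two different points to be compared. If
  \<open>r = 0\<close>, it says that the order exceeds that of \<open>u^m\<close>.\<close>

definition has_leading :: "complex fls \<Rightarrow> complex fls \<Rightarrow> int \<Rightarrow> complex \<Rightarrow> bool" where
  "has_leading u a m r \<longleftrightarrow>
     (\<forall>E v. valued K E v \<longrightarrow> u \<in> E \<longrightarrow> 0 < v u \<longrightarrow> valued.vge E v 1 (a / u powi m - fls_const r))"

lemma has_leadingD:
  "has_leading u a m r \<Longrightarrow> valued K E v \<Longrightarrow> u \<in> E \<Longrightarrow> 0 < v u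
    \<Longrightarrow> valued.vge E v 1 (a / u powi m - fls_const r)"
  unfolding has_leading_def by blast

lemma leading_v:
  assumes "has_leading u a m r" "r \<in> K" "r \<noteq> 0" "u \<noteq> 0" "valued K E v" "u \<in> E" "0 < v u"
  shows "a \<noteq> 0" "v a = m * v u" "a \<in> E"
proof -
  interpret valued K E v by fact
  have *: "vge 1 (a / u powi m - fls_const r)"
    using assms by (intro has_leadingD) auto
  note u = v_unit[OF assms(2,3) *]
  show "a \<noteq> 0" using u by auto
  have a: "a = (a / u powi m) * u powi m"
    using assms by simp
  show "a \<in> E"
    using E_mult[OF u(3) E_powi[OF assms(6), of m]] a by simp
  show "v a = m * v u"
    using u assms by (subst a, subst v_mult) (auto simp: E_powi v_powi)
qed

text \<open>Here \<open>m\<close> is the multiplicity of the root 0 of \<open>p\<close>, and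
  \<open>r\<close> is the lowest nonzero coefficient.\<close>

lemma leading_eval:
  assumes "poly_over K p" "p \<noteq> 0" "u \<noteq> 0"
  shows "\<exists>m r. r \<in> K \<and> r \<noteq> 0 \<and> has_leading u (eval_fls u p) m r"
  using assms(1,2)
proof (induction p)
  case (pCons a p)
  show ?case
  proof (cases "a = 0")
    case True
    then obtain m r where r: "r \<in> K" "r \<noteq> 0" "has_leading u (eval_fls u p) m r"
      using pCons by (auto simp: poly_over_pCons)
    then have "has_leading u (eval_fls u (pCons a p)) (m + 1) r"
      using True assms(3) by (simp add: has_leading_def power_int_add)
    then show ?thesis using r by blast
  next
    case False
    have "has_leading u (eval_fls u (pCons a p)) 0 a"
      unfolding has_leading_def
    proof (intro allI impI)
      fix E v assume *: "valued K E v" "u \<in> E" "0 < v u"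
      interpret valued K E v by fact
      show "vge 1 (eval_fls u (pCons a p) / u powi 0 - fls_const a)"
        using residue_eval[OF pCons.prems(1), of u] * by (auto simp: vge_def)
    qed
    then show ?thesis using False pCons by (auto simp: poly_over_pCons)
  qed
qed simp

lemma leading_Rat:
  assumes "a \<in> Rat u" "a \<noteq> 0" "u \<noteq> 0"
  obtains m r where "r \<in> K" "r \<noteq> 0" "has_leading u a m r"
proof -
  obtain p q where pq: "poly_over K p" "poly_over K q" "eval_fls u q \<noteq> 0" "a = eval_fls u p / eval_fls u q"
    using assms(1) by (rule RatE)
  obtain m r where r: "r \<in> K" "r \<noteq> 0" "has_leading u (eval_fls u p) m r"
    using leading_eval[of p u] pq assms(2,3) by (metis div_0 eval_fls_0)
  obtain n s where s: "s \<in> K" "s \<noteq> 0" "has_leading u (eval_fls u q) n s"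
    using leading_eval[of q u] pq assms(2,3) by (metis eval_fls_0)
  have "has_leading u a (m - n) (r * inverse s)"
    unfolding has_leading_def
  proof (intro allI impI)
    fix E v assume *: "valued K E v" "u \<in> E" "0 < v u"
    interpret valued K E v by fact
    have "vge 1 ((eval_fls u p / u powi m) * inverse (eval_fls u q / u powi n) - fls_const (r * inverse s))"
      using r s * by (intro residue_mult residue_inverse has_leadingD) (auto intro: K_closed)
    moreover have "(eval_fls u p / u powi m) * inverse (eval_fls u q / u powi n) = a / u powi (m - n)"
      using assms by (simp add: pq(4) power_int_diff field_simps)
    ultimately show "vge 1 (a / u powi (m - n) - fls_const (r * inverse s))" by simp
  qed
  then show ?thesis using r s by (intro that[of "r * inverse s"]) (auto intro: K_closed)
qed

text \<open>The least exponent of the family serves as a common one: after division by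
  \<open>u^m\<close> all members are integral and not all have residue zero.\<close>

lemma leading_family:
  assumes "finite S" "S \<subseteq> Rat u" "a0 \<in> S" "a0 \<noteq> 0" "u \<noteq> 0"
  obtains m r where "\<And>a. a \<in> S \<Longrightarrow> r a \<in> K" "\<And>a. a \<in> S \<Longrightarrow> has_leading u a m (r a)"
    "\<exists>a \<in> S. r a \<noteq> 0"
proof -
  define T where "T = S - {0}"
  have "\<forall>a \<in> T. \<exists>m r. r \<in> K \<and> r \<noteq> 0 \<and> has_leading u a m r"
    using assms leading_Rat unfolding T_def by blast
  then obtain n \<rho> where n: "\<And>a. a \<in> T \<Longrightarrow> \<rho> a \<in> K \<and> \<rho> a \<noteq> 0 \<and> has_leading u a (n a) (\<rho> a)"
    by metis
  have T: "finite (n ` T)" "n ` T \<noteq> {}"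
    using assms by (auto simp: T_def)
  define m where "m = Min (n ` T)"
  define r where "r a = (if a \<in> T \<and> n a = m then \<rho> a else 0)" for a
  have "m \<in> n ` T"
    unfolding m_def by (rule Min_in) (use T in auto)
  then have "\<exists>a \<in> S. r a \<noteq> 0"
    using n by (auto simp: r_def T_def)
  moreover have "r a \<in> K" for a
    using n by (auto simp: r_def K_0)
  moreover have "has_leading u a m (r a)" if "a \<in> S" for a
  proof (cases "a \<in> T \<and> n a \<noteq> m")
    case False
    then show ?thesis using n[of a] that
      by (cases "a = 0") (auto simp: r_def T_def has_leading_def valued.vge_0)
  next
    case True
    then have "m < n a"
      using T(1) by (simp add: m_def order.not_eq_order_implies_strict)
    show ?thesis
      unfolding has_leading_def
    proof (intro allI impI)
      fix E v assume *: "valued K E v" "u \<in> E" "0 < v u"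
      interpret valued K E v by fact
      have eq: "a / u powi m = (a / u powi n a) * u powi (n a - m)"
        using assms by (simp add: power_int_diff field_simps)
      have "vge 0 (a / u powi n a)"
        using has_leadingD[of u a "n a" "\<rho> a" E v] n[of a] True * by (auto intro: vge_of_residue)
      moreover have "0 < (n a - m) * v u"
        using * \<open>m < n a\<close> by simp
      then have "vge 1 (u powi (n a - m))"
        using * assms by (intro vge_self) (simp_all add: E_powi v_powi)
      ultimately have "vge (0 + 1) (a / u powi m)"
        unfolding eq by (rule vge_mult)
      then show "vge 1 (a / u powi m - fls_const (r a))"
        using True by (simp add: r_def)
    qed
  qed
  ultimately show ?thesis using that by blast
qed

text \<open>After division by the common power \<open>u^m\<close>, the elements
  \<open>a + b z\<close> and \<open>a - b z\<close> have residues \<open>r a + r b * s\<close> and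
  \<open>r a - r b * s\<close>, which cannot both vanish as \<open>s\<close> is nonzero. If the
  first vanishes, the conjugate has order \<open>m * v u\<close>, and the order of
  \<open>a + b z\<close> is that of the norm, a function of \<open>u\<close>, minus this. The factor
  \<open>n\<close> is therefore common to all the valuations considered.\<close>

lemma unramified_order:
  assumes "a \<in> Rat u" "b \<in> Rat u" "z\<^sup>2 \<in> Rat u" "s \<in> K" "s \<noteq> 0" "u \<noteq> 0"
    and nz: "a + b * z \<noteq> 0" "a - b * z \<noteq> 0"
  obtains n where "\<And>E v. valued K E v \<Longrightarrow> u \<in> E \<Longrightarrow> 0 < v u \<Longrightarrow> valued.vge E v 1 (z - fls_const s)
    \<Longrightarrow> v (a + b * z) = n * v u"
proof -
  have "a \<noteq> 0 \<or> b \<noteq> 0" using nz by auto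
  then obtain c where c: "c \<in> {a, b}" "c \<noteq> 0" by blast
  have fin: "finite {a, b}" "{a, b} \<subseteq> Rat u" using assms by simp_all
  obtain m r where mr: "\<And>c. c \<in> {a, b} \<Longrightarrow> r c \<in> K" "\<And>c. c \<in> {a, b} \<Longrightarrow> has_leading u c m (r c)"
    "\<exists>c \<in> {a, b}. r c \<noteq> 0"
    by (rule leading_family[OF fin c \<open>u \<noteq> 0\<close>]) (rule that)
  have nf: "a ^ 2 - b ^ 2 * z ^ 2 = (a + b * z) * (a - b * z)"
    by (simp add: algebra_simps power2_eq_square)
  have "a ^ 2 - b ^ 2 * z ^ 2 \<in> Rat u"
    by (intro Rat_diff Rat_mult Rat_power assms)
  moreover have "a ^ 2 - b ^ 2 * z ^ 2 \<noteq> 0"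
    unfolding nf using nz by simp
  ultimately obtain k t where k: "t \<in> K" "t \<noteq> 0" "has_leading u (a ^ 2 - b ^ 2 * z ^ 2) k t"
    using leading_Rat assms by blast
  have conj: "v (a + \<sigma> * (b * z)) = m * v u"
    if "valued K E v" "u \<in> E" "0 < v u" "valued.vge E v 1 (z - fls_const s)"
      "\<sigma> = fls_const \<tau>" "\<tau> \<in> K" "r a + \<tau> * (r b * s) \<noteq> 0" for E v \<sigma> \<tau>
  proof -
    interpret valued K E v by fact
    have "vge 1 (a / u powi m + fls_const \<tau> * (b / u powi m * z) - fls_const (r a + \<tau> * (r b * s)))"
      using mr that assms
      by (intro residue_add residue_mult has_leadingD) (auto intro: K_closed vge_0)
    moreover have "a / u powi m + fls_const \<tau> * (b / u powi m * z) = (a + \<sigma> * (b * z)) / u powi m"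
      using that by (simp add: field_simps add_divide_distrib)
    ultimately have *: "vge 1 ((a + \<sigma> * (b * z)) / u powi m - fls_const (r a + \<tau> * (r b * s)))"
      by simp
    have "r a + \<tau> * (r b * s) \<in> K"
      using mr that assms by (intro K_closed) auto
    note un = v_unit[OF this that(7) *]
    have "a + \<sigma> * (b * z) = (a + \<sigma> * (b * z)) / u powi m * u powi m"
      using assms by simp
    then have "v (a + \<sigma> * (b * z)) = v ((a + \<sigma> * (b * z)) / u powi m) + v (u powi m)"
      using un assms that by (metis E_powi power_int_eq_0_iff v_mult)
    then show ?thesis using un that assms by (simp add: v_powi)
  qed
  show ?thesis
  proof (cases "r a + 1 * (r b * s) = 0")
    case False
    show ?thesis
      using conj[OF _ _ _ _ _ K_1 False, of _ _ 1] by (intro that[of m]) simp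
  next
    case True
    have "r a + (- 1) * (r b * s) \<noteq> 0"
    proof
      assume "r a + (- 1) * (r b * s) = 0"
      then have "r a = r b * s" by simp
      with True have "r b * s + r b * s = 0" by simp
      then have "r b = 0" using assms(5) by simp
      with \<open>r a = r b * s\<close> show False using mr(3) by simp
    qed
    note cj = conj[OF _ _ _ _ _ K_uminus[OF K_1] this, of _ _ "- 1"]
    show ?thesis
    proof (rule that[of "k - m"])
      fix E v
      assume *: "valued K E v" "u \<in> E" "0 < v u" "valued.vge E v 1 (z - fls_const s)"
      interpret valued K E v by fact
      have E: "a \<in> E" "b \<in> E" "z \<in> E"
        using Rat_in_E[OF assms(1)] Rat_in_E[OF assms(2)] vge_of_residue[of s z] vge_E assms(4) * by blast+
      have "v (a - b * z) = m * v u"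
        using cj[OF *] by simp
      moreover have "v (a ^ 2 - b ^ 2 * z ^ 2) = k * v u"
        using leading_v(2)[OF k(3,1,2) assms(6) *(1-3)] .
      moreover have "v (a ^ 2 - b ^ 2 * z ^ 2) = v (a + b * z) + v (a - b * z)"
        unfolding nf using nz E by (intro v_mult E_closed) auto
      ultimately show "v (a + b * z) = (k - m) * v u"
        by (simp add: algebra_simps)
    qed
  qed
qed

text \<open>The doubled orders of \<open>a\<close> and \<open>b z\<close> are \<open>2 m\<close> and
  \<open>2 l + j\<close> times \<open>v u\<close>. For odd \<open>j\<close> they never tie, so the
  smaller one is the order of the sum. Doubling avoids half-integers.\<close>

lemma ramified_order:
  assumes "a \<in> Rat u" "b \<in> Rat u" "z \<noteq> 0" "u \<noteq> 0" "odd j" and nz: "a + b * z \<noteq> 0"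
  obtains n where "\<And>E v. valued K E v \<Longrightarrow> u \<in> E \<Longrightarrow> 0 < v u \<Longrightarrow> z \<in> E \<Longrightarrow> 2 * v z = j * v u
    \<Longrightarrow> 2 * v (a + b * z) = n * v u"
proof -
  consider "b = 0" | "a = 0" "b \<noteq> 0" | "a \<noteq> 0" "b \<noteq> 0" by blast
  then show ?thesis
  proof cases
    case 1
    then obtain m r where r: "r \<in> K" "r \<noteq> 0" "has_leading u a m r"
      using leading_Rat[of a u] assms by (metis add_0 add.right_neutral mult_zero_left)
    show ?thesis
      using leading_v(2)[OF r(3,1,2) assms(4)] 1 by (intro that[of "2 * m"]) simp
  next
    case 2
    then obtain m r where r: "r \<in> K" "r \<noteq> 0" "has_leading u b m r"
      using leading_Rat[of b u] assms by (metis add_0 add.right_neutral mult_zero_left)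
    show ?thesis
    proof (rule that[of "2 * m + j"])
      fix E v assume *: "valued K E v" "u \<in> E" "0 < v u" "z \<in> E" "2 * v z = j * v u"
      then show "2 * v (a + b * z) = (2 * m + j) * v u"
        using leading_v[OF r(3,1,2) assms(4) *(1-3)] 2 valued.v_mult[OF *(1), of b z] assms
        by (simp add: algebra_simps)
    qed
  next
    case 3
    then obtain m r where r: "r \<in> K" "r \<noteq> 0" "has_leading u a m r"
      using leading_Rat[of a u] assms by (metis add_0 add.right_neutral mult_zero_left)
    obtain l t where t: "t \<in> K" "t \<noteq> 0" "has_leading u b l t"
      using leading_Rat[of b u] assms 3 by (metis add_0 add.right_neutral mult_zero_left)
    show ?thesis
    proof (rule that[of "min (2 * m) (2 * l + j)"])
      fix E v assume *: "valued K E v" "u \<in> E" "0 < v u" "z \<in> E" "2 * v z = j * v u"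
      interpret valued K E v by fact
      note a = leading_v[OF r(3,1,2) assms(4) *(1-3)]
      note b = leading_v[OF t(3,1,2) assms(4) *(1-3)]
      have bz: "2 * v (b * z) = (2 * l + j) * v u" "b * z \<in> E" "b * z \<noteq> 0"
        using b assms * by (simp_all add: v_mult algebra_simps E_mult)
      have "2 * m \<noteq> 2 * l + j" using \<open>odd j\<close> by presburger
      then consider "2 * m < 2 * l + j" | "2 * l + j < 2 * m" by linarith
      then show "2 * v (a + b * z) = min (2 * m) (2 * l + j) * v u"
      proof cases
        case 1
        then have "2 * m * v u < (2 * l + j) * v u" using * by simp
        then have "v a < v (b * z)" using a bz by linarith
        then have "v (a + b * z) = v a"
          using v_add_eq(2)[of a "b * z"] a bz by (simp add: vge_def)
        then show ?thesis using 1 a by simp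
      next
        case 2
        then have "(2 * l + j) * v u < 2 * m * v u" using * by simp
        then have "v (b * z) < v a" using a bz by linarith
        then have "v (b * z + a) = v (b * z)"
          using v_add_eq(2)[of "b * z" a] a bz by (simp add: vge_def)
        then show ?thesis using 2 bz by (simp add: add.commute)
      qed
    qed
  qed
qed

text \<open>
  The minimal polynomial of \<open>a + b z\<close> over the rational function field, made primitive, reduces to
  a nonzero polynomial of degree at most two, which splits over the constants.
\<close>

lemma residue_exists:
  assumes "K = UNIV" "a \<in> Rat u" "b \<in> Rat u" "z\<^sup>2 \<in> Rat u" "u \<noteq> 0"
    and val: "valued K E v" "u \<in> E" "0 < v u" "z \<in> E" and f: "valued.vge E v 0 (a + b * z)"
  obtains c where "valued.vge E v 1 (a + b * z - fls_const c)"
proof -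
  interpret valued K E v by fact
  define f where "f = a + b * z"
  define t where "t = - (2 * a)"
  define n where "n = a ^ 2 - b ^ 2 * z ^ 2"
  have nR: "n \<in> Rat u"
    unfolding n_def by (intro Rat_diff Rat_mult Rat_power assms)
  have tR: "t \<in> Rat u"
    unfolding t_def using Rat_diff[OF Rat_0 Rat_add[OF assms(2) assms(2)]] by (simp only: mult_2 diff_0)
  have rel: "f ^ 2 + t * f + n = 0"
    by (simp add: f_def t_def n_def algebra_simps power2_eq_square)
  have fin: "finite {1, t, n}" "{1, t, n} \<subseteq> Rat u" "1 \<in> {1, t, n}" "(1 :: complex fls) \<noteq> 0"
    using nR tR Rat_1 by simp_all
  obtain m r where "\<And>c. c \<in> {1, t, n} \<Longrightarrow> r c \<in> K"
    and r: "\<And>c. c \<in> {1, t, n} \<Longrightarrow> has_leading u c m (r c)"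
    "\<exists>c \<in> {1, t, n}. r c \<noteq> 0"
    by (rule leading_family[OF fin \<open>u \<noteq> 0\<close>]) (rule that)
  define w where "w = u powi m"
  have w: "w \<noteq> 0" "w \<in> E" using assms by (simp_all add: w_def E_powi)
  have r': "vge 1 (1 / w - fls_const (r 1))" "vge 1 (t / w - fls_const (r t))" "vge 1 (n / w - fls_const (r n))"
    unfolding w_def by (rule has_leadingD[OF r(1) val(1-3)]; simp)+
  have f0: "vge 0 f" using f by (simp add: f_def)
  have ff: "vge 0 (f ^ 2)" using vge_power[OF f0, of 2] by simp
  define P where "P = fls_const (r 1) * f ^ 2 + fls_const (r t) * f + fls_const (r n)"
  have "(f ^ 2 + t * f + n) / w = 0" using rel by simp
  then have "P = - ((1 / w - fls_const (r 1)) * f ^ 2 + (t / w - fls_const (r t)) * f + (n / w - fls_const (r n)))"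
    by (simp add: P_def algebra_simps add_divide_distrib)
  moreover have "vge (1 + 0) ((1 / w - fls_const (r 1)) * f ^ 2)" "vge (1 + 0) ((t / w - fls_const (r t)) * f)"
    by (intro vge_mult r' f0 ff)+
  ultimately have P: "vge 1 P"
    using vge_uminus[OF vge_add[OF vge_add r'(3)]] by simp
  have root: "\<exists>c. vge 1 (f - fls_const c)"
  proof (cases "r 1 = 0")
    case True
    show ?thesis
    proof (cases "r t = 0")
      case True': True
      \<comment> \<open>The reduced relation cannot be a nonzero constant, because \<open>P\<close>
        has positive order.\<close>
      then have "r n \<noteq> 0" using r(2) True by auto
      then have "\<not> vge 1 P"
        using True True' v_const[of "r n"] assms(1) by (simp add: P_def vge_def)
      then show ?thesis using P by simp
    next
      case False
      define c where "c = - (r n / r t)"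
      have "r n = - (r t * c)" using False by (simp add: c_def)
      then have "P = fls_const (r t) * (f - fls_const c)"
        using True by (simp add: P_def right_diff_distrib)
      moreover have "fls_const (inverse (r t)) * fls_const (r t) = 1"
        using False by simp
      ultimately have "f - fls_const c = fls_const (inverse (r t)) * P"
        by (simp flip: mult.assoc)
      moreover have "vge (0 + 1) (fls_const (inverse (r t)) * P)"
        using P assms(1) by (intro vge_mult vge_const) auto
      ultimately show ?thesis by (metis add_0)
    qed
  next
    case False
    define d where "d = csqrt ((r t)\<^sup>2 - 4 * r 1 * r n)"
    have d2: "d\<^sup>2 = (r t)\<^sup>2 - 4 * r 1 * r n" by (simp add: d_def)
    define c1 c2 where "c1 = (- r t + d) / (2 * r 1)" and "c2 = (- r t - d) / (2 * r 1)"
    have "c1 + c2 = - r t / r 1"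
      using False by (simp add: c1_def c2_def field_simps)
    then have ct: "r t = - (r 1 * (c1 + c2))"
      using False by simp
    have "c1 * c2 = ((r t)\<^sup>2 - d\<^sup>2) / (4 * r 1 * r 1)"
      using False by (simp add: c1_def c2_def power2_eq_square) (simp add: algebra_simps)
    then have cn: "r n = r 1 * (c1 * c2)"
      using False by (simp add: d2)
    have ctn: "fls_const (r t) = - (fls_const (r 1) * (fls_const c1 + fls_const c2))"
      "fls_const (r n) = fls_const (r 1) * (fls_const c1 * fls_const c2)"
      by (simp_all only: ct cn fls_const_mult_const fls_plus_const fls_const_uminus)
    have "P = fls_const (r 1) * ((f - fls_const c1) * (f - fls_const c2))"
      unfolding P_def ctn by (simp add: algebra_simps power2_eq_square del: fls_const_mult_const)
    moreover have "f - fls_const c' \<in> E" for c'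
      using f0 assms(1) by (simp add: vge_def E_diff E_const)
    moreover have "\<not> vge 1 (fls_const (r 1) * ((f - fls_const c1) * (f - fls_const c2)))"
      if "\<not> vge 1 (f - fls_const c1)" "\<not> vge 1 (f - fls_const c2)"
    proof -
      have "f - fls_const c1 \<noteq> 0" "f - fls_const c2 \<noteq> 0" "v (f - fls_const c1) \<le> 0" "v (f - fls_const c2) \<le> 0"
        using that \<open>\<And>c'. f - fls_const c' \<in> E\<close> by (auto simp: vge_def)
      then show ?thesis
        using False assms(1) \<open>\<And>c'. f - fls_const c' \<in> E\<close> by (simp add: vge_def v_mult v_const E_mult E_const)
    qed
    ultimately show ?thesis using P by blast
  qed
  then show ?thesis using that unfolding f_def by blast
qed

end

section \<open>Parametrizations by Laurent series\<close>

definition transcendental :: "complex fls \<Rightarrow> bool" where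
  "transcendental \<xi> \<longleftrightarrow> (\<forall>p. p \<noteq> 0 \<longrightarrow> eval_fls \<xi> p \<noteq> 0)"

lemma constants_UNIV: "constants UNIV"
  by unfold_locales auto

lemma valued_subdegree:
  assumes "constants K"
  shows "valued K UNIV (fls_subdegree :: complex fls \<Rightarrow> int)"
proof -
  interpret constants K by fact
  show ?thesis
    by unfold_locales (auto simp: fls_plus_subdegree)
qed

text \<open>The lowest term of \<open>p\<close> dominates when \<open>u\<close> has positive order,
  so \<open>p(u)\<close> cannot vanish.\<close>

lemma transcendental_positive:
  assumes "0 < fls_subdegree u"
  shows "transcendental u"
  unfolding transcendental_def
proof (intro allI impI)
  fix p :: "complex poly" assume "p \<noteq> 0"
  interpret constants UNIV by (rule constants_UNIV)
  have "u \<noteq> 0" using assms by auto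
  then obtain m r where "r \<noteq> 0" "has_leading u (eval_fls u p) m r"
    using leading_eval[of p u] \<open>p \<noteq> 0\<close> by (auto simp: poly_over_def)
  then show "eval_fls u p \<noteq> 0"
    using leading_v(1)[of u _ m r UNIV fls_subdegree] valued_subdegree[OF constants_UNIV] assms \<open>u \<noteq> 0\<close> by auto
qed

lemma eval_fls_shift: "eval_fls \<xi> p = eval_fls (\<xi> - fls_const c) (pcompose p [:c, 1:])"
  by (simp add: eval_fls_pcompose)

lemma transcendental_shift:
  assumes "transcendental (\<xi> - fls_const c)"
  shows "transcendental \<xi>"
proof -
  have "pcompose p [:c, 1:] \<noteq> 0" if "p \<noteq> 0" for p :: "complex poly"
    using that pcompose_eq_0[of p "[:c, 1:]"] by auto
  then have "eval_fls (\<xi> - fls_const c) (pcompose p [:c, 1:]) \<noteq> 0" if "p \<noteq> 0" for p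
    using assms that unfolding transcendental_def by blast
  then show ?thesis
    unfolding transcendental_def eval_fls_shift[of \<xi> _ c] by blast
qed

lemma transcendental_inverse:
  assumes "transcendental (inverse \<xi>)" "\<xi> \<noteq> 0"
  shows "transcendental \<xi>"
  using assms by (simp add: transcendental_def eval_fls_reflect[of \<xi>])

text \<open>Dividing by an even power of the variable leaves a power series with nonzero constant
  term; the complex square root of that term extends to a root of the series.\<close>

lemma fls_sqrt_exists:
  fixes g :: "complex fls"
  assumes "even (fls_subdegree g)"
  shows "\<exists>\<eta>. \<eta>\<^sup>2 = g"
proof (cases "g = 0")
  case False
  obtain m where m: "fls_subdegree g = 2 * m" using assms by (elim evenE)
  define h where "h = fls_base_factor_to_fps g"
  define r where "r = fps_radical (\<lambda>_. csqrt) 2 h"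
  have "h $ 0 \<noteq> 0" using False by (simp add: h_def fls_base_factor_to_fps_nth)
  then have r: "r ^ 2 = h"
    using power_radical[of h "\<lambda>_. csqrt" 1] power2_csqrt[of "h $ 0"]
    by (simp add: r_def numeral_2_eq_2)
  have "g = fls_shift (- (2 * m)) (fps_to_fls h)"
    using fls_conv_base_factor_to_fps_shift_subdegree[of g] m by (simp add: h_def)
  also have "\<dots> = fls_shift (- m) (fps_to_fls r) ^ 2"
    by (simp add: r[symmetric] power2_eq_square fls_times_both_shifted_simp fls_times_fps_to_fls)
  finally show ?thesis by metis
qed (auto intro: exI[of _ 0])

text \<open>Stated through the reduced fraction to avoid a quotient construction. For transcendental
  \<open>\<xi>\<close> any other representation gives the same value, by
  \<open>eval_fract_Fract\<close>.\<close>

definition eval_fract :: "complex fls \<Rightarrow> complex poly fract \<Rightarrow> complex fls" where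
  "eval_fract \<xi> A = eval_fls \<xi> (fst (quot_of_fract A)) / eval_fls \<xi> (snd (quot_of_fract A))"

lemma quot_of_fract_cases:
  fixes A :: "complex poly fract"
  obtains p q where "A = Fract p q" "q \<noteq> 0" "coprime p q" "quot_of_fract A = (p, q)"
proof -
  obtain p q where pq: "quot_of_fract A = (p, q)" by fastforce
  have "q \<noteq> 0" "coprime p q"
    using snd_quot_of_fract_nonzero[of A] coprime_quot_of_fract[of A] pq by auto
  moreover have "A = Fract p q"
    using Fract_quot_of_fract[of A] pq by simp
  ultimately show ?thesis using that pq by blast
qed

context
  fixes \<xi> :: "complex fls"
  assumes trans: "transcendental \<xi>"
begin

lemma eval_fls_eq_0_iff: "eval_fls \<xi> p = 0 \<longleftrightarrow> p = 0"
  using trans by (auto simp: transcendental_def)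

lemma eval_fract_Fract:
  assumes "q \<noteq> 0"
  shows "eval_fract \<xi> (Fract p q) = eval_fls \<xi> p / eval_fls \<xi> q"
proof -
  obtain r s where rs: "Fract p q = Fract r s" "s \<noteq> 0" "quot_of_fract (Fract p q) = (r, s)"
    by (rule quot_of_fract_cases)
  then have "p * s = r * q" using assms by (simp add: eq_fract)
  then have "eval_fls \<xi> p * eval_fls \<xi> s = eval_fls \<xi> r * eval_fls \<xi> q"
    by (simp flip: eval_fls_mult)
  then show ?thesis
    using rs assms by (simp add: eval_fract_def eval_fls_eq_0_iff field_simps)
qed

lemma eval_fract_add: "eval_fract \<xi> (A + B) = eval_fract \<xi> A + eval_fract \<xi> B"
  by (cases A; cases B)
    (simp add: eval_fract_Fract eval_fls_add eval_fls_mult eval_fls_eq_0_iff add_frac_eq)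

lemma eval_fract_mult: "eval_fract \<xi> (A * B) = eval_fract \<xi> A * eval_fract \<xi> B"
  by (cases A; cases B) (simp add: eval_fract_Fract eval_fls_mult)

lemma eval_fract_uminus: "eval_fract \<xi> (- A) = - eval_fract \<xi> A"
  by (cases A) (simp add: eval_fract_Fract eval_fls_uminus)

lemma eval_fract_eq_0_iff: "eval_fract \<xi> A = 0 \<longleftrightarrow> A = 0"
  by (cases A) (simp add: eval_fract_Fract eval_fls_eq_0_iff Zero_fract_def eq_fract)

lemma eval_fract_0: "eval_fract \<xi> 0 = 0"
  by (simp add: eval_fract_eq_0_iff)

lemma eval_fract_1: "eval_fract \<xi> 1 = 1"
  by (simp add: One_fract_def eval_fract_Fract)

lemma eval_fract_poly: "eval_fract \<xi> (Fract p 1) = eval_fls \<xi> p"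
  by (simp add: eval_fract_Fract)

end

section \<open>The function field of the curve and its subfield of constants\<close>

locale double_cover = constants +
  fixes F :: "complex poly"
  assumes F_over: "poly_over K F"
    and F_degree: "degree F = 6"
    and F_monic: "lead_coeff F = 1"
    and F_nonsquare: "A * A \<noteq> Fract F 1"
begin

definition embedding :: "complex fls \<Rightarrow> complex fls \<Rightarrow> bool" where
  "embedding \<xi> \<eta> \<longleftrightarrow> transcendental \<xi> \<and> \<eta>\<^sup>2 = eval_fls \<xi> F"

definition embed :: "complex fls \<Rightarrow> complex fls \<Rightarrow> double_cover_function \<Rightarrow> complex fls" where
  "embed \<xi> \<eta> = (\<lambda>(A, B). eval_fract \<xi> A + eval_fract \<xi> B * \<eta>)"

abbreviation L :: "double_cover_function ring" where
  "L \<equiv> function_field K F"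

lemma carrier_L: "carrier L = rational_functions K \<times> rational_functions K"
  and zero_L: "\<zero>\<^bsub>L\<^esub> = (0, 0)"
  and one_L: "\<one>\<^bsub>L\<^esub> = (1, 0)"
  and add_L: "(A, B) \<oplus>\<^bsub>L\<^esub> (C, D) = (A + C, B + D)"
  and mult_L: "(A, B) \<otimes>\<^bsub>L\<^esub> (C, D) = (A * C + B * D * Fract F 1, A * D + B * C)"
  by (simp_all add: function_field_def)

lemma rational_functionsE:
  assumes "A \<in> rational_functions K"
  obtains p q where "A = Fract p q" "q \<noteq> 0" "poly_over K p" "poly_over K q"
  using assms unfolding rational_functions_def poly_over_def by blast

lemma rational_functionsI:
  "q \<noteq> 0 \<Longrightarrow> poly_over K p \<Longrightarrow> poly_over K q \<Longrightarrow> Fract p q \<in> rational_functions K"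
  unfolding rational_functions_def poly_over_def by blast

lemma rf_poly: "poly_over K p \<Longrightarrow> Fract p 1 \<in> rational_functions K"
  by (intro rational_functionsI) (auto intro: poly_over_1)

lemma rf_0: "0 \<in> rational_functions K" and rf_1: "1 \<in> rational_functions K"
  using rf_poly[OF poly_over_0] rf_poly[OF poly_over_1] by (simp_all add: Zero_fract_def One_fract_def)

lemma rf_add: "A \<in> rational_functions K \<Longrightarrow> B \<in> rational_functions K \<Longrightarrow> A + B \<in> rational_functions K"
  by (elim rational_functionsE)
    (auto intro!: rational_functionsI poly_over_add poly_over_mult)

lemma rf_mult: "A \<in> rational_functions K \<Longrightarrow> B \<in> rational_functions K \<Longrightarrow> A * B \<in> rational_functions K"
  by (elim rational_functionsE) (auto intro!: rational_functionsI poly_over_mult)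

lemma rf_uminus: "A \<in> rational_functions K \<Longrightarrow> - A \<in> rational_functions K"
  by (elim rational_functionsE) (auto intro!: rational_functionsI poly_over_uminus)

lemma rf_diff: "A \<in> rational_functions K \<Longrightarrow> B \<in> rational_functions K \<Longrightarrow> A - B \<in> rational_functions K"
  using rf_add[OF _ rf_uminus, of A B] by simp

lemma rf_inverse: "A \<in> rational_functions K \<Longrightarrow> inverse A \<in> rational_functions K"
proof (elim rational_functionsE)
  fix p q assume *: "A = Fract p q" "q \<noteq> 0" "poly_over K p" "poly_over K q"
  show ?thesis
  proof (cases "p = 0")
    case True
    then have "A = 0" using * by (simp add: Zero_fract_def eq_fract)
    then show ?thesis by (simp add: rf_0)
  next
    case False
    then show ?thesis using * by (simp add: rational_functionsI)
  qed
qed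

lemmas rf_closed = rf_0 rf_1 rf_add rf_mult rf_uminus rf_diff rf_inverse rf_poly

text \<open>\<open>F_nonsquare\<close> ranges over all complex rational functions, so it expresses
  irreducibility over the complex numbers and not just over \<open>K\<close>. It makes nonzero
  elements have nonzero norm, hence inverses.\<close>

lemma norm_nonzero:
  assumes "(A, B) \<noteq> (0, 0)"
  shows "A * A - B * B * Fract F 1 \<noteq> 0"
proof
  assume *: "A * A - B * B * Fract F 1 = 0"
  show False
  proof (cases "B = 0")
    case True
    then show False using * assms by simp
  next
    case False
    then have "(A / B) * (A / B) = Fract F 1" using * by (simp add: field_simps)
    then show False using F_nonsquare by blast
  qed
qed

lemma L_inverse:
  assumes "f \<in> carrier L" "f \<noteq> \<zero>\<^bsub>L\<^esub>"
  shows "\<exists>g \<in> carrier L. f \<otimes>\<^bsub>L\<^esub> g = \<one>\<^bsub>L\<^esub>"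
proof -
  obtain A B where f: "f = (A, B)" "A \<in> rational_functions K" "B \<in> rational_functions K"
    using assms by (auto simp: carrier_L)
  define N where "N = A * A - B * B * Fract F 1"
  have N: "N \<noteq> 0" using norm_nonzero[of A B] assms f by (simp add: N_def zero_L)
  have "N \<in> rational_functions K" unfolding N_def by (intro rf_closed f F_over)
  then have "(A * inverse N, - (B * inverse N)) \<in> carrier L"
    using f by (auto simp: carrier_L intro!: rf_closed)
  moreover have "A * (A * inverse N) + B * - (B * inverse N) * Fract F 1 = N * inverse N"
    unfolding N_def left_diff_distrib by (simp add: mult_ac)
  then have "f \<otimes>\<^bsub>L\<^esub> (A * inverse N, - (B * inverse N)) = \<one>\<^bsub>L\<^esub>"
    using N by (simp add: f mult_L one_L)
  ultimately show ?thesis by blast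
qed

lemma cring_L: "cring L"
proof (rule cringI)
  show "abelian_group L"
  proof (rule abelian_groupI)
    fix f assume "f \<in> carrier L"
    then show "\<exists>g \<in> carrier L. g \<oplus>\<^bsub>L\<^esub> f = \<zero>\<^bsub>L\<^esub>"
      by (intro bexI[of _ "(- fst f, - snd f)"]) (auto simp: carrier_L add_L zero_L intro: rf_closed)
  qed (auto simp: carrier_L add_L zero_L intro: rf_closed)
  show "comm_monoid L"
    by (rule comm_monoidI)
      (auto simp: carrier_L mult_L one_L algebra_simps intro!: rf_closed F_over)
  show "\<And>f g h. f \<in> carrier L \<Longrightarrow> g \<in> carrier L \<Longrightarrow> h \<in> carrier L \<Longrightarrow>
      (f \<oplus>\<^bsub>L\<^esub> g) \<otimes>\<^bsub>L\<^esub> h = f \<otimes>\<^bsub>L\<^esub> h \<oplus>\<^bsub>L\<^esub> g \<otimes>\<^bsub>L\<^esub> h"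
    by (auto simp: carrier_L mult_L add_L algebra_simps)
qed

lemma field_L: "field L"
proof (rule cring.cring_fieldI[OF cring_L])
  interpret cring L by (rule cring_L)
  show "Units L = carrier L - {\<zero>\<^bsub>L\<^esub>}"
  proof (intro equalityI subsetI)
    fix f assume "f \<in> carrier L - {\<zero>\<^bsub>L\<^esub>}"
    then show "f \<in> Units L"
      using L_inverse[of f] m_comm by (auto simp: Units_def)
  next
    fix f assume "f \<in> Units L"
    moreover have "\<one>\<^bsub>L\<^esub> \<noteq> \<zero>\<^bsub>L\<^esub>" by (simp add: one_L zero_L)
    ultimately show "f \<in> carrier L - {\<zero>\<^bsub>L\<^esub>}"
      by (auto simp: Units_def)
  qed
qed

lemma const_in_L: "c \<in> K \<Longrightarrow> const c \<in> carrier L"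
  by (auto simp: const_def carrier_L intro!: rf_closed simp: poly_over_pCons poly_over_0 K_0)

lemma const_add: "const a \<oplus>\<^bsub>L\<^esub> const b = const (a + b)"
  and const_mult: "const a \<otimes>\<^bsub>L\<^esub> const b = const (a * b)"
  and const_0: "const 0 = \<zero>\<^bsub>L\<^esub>"
  and const_1: "const 1 = \<one>\<^bsub>L\<^esub>"
  by (simp_all add: const_def add_L mult_L zero_L one_L Zero_fract_def One_fract_def one_pCons mult.commute)

lemma const_inj: "const a = const b \<longleftrightarrow> a = b"
  by (simp add: const_def eq_fract)

lemma subfield_const: "subfield (const ` K) L"
proof -
  interpret field L by (rule field_L)
  have um: "\<ominus>\<^bsub>L\<^esub> const a = const (- a)" if "a \<in> K" for a
    using that const_add[of "- a" a] by (intro minus_equality) (auto simp: const_in_L K_closed const_0)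
  show ?thesis
  proof (rule subfieldI')
    show "subring (const ` K) L"
      by (rule subringI) (auto simp: const_in_L um const_add const_mult const_1 intro: K_closed simp flip: const_1)
    fix k assume "k \<in> const ` K - {\<zero>\<^bsub>L\<^esub>}"
    then obtain c where c: "c \<in> K" "c \<noteq> 0" "k = const c" using const_0 by blast
    then have "inv\<^bsub>L\<^esub> k = const (inverse c)"
      by (intro comm_inv_char) (auto simp: const_in_L K_inverse const_mult const_1)
    then show "inv\<^bsub>L\<^esub> k \<in> const ` K" using c by (auto intro: K_inverse)
  qed
qed

section \<open>Embeddings of the function field into Laurent series\<close>

context
  fixes \<xi> \<eta>
  assumes emb: "embedding \<xi> \<eta>"
begin

lemma embed_trans: "transcendental \<xi>" and embed_square: "\<eta>\<^sup>2 = eval_fls \<xi> F"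
  using emb by (auto simp: embedding_def)

lemma embed_add: "embed \<xi> \<eta> (f \<oplus>\<^bsub>L\<^esub> g) = embed \<xi> \<eta> f + embed \<xi> \<eta> g"
  by (cases f; cases g) (simp add: embed_def add_L eval_fract_add[OF embed_trans] algebra_simps)

lemma embed_mult: "embed \<xi> \<eta> (f \<otimes>\<^bsub>L\<^esub> g) = embed \<xi> \<eta> f * embed \<xi> \<eta> g"
  by (cases f; cases g)
    (simp add: embed_def mult_L eval_fract_add[OF embed_trans] eval_fract_mult[OF embed_trans]
      eval_fract_poly[OF embed_trans] embed_square[symmetric] power2_eq_square algebra_simps)

lemma embed_const: "embed \<xi> \<eta> (const c) = fls_const c"
  by (simp add: embed_def const_def eval_fract_poly[OF embed_trans] eval_fract_0[OF embed_trans])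

lemma embed_0: "embed \<xi> \<eta> \<zero>\<^bsub>L\<^esub> = 0" and embed_1: "embed \<xi> \<eta> \<one>\<^bsub>L\<^esub> = 1"
  using embed_const[of 0] embed_const[of 1] by (simp_all add: const_0 const_1)

lemma embed_x: "embed \<xi> \<eta> coord_x = \<xi>"
  by (simp add: embed_def coord_x_def eval_fract_poly[OF embed_trans] eval_fract_0[OF embed_trans])

lemma embed_y: "embed \<xi> \<eta> coord_y = \<eta>"
  by (simp add: embed_def coord_y_def eval_fract_1[OF embed_trans] eval_fract_0[OF embed_trans])

text \<open>If \<open>f\<close> is sent to zero, then so is its norm, a rational function of
  \<open>x\<close>, on which the embedding is injective.\<close>

lemma embed_eq_0_iff: "embed \<xi> \<eta> f = 0 \<longleftrightarrow> f = \<zero>\<^bsub>L\<^esub>"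
proof
  assume *: "embed \<xi> \<eta> f = 0"
  obtain A B where f: "f = (A, B)" by fastforce
  have "embed \<xi> \<eta> (A * A - B * B * Fract F 1, 0) = embed \<xi> \<eta> ((A, B) \<otimes>\<^bsub>L\<^esub> (A, - B))"
    by (simp add: mult_L mult.commute)
  also have "\<dots> = 0" using * f by (simp add: embed_mult)
  finally have "A * A - B * B * Fract F 1 = 0"
    by (simp add: embed_def eval_fract_0[OF embed_trans] eval_fract_eq_0_iff[OF embed_trans])
  then show "f = \<zero>\<^bsub>L\<^esub>" using norm_nonzero f by (auto simp: zero_L)
qed (simp add: embed_0)

lemma embed_uminus: "embed \<xi> \<eta> (- A, - B) = - embed \<xi> \<eta> (A, B)"
  by (simp add: embed_def eval_fract_uminus[OF embed_trans])

lemma embed_inj: "inj (embed \<xi> \<eta>)"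
proof (rule injI)
  fix f g assume eq: "embed \<xi> \<eta> f = embed \<xi> \<eta> g"
  obtain A B C D where fg: "f = (A, B)" "g = (C, D)" by fastforce
  have "embed \<xi> \<eta> ((A, B) \<oplus>\<^bsub>L\<^esub> (- C, - D)) = 0"
    using eq fg by (simp add: embed_add embed_uminus)
  then show "f = g" using fg by (simp add: embed_eq_0_iff add_L zero_L)
qed

end

end

section \<open>Points as valuations\<close>

context valued
begin

lemma vge_mult_cancel: "a \<in> E \<Longrightarrow> b \<in> E \<Longrightarrow> vge 1 (a * b) \<Longrightarrow> vge 1 a \<or> vge 1 b"
  using v_mult[of a b] by (cases "a = 0"; cases "b = 0") (auto simp: vge_def)

lemma residue_square:
  assumes "z \<in> E" "s \<in> K" "vge 1 (z\<^sup>2 - fls_const (s\<^sup>2))"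
  shows "vge 1 (z - fls_const s) \<or> vge 1 (z - fls_const (- s))"
proof -
  have "z\<^sup>2 - fls_const (s\<^sup>2) = (z - fls_const s) * (z - fls_const (- s))"
    by (simp add: algebra_simps power2_eq_square)
  then show ?thesis
    using assms by (intro vge_mult_cancel) (auto intro: E_closed K_closed simp del: fls_const_uminus)
qed

end

context double_cover
begin

section \<open>A copy of the function field inside the Laurent series, and points as valuations on
  it\<close>

definition base_x :: "complex fls" where
  "base_x = fls_X_inv"

lemma base_x_nonzero [simp]: "base_x \<noteq> 0"
  by (simp add: base_x_def)

text \<open>Either root will do: this embedding only provides a copy of the field with type class
  arithmetic. \<open>P0\<close> is singled out by the residue of \<open>base_y / base_x ^ 3\<close>
  under its own valuation, not by these series.\<close>

definition base_y :: "complex fls" where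
  "base_y = (SOME \<eta>. \<eta>\<^sup>2 = eval_fls base_x F)"

definition \<phi> :: "double_cover_function \<Rightarrow> complex fls" where
  "\<phi> = embed base_x base_y"

lemma transcendental_base_x: "transcendental base_x"
  using transcendental_inverse[of base_x] transcendental_positive[of fls_X]
  by (simp add: base_x_def fls_inverse_X_inv)

lemma subdegree_base_x_eval: "p \<noteq> 0 \<Longrightarrow> fls_subdegree (eval_fls base_x p) = - int (degree p)"
proof -
  assume "p \<noteq> 0"
  interpret v: valued UNIV UNIV fls_subdegree by (rule valued_subdegree[OF constants_UNIV])
  have "v.vge 1 (eval_fls fls_X (reflect_poly p) - fls_const (coeff (reflect_poly p) 0))"
    by (rule v.residue_eval) (auto simp: poly_over_def v.vge_def)
  then have "fls_subdegree (eval_fls fls_X (reflect_poly p)) = 0" "eval_fls fls_X (reflect_poly p) \<noteq> 0"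
    using v.v_unit[of "lead_coeff p"] \<open>p \<noteq> 0\<close> by auto
  then show ?thesis
    using eval_fls_reflect[of base_x p] by (simp add: base_x_def fls_inverse_X_inv fls_subdegree_pow)
qed

lemma base_y_square: "base_y\<^sup>2 = eval_fls base_x F"
proof -
  have "F \<noteq> 0" using F_degree by auto
  then have "\<exists>\<eta>. \<eta>\<^sup>2 = eval_fls base_x F"
    by (intro fls_sqrt_exists) (simp add: subdegree_base_x_eval F_degree)
  then show ?thesis unfolding base_y_def by (rule someI_ex)
qed

lemma base_embedding: "embedding base_x base_y"
  by (simp add: embedding_def transcendental_base_x base_y_square)

lemmas \<phi>_add = embed_add[OF base_embedding, folded \<phi>_def]
  and \<phi>_mult = embed_mult[OF base_embedding, folded \<phi>_def]
  and \<phi>_const = embed_const[OF base_embedding, folded \<phi>_def]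
  and \<phi>_0 = embed_0[OF base_embedding, folded \<phi>_def]
  and \<phi>_1 = embed_1[OF base_embedding, folded \<phi>_def]
  and \<phi>_x = embed_x[OF base_embedding, folded \<phi>_def]
  and \<phi>_y = embed_y[OF base_embedding, folded \<phi>_def]
  and \<phi>_eq_0_iff = embed_eq_0_iff[OF base_embedding, folded \<phi>_def]
  and \<phi>_inj = embed_inj[OF base_embedding, folded \<phi>_def]

lemma base_y_nonzero: "base_y \<noteq> 0"
proof -
  have "F \<noteq> 0" using F_degree by auto
  then have "base_y\<^sup>2 \<noteq> 0"
    unfolding base_y_square by (simp add: eval_fls_eq_0_iff[OF transcendental_base_x])
  then show ?thesis by simp
qed

definition E :: "complex fls set" where
  "E = \<phi> ` carrier L"

text \<open>Transports an order function along \<open>\<phi>\<close>. The inverse is taken on all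
  pairs, since \<open>\<phi>\<close> is injective on the whole type, and so
  \<open>val P (\<phi> f) = P f\<close> needs no membership condition.\<close>

definition val :: "(double_cover_function \<Rightarrow> int) \<Rightarrow> complex fls \<Rightarrow> int" where
  "val P a = P (inv_into UNIV \<phi> a)"

abbreviation Pts :: "(double_cover_function \<Rightarrow> int) set" where
  "Pts \<equiv> points L (const ` K)"

lemma val_\<phi>: "val P (\<phi> f) = P f"
  by (simp add: val_def inv_f_f[OF \<phi>_inj])

lemma \<phi>_in_E: "f \<in> carrier L \<Longrightarrow> \<phi> f \<in> E"
  by (simp add: E_def)

lemma eval_fract_Rat: "A \<in> rational_functions K \<Longrightarrow> transcendental \<xi> \<Longrightarrow> eval_fract \<xi> A \<in> Rat \<xi>"
  by (elim rational_functionsE) (simp add: eval_fract_Fract RatI eval_fls_eq_0_iff)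

lemma \<phi>_pair: "\<phi> (A, B) = eval_fract base_x A + eval_fract base_x B * base_y"
  by (simp add: \<phi>_def embed_def)

lemma E_decompose:
  assumes "f \<in> E"
  obtains a b where "a \<in> Rat base_x" "b \<in> Rat base_x" "f = a + b * base_y"
proof -
  obtain A B where AB: "A \<in> rational_functions K" "B \<in> rational_functions K" "f = \<phi> (A, B)"
    using assms unfolding E_def carrier_L by blast
  then show ?thesis
    using eval_fract_Rat[OF _ transcendental_base_x] by (intro that) (auto simp: \<phi>_pair)
qed

lemma Rat_X_fract:
  assumes "a \<in> Rat base_x"
  obtains A where "A \<in> rational_functions K" "a = eval_fract base_x A"
proof -
  obtain p q where pq: "poly_over K p" "poly_over K q" "eval_fls base_x q \<noteq> 0" "a = eval_fls base_x p / eval_fls base_x q"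
    using assms by (rule RatE)
  then have "q \<noteq> 0" by auto
  then show ?thesis
    using pq by (intro that[of "Fract p q"]) (auto simp: eval_fract_Fract[OF transcendental_base_x] rational_functionsI)
qed

lemma E_compose: "a \<in> Rat base_x \<Longrightarrow> b \<in> Rat base_x \<Longrightarrow> a + b * base_y \<in> E"
  by (elim Rat_X_fract) (auto simp: E_def carrier_L \<phi>_pair[symmetric])

lemma E_conj_nonzero:
  assumes "a \<in> Rat base_x" "b \<in> Rat base_x" "a + b * base_y \<noteq> 0"
  shows "a - b * base_y \<noteq> 0"
proof -
  obtain A B where AB: "a = eval_fract base_x A" "b = eval_fract base_x B"
    using assms by (metis Rat_X_fract)
  have "\<phi> (A, - B) = a - b * base_y"
    by (simp add: \<phi>_pair AB eval_fract_uminus[OF transcendental_base_x])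
  moreover have "(A, B) \<noteq> \<zero>\<^bsub>L\<^esub>"
    using assms \<phi>_eq_0_iff[of "(A, B)"] by (auto simp: \<phi>_pair AB)
  then have "(A, - B) \<noteq> \<zero>\<^bsub>L\<^esub>" by (auto simp: zero_L)
  ultimately show ?thesis using \<phi>_eq_0_iff[of "(A, - B)"] by simp
qed

lemma
  assumes "P \<in> Pts"
  shows point_mult: "\<And>f g. f \<in> carrier L \<Longrightarrow> f \<noteq> \<zero>\<^bsub>L\<^esub> \<Longrightarrow> g \<in> carrier L \<Longrightarrow> g \<noteq> \<zero>\<^bsub>L\<^esub> \<Longrightarrow> P (f \<otimes>\<^bsub>L\<^esub> g) = P f + P g"
    and point_add: "\<And>f g. f \<in> carrier L \<Longrightarrow> f \<noteq> \<zero>\<^bsub>L\<^esub> \<Longrightarrow> g \<in> carrier L \<Longrightarrow> g \<noteq> \<zero>\<^bsub>L\<^esub> \<Longrightarrow> f \<oplus>\<^bsub>L\<^esub> g \<noteq> \<zero>\<^bsub>L\<^esub> \<Longrightarrow> min (P f) (P g) \<le> P (f \<oplus>\<^bsub>L\<^esub> g)"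
    and point_const: "\<And>c. c \<in> K \<Longrightarrow> c \<noteq> 0 \<Longrightarrow> P (const c) = 0"
    and point_surj: "\<exists>f \<in> carrier L. f \<noteq> \<zero>\<^bsub>L\<^esub> \<and> P f = n"
    and point_extensional: "P \<in> extensional (carrier L - {\<zero>\<^bsub>L\<^esub>})"
proof -
  have c: "const c \<noteq> \<zero>\<^bsub>L\<^esub>" if "c \<noteq> 0" for c
    using that const_inj[of c 0] by (simp add: const_0)
  show "\<And>f g. f \<in> carrier L \<Longrightarrow> f \<noteq> \<zero>\<^bsub>L\<^esub> \<Longrightarrow> g \<in> carrier L \<Longrightarrow> g \<noteq> \<zero>\<^bsub>L\<^esub> \<Longrightarrow> P (f \<otimes>\<^bsub>L\<^esub> g) = P f + P g"
    and "\<And>f g. f \<in> carrier L \<Longrightarrow> f \<noteq> \<zero>\<^bsub>L\<^esub> \<Longrightarrow> g \<in> carrier L \<Longrightarrow> g \<noteq> \<zero>\<^bsub>L\<^esub> \<Longrightarrow> f \<oplus>\<^bsub>L\<^esub> g \<noteq> \<zero>\<^bsub>L\<^esub> \<Longrightarrow> min (P f) (P g) \<le> P (f \<oplus>\<^bsub>L\<^esub> g)"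
    using assms unfolding points_def by blast+
  show "\<And>c. c \<in> K \<Longrightarrow> c \<noteq> 0 \<Longrightarrow> P (const c) = 0"
    using assms c unfolding points_def by blast
  have "P ` (carrier L - {\<zero>\<^bsub>L\<^esub>}) = UNIV"
    using assms unfolding points_def by blast
  then have "n \<in> P ` (carrier L - {\<zero>\<^bsub>L\<^esub>})" by simp
  then show "\<exists>f \<in> carrier L. f \<noteq> \<zero>\<^bsub>L\<^esub> \<and> P f = n" by blast
  show "P \<in> extensional (carrier L - {\<zero>\<^bsub>L\<^esub>})"
    using assms by (auto simp: points_def PiE_def)
qed

lemma pointI:
  assumes "\<And>f g. f \<in> carrier L \<Longrightarrow> f \<noteq> \<zero>\<^bsub>L\<^esub> \<Longrightarrow> g \<in> carrier L \<Longrightarrow> g \<noteq> \<zero>\<^bsub>L\<^esub> \<Longrightarrow> P (f \<otimes>\<^bsub>L\<^esub> g) = P f + P g"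
    and "\<And>f g. f \<in> carrier L \<Longrightarrow> f \<noteq> \<zero>\<^bsub>L\<^esub> \<Longrightarrow> g \<in> carrier L \<Longrightarrow> g \<noteq> \<zero>\<^bsub>L\<^esub> \<Longrightarrow> f \<oplus>\<^bsub>L\<^esub> g \<noteq> \<zero>\<^bsub>L\<^esub> \<Longrightarrow> min (P f) (P g) \<le> P (f \<oplus>\<^bsub>L\<^esub> g)"
    and "\<And>c. c \<in> K \<Longrightarrow> c \<noteq> 0 \<Longrightarrow> P (const c) = 0"
    and "\<And>n. \<exists>f \<in> carrier L. f \<noteq> \<zero>\<^bsub>L\<^esub> \<and> P f = n"
    and "P \<in> extensional (carrier L - {\<zero>\<^bsub>L\<^esub>})"
  shows "P \<in> Pts"
proof -
  have "P ` (carrier L - {\<zero>\<^bsub>L\<^esub>}) = UNIV"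
  proof (intro equalityI subsetI)
    fix n :: int
    obtain f where "f \<in> carrier L" "f \<noteq> \<zero>\<^bsub>L\<^esub>" "P f = n" using assms(4) by blast
    then show "n \<in> P ` (carrier L - {\<zero>\<^bsub>L\<^esub>})" by blast
  qed simp
  moreover have "\<forall>c \<in> const ` K - {\<zero>\<^bsub>L\<^esub>}. P c = 0"
  proof
    fix c assume "c \<in> const ` K - {\<zero>\<^bsub>L\<^esub>}"
    then obtain k where "k \<in> K" "c = const k" "k \<noteq> 0" using const_0 by blast
    then show "P c = 0" using assms(3) by blast
  qed
  ultimately show ?thesis
    using assms(1,2,5) unfolding points_def PiE_def by auto
qed

lemma E_field:
  shows "c \<in> K \<Longrightarrow> fls_const c \<in> E"
    and "a \<in> E \<Longrightarrow> b \<in> E \<Longrightarrow> a + b \<in> E"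
    and "a \<in> E \<Longrightarrow> - a \<in> E"
    and "a \<in> E \<Longrightarrow> b \<in> E \<Longrightarrow> a * b \<in> E"
    and "a \<in> E \<Longrightarrow> inverse a \<in> E"
proof -
  interpret Lf: field L by (rule field_L)
  show c: "fls_const c \<in> E" if "c \<in> K" for c
    using that \<phi>_in_E[OF const_in_L[of c]] by (simp add: \<phi>_const)
  show "a + b \<in> E" if "a \<in> E" "b \<in> E"
    using that by (auto simp: E_def \<phi>_add[symmetric])
  show m: "a * b \<in> E" if "a \<in> E" "b \<in> E" for a b
    using that by (auto simp: E_def \<phi>_mult[symmetric])
  show "- a \<in> E" if "a \<in> E"
    using m[OF c[of "- 1"] that] by (simp add: K_closed)
  show "inverse a \<in> E" if a: "a \<in> E"
  proof (cases "a = 0")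
    case False
    then obtain f where f: "f \<in> carrier L" "a = \<phi> f" "f \<noteq> \<zero>\<^bsub>L\<^esub>"
      using a \<phi>_0 unfolding E_def by blast
    then obtain g where g: "g \<in> carrier L" "f \<otimes>\<^bsub>L\<^esub> g = \<one>\<^bsub>L\<^esub>"
      using L_inverse by blast
    then have "a * \<phi> g = 1" using \<phi>_mult[of f g] f by (simp add: \<phi>_1)
    then have "inverse a = \<phi> g" by (rule inverse_unique)
    then show ?thesis using g by (simp add: \<phi>_in_E)
  qed (use a in simp)
qed

lemma valued_point:
  assumes "P \<in> Pts"
  shows "valued K E (val P)"
proof unfold_locales
  show "\<And>c. c \<in> K \<Longrightarrow> fls_const c \<in> E" "\<And>a b. a \<in> E \<Longrightarrow> b \<in> E \<Longrightarrow> a * b \<in> E"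
    "\<And>a. a \<in> E \<Longrightarrow> inverse a \<in> E"
    by (fact E_field)+
  show "\<And>a b. a \<in> E \<Longrightarrow> b \<in> E \<Longrightarrow> a - b \<in> E"
    using E_field(2)[OF _ E_field(3)] by force
  show "\<And>c. c \<in> K \<Longrightarrow> c \<noteq> 0 \<Longrightarrow> val P (fls_const c) = 0"
    using point_const[OF assms] by (simp flip: \<phi>_const add: val_\<phi>)
  show "val P (a * b) = val P a + val P b" if "a \<in> E" "b \<in> E" "a \<noteq> 0" "b \<noteq> 0" for a b
    using that point_mult[OF assms] by (auto simp: E_def val_\<phi> \<phi>_eq_0_iff simp flip: \<phi>_mult)
  show "min (val P a) (val P b) \<le> val P (a + b)"
    if "a \<in> E" "b \<in> E" "a \<noteq> 0" "b \<noteq> 0" "a + b \<noteq> 0" for a b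
    using that point_add[OF assms] by (auto simp: E_def val_\<phi> \<phi>_eq_0_iff simp flip: \<phi>_add)
qed

lemma val_surj:
  assumes "P \<in> Pts"
  obtains f where "f \<in> E" "f \<noteq> 0" "val P f = n"
  using point_surj[OF assms, of n] by (metis \<phi>_eq_0_iff \<phi>_in_E val_\<phi>)

lemma point_eqI:
  assumes "P \<in> Pts" "Q \<in> Pts" "\<And>f. f \<in> E \<Longrightarrow> f \<noteq> 0 \<Longrightarrow> val P f = val Q f"
  shows "P = Q"
proof (rule extensionalityI[OF point_extensional point_extensional])
  fix f assume "f \<in> carrier L - {\<zero>\<^bsub>L\<^esub>}"
  then have "\<phi> f \<in> E" "\<phi> f \<noteq> 0" by (auto simp: \<phi>_in_E \<phi>_eq_0_iff)
  then show "P f = Q f" using assms(3)[of "\<phi> f"] by (simp add: val_\<phi>)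
qed (use assms in auto)

lemma base_x_in_E: "base_x \<in> E"
  using E_compose[of base_x 0] by (simp add: Rat_self Rat_0)

lemma base_y_in_E: "base_y \<in> E"
  using E_compose[of 0 1] by (simp add: Rat_1 Rat_0)

text \<open>By \<open>unramified_order\<close> each order is a multiple of that of \<open>u\<close>,
  with the same factor for \<open>P\<close> and \<open>Q\<close>. Since a point takes the value 1,
  \<open>u\<close> has order one at both, and the points agree. The factor \<open>w\<close> scales
  \<open>y\<close> to a unit.\<close>

lemma unramified_unique:
  assumes P: "P \<in> Pts" "0 < val P u" "valued.vge E (val P) 1 (base_y * w - fls_const s)"
    and Q: "Q \<in> Pts" "0 < val Q u" "valued.vge E (val Q) 1 (base_y * w - fls_const s)"
    and u: "u \<in> E" "base_x \<in> Rat u" "u \<noteq> 0" and w: "w \<in> Rat u" "w \<noteq> 0" and s: "s \<in> K" "s \<noteq> 0"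
  shows "P = Q" "val P u = 1"
proof -
  have z2: "(base_y * w)\<^sup>2 \<in> Rat u"
    unfolding power_mult_distrib base_y_square by (intro Rat_mult Rat_power eval_in_Rat u w F_over)
  have *: "\<exists>n. val P f = n * val P u \<and> val Q f = n * val Q u" if "f \<in> E" "f \<noteq> 0" for f
  proof -
    obtain a b where f: "a \<in> Rat base_x" "b \<in> Rat base_x" "f = a + b * base_y"
      using \<open>f \<in> E\<close> by (rule E_decompose)
    have R: "a \<in> Rat u" "b / w \<in> Rat u"
      using f w u by (auto intro: Rat_trans Rat_divide)
    have eq: "a + b / w * (base_y * w) = f" "a - b / w * (base_y * w) = a - b * base_y"
      using f w by simp_all
    have nz: "a + b / w * (base_y * w) \<noteq> 0" "a - b / w * (base_y * w) \<noteq> 0"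
      unfolding eq using that E_conj_nonzero[of a b] f by simp_all
    obtain n where n: "\<And>E v. valued K E v \<Longrightarrow> u \<in> E \<Longrightarrow> 0 < v u \<Longrightarrow> valued.vge E v 1 (base_y * w - fls_const s)
        \<Longrightarrow> v (a + b / w * (base_y * w)) = n * v u"
      by (rule unramified_order[OF R z2 s u(3) nz]) (rule that)
    then show ?thesis
      using valued_point P Q u unfolding eq by metis
  qed
  have one: "val P u = 1" if P: "P \<in> Pts" "0 < val P u"
    "\<And>f. f \<in> E \<Longrightarrow> f \<noteq> 0 \<Longrightarrow> \<exists>n. val P f = n * val P u" for P
  proof -
    obtain f where "f \<in> E" "f \<noteq> 0" "val P f = 1" using val_surj[OF P(1)] .
    then obtain n where "n * val P u = 1" using P(3) by metis
    then show ?thesis using P(2) by (auto simp: zmult_eq_1_iff)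
  qed
  show 1: "val P u = 1" using one[of P] P * by blast
  have 2: "val Q u = 1" using one[of Q] Q * by blast
  show "P = Q"
  proof (rule point_eqI[OF P(1) Q(1)])
    fix f assume "f \<in> E" "f \<noteq> 0"
    then show "val P f = val Q f" using *[of f] 1 2 by auto
  qed
qed

text \<open>Here twice each order is a multiple of \<open>val P u\<close>. As the value 1 is taken,
  \<open>val P u\<close> divides 2, and it is not 1 because \<open>j\<close> is odd.\<close>

lemma ramified_unique:
  assumes P: "P \<in> Pts" "0 < val P u" "2 * val P (base_y * w) = j * val P u"
    and Q: "Q \<in> Pts" "0 < val Q u" "2 * val Q (base_y * w) = j * val Q u"
    and u: "u \<in> E" "base_x \<in> Rat u" "u \<noteq> 0" and w: "w \<in> Rat u" "w \<noteq> 0" and j: "odd j"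
  shows "P = Q" "val P u = 2"
proof -
  have wY: "base_y * w \<noteq> 0" using w base_y_nonzero by simp
  have *: "\<exists>n. 2 * val P f = n * val P u \<and> 2 * val Q f = n * val Q u" if "f \<in> E" "f \<noteq> 0" for f
  proof -
    obtain a b where f: "a \<in> Rat base_x" "b \<in> Rat base_x" "f = a + b * base_y"
      using \<open>f \<in> E\<close> by (rule E_decompose)
    have R: "a \<in> Rat u" "b / w \<in> Rat u"
      using f w u by (auto intro: Rat_trans Rat_divide)
    have eq: "a + b / w * (base_y * w) = f" using f w by simp
    have nz: "a + b / w * (base_y * w) \<noteq> 0" unfolding eq using that by simp
    obtain n where n: "\<And>E v. valued K E v \<Longrightarrow> u \<in> E \<Longrightarrow> 0 < v u \<Longrightarrow> base_y * w \<in> E \<Longrightarrow> 2 * v (base_y * w) = j * v u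
        \<Longrightarrow> 2 * v (a + b / w * (base_y * w)) = n * v u"
      by (rule ramified_order[OF R wY u(3) j nz]) (rule that)
    have "base_y * w \<in> E"
      using valued.Rat_in_E[OF valued_point[OF P(1)] w(1) u(1)] base_y_in_E by (rule E_field(4)[rotated])
    then show ?thesis
      using n[OF valued_point[OF P(1)] u(1) P(2) _ P(3)] n[OF valued_point[OF Q(1)] u(1) Q(2) _ Q(3)]
      unfolding eq by metis
  qed
  have two: "val P u = 2" if P: "P \<in> Pts" "0 < val P u" "2 * val P (base_y * w) = j * val P u"
    "\<And>f. f \<in> E \<Longrightarrow> f \<noteq> 0 \<Longrightarrow> \<exists>n. 2 * val P f = n * val P u" for P
  proof -
    obtain f where "f \<in> E" "f \<noteq> 0" "val P f = 1" using val_surj[OF P(1)] .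
    then obtain n where "n * val P u = 2" using P(4) by (metis mult_1_right)
    then have "val P u dvd 2" by (metis dvd_triv_right)
    then have "val P u \<le> 2" by (rule zdvd_imp_le) simp
    moreover have "val P u \<noteq> 1" using P(3) j by (metis dvd_triv_left mult_1_right)
    ultimately show ?thesis using P(2) by simp
  qed
  show 1: "val P u = 2" using two[OF P] * by blast
  have 2: "val Q u = 2" using two[OF Q] * by blast
  show "P = Q"
  proof (rule point_eqI[OF P(1) Q(1)])
    fix f assume "f \<in> E" "f \<noteq> 0"
    then show "val P f = val Q f" using *[of f] 1 2 by auto
  qed
qed

text \<open>
  The order at \<open>t = 0\<close> of a parametrization of the curve by Laurent series, divided by the
  positive generator of its group of values, is the order function of a point.
\<close>

lemma point_of_embedding:
  assumes emb: "embedding \<xi> \<eta>" and f0: "f0 \<in> carrier L" "fls_subdegree (embed \<xi> \<eta> f0) < 0"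
  obtains P d where "P \<in> Pts" "0 < d"
    "\<And>f. f \<in> carrier L \<Longrightarrow> f \<noteq> \<zero>\<^bsub>L\<^esub> \<Longrightarrow> fls_subdegree (embed \<xi> \<eta> f) = d * P f"
proof -
  interpret Lf: field L by (rule field_L)
  define C where "C = carrier L - {\<zero>\<^bsub>L\<^esub>}"
  define o' where "o' f = fls_subdegree (embed \<xi> \<eta> f)" for f
  have mult: "f \<otimes>\<^bsub>L\<^esub> g \<in> C \<and> o' (f \<otimes>\<^bsub>L\<^esub> g) = o' f + o' g" if "f \<in> C" "g \<in> C" for f g
    using that by (auto simp: C_def o'_def embed_mult[OF emb] embed_eq_0_iff[OF emb] Lf.integral_iff)
  have inv: "\<exists>g \<in> C. o' g = - o' f" if "f \<in> C" for f
  proof -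
    obtain g where g: "g \<in> carrier L" "f \<otimes>\<^bsub>L\<^esub> g = \<one>\<^bsub>L\<^esub>"
      using L_inverse[of f] \<open>f \<in> C\<close> unfolding C_def by blast
    then have "g \<noteq> \<zero>\<^bsub>L\<^esub>" using that Lf.r_null by (auto simp: C_def)
    then have "g \<in> C" using g by (simp add: C_def)
    moreover have "o' f + o' g = 0" using mult[OF that \<open>g \<in> C\<close>] g by (simp add: o'_def embed_1[OF emb])
    ultimately show ?thesis by force
  qed
  have one: "\<one>\<^bsub>L\<^esub> \<in> C \<and> o' \<one>\<^bsub>L\<^esub> = 0" by (simp add: C_def o'_def embed_1[OF emb])
  define S where "S = o' ` C"
  have S_add: "a + b \<in> S" if "a \<in> S" "b \<in> S" for a b
    using that mult unfolding S_def by (metis (no_types, lifting) imageE imageI)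
  have S_neg: "- a \<in> S" if "a \<in> S" for a
    using that inv unfolding S_def by (metis (no_types, lifting) imageE imageI)
  have S_0: "0 \<in> S" using one unfolding S_def by (metis imageI)
  have S_nat: "int n * a \<in> S" if "a \<in> S" for n a
    by (induction n) (use S_0 S_add that in \<open>auto simp: algebra_simps\<close>)
  have S_mult: "k * a \<in> S" if "a \<in> S" for k a
    using S_nat[OF that, of "nat k"] S_neg[OF S_nat[OF that, of "nat (- k)"]] by (cases "0 \<le> k") auto
  \<comment> \<open>If the value of \<open>x\<close> at the centre is transcendental over
    \<open>K\<close>, all orders are zero; the function \<open>f0\<close> of negative order excludes
    this and makes the value group \<open>S\<close> nontrivial.\<close>
  have "f0 \<in> C" using f0 by (auto simp: C_def embed_0[OF emb])
  then have "- o' f0 \<in> S" "- o' f0 > 0" using f0 S_neg by (auto simp: S_def o'_def)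
  then have ex: "int (nat (- o' f0)) \<in> S \<and> 0 < nat (- o' f0)" by simp
  define d where "d = int (LEAST n. int n \<in> S \<and> 0 < n)"
  have d: "d \<in> S" "0 < d"
    using LeastI[of "\<lambda>n. int n \<in> S \<and> 0 < n", OF ex] by (auto simp: d_def)
  have dmin: "d \<le> a" if "a \<in> S" "0 < a" for a
    using Least_le[of "\<lambda>n. int n \<in> S \<and> 0 < n" "nat a"] that by (simp add: d_def)
  have dvd: "d dvd a" if "a \<in> S" for a
  proof -
    have "a mod d = a + (- (a div d)) * d" by (simp add: minus_div_mult_eq_mod [symmetric])
    then have "a mod d \<in> S" using S_add S_mult that d by metis
    then have "a mod d = 0" using dmin[of "a mod d"] pos_mod_bound[of d a] pos_mod_sign[of d a] d by fastforce
    then show ?thesis by auto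
  qed
  define P where "P = restrict (\<lambda>f. o' f div d) C"
  have oP: "o' f = d * P f" if "f \<in> C" for f
    using that dvd[of "o' f"] by (simp add: P_def S_def)
  have "P \<in> Pts"
  proof (rule pointI)
    fix f g assume fg: "f \<in> carrier L" "f \<noteq> \<zero>\<^bsub>L\<^esub>" "g \<in> carrier L" "g \<noteq> \<zero>\<^bsub>L\<^esub>"
    then have "f \<in> C" "g \<in> C" by (auto simp: C_def)
    then have "d * P (f \<otimes>\<^bsub>L\<^esub> g) = d * (P f + P g)"
      using mult[of f g] oP[of f] oP[of g] oP[of "f \<otimes>\<^bsub>L\<^esub> g"] by (simp add: distrib_left)
    then show "P (f \<otimes>\<^bsub>L\<^esub> g) = P f + P g" using d by simp
    assume "f \<oplus>\<^bsub>L\<^esub> g \<noteq> \<zero>\<^bsub>L\<^esub>"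
    then have "f \<oplus>\<^bsub>L\<^esub> g \<in> C" using fg by (simp add: C_def)
    moreover have "min (o' f) (o' g) \<le> o' (f \<oplus>\<^bsub>L\<^esub> g)"
      using fls_plus_subdegree[of "embed \<xi> \<eta> f" "embed \<xi> \<eta> g"] \<open>f \<oplus>\<^bsub>L\<^esub> g \<noteq> \<zero>\<^bsub>L\<^esub>\<close>
      by (simp add: o'_def embed_eq_0_iff[OF emb] flip: embed_add[OF emb])
    ultimately have "d * min (P f) (P g) \<le> d * P (f \<oplus>\<^bsub>L\<^esub> g)"
      using \<open>f \<in> C\<close> \<open>g \<in> C\<close> d by (simp add: oP min_mult_distrib_left)
    then show "min (P f) (P g) \<le> P (f \<oplus>\<^bsub>L\<^esub> g)" using d by simp
  next
    fix c assume "c \<in> K" "c \<noteq> 0"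
    then have "const c \<in> C" using const_inj[of c 0] by (simp add: C_def const_in_L const_0)
    then have "d * P (const c) = 0" using oP[of "const c"] by (simp add: o'_def embed_const[OF emb])
    then show "P (const c) = 0" using d by simp
  next
    fix n
    have "n * d \<in> S" using S_mult d by blast
    then obtain f where "f \<in> C" "o' f = n * d" unfolding S_def by (metis imageE)
    then show "\<exists>f \<in> carrier L. f \<noteq> \<zero>\<^bsub>L\<^esub> \<and> P f = n"
      using oP[of f] d by (auto simp: C_def intro!: bexI[of _ f])
  next
    show "P \<in> extensional (carrier L - {\<zero>\<^bsub>L\<^esub>})" by (simp add: P_def C_def)
  qed
  then show ?thesis
    using that d oP by (auto simp: C_def o'_def)
qed

end

section \<open>Points at infinity and fibres of \<open>x\<close>\<close>

lemma subsingleton_sum: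
  fixes f :: "'a \<Rightarrow> int"
  assumes "\<And>P Q. P \<in> S \<Longrightarrow> Q \<in> S \<Longrightarrow> P = Q \<and> f P = c" "0 \<le> c"
  shows "finite S" "sum f S \<le> c"
proof -
  have "S = {} \<or> (\<exists>P. S = {P})" using assms(1) by blast
  then show "finite S" "sum f S \<le> c" using assms by auto
qed

lemma sum_Un_le:
  fixes f :: "'a \<Rightarrow> int"
  assumes "finite A" "finite B" "\<And>x. x \<in> A \<Longrightarrow> 0 \<le> f x"
  shows "sum f (A \<union> B) \<le> sum f A + sum f B"
proof -
  have "0 \<le> sum f (A \<inter> B)" using assms by (intro sum_nonneg) auto
  then show ?thesis using sum.union_inter[of A B f] assms by linarith
qed

context double_cover
begin

abbreviation vge_at :: "(double_cover_function \<Rightarrow> int) \<Rightarrow> int \<Rightarrow> complex fls \<Rightarrow> bool" where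
  "vge_at P \<equiv> valued.vge E (val P)"

lemma x_shift_nonzero: "base_x - fls_const c \<noteq> 0"
  using eval_fls_eq_0_iff[OF transcendental_base_x, of "[:- c, 1:]"] by simp

text \<open>Polynomials in \<open>x\<close> have no pole where \<open>x\<close> has none, and the
  square of \<open>y\<close> is such a polynomial.\<close>

lemma finite_y:
  assumes "P \<in> Pts" "0 \<le> val P base_x"
  shows "0 \<le> val P base_y" "\<And>p. poly_over K p \<Longrightarrow> vge_at P 0 (eval_fls base_x p)"
proof -
  interpret valued K E "val P" by (rule valued_point[OF assms(1)])
  show *: "vge 0 (eval_fls base_x p)" if "poly_over K p" for p
    using that
  proof (induction p)
    case (pCons a p)
    have "vge (0 + 0) (base_x * eval_fls base_x p)"
      using pCons by (intro vge_mult vge_self[OF base_x_in_E assms(2)]) (simp add: poly_over_pCons)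
    then show ?case
      using pCons by (simp add: vge_add vge_const poly_over_pCons)
  qed (simp add: vge_0)
  have "vge 0 (base_y\<^sup>2)" unfolding base_y_square by (intro * F_over)
  then show "0 \<le> val P base_y"
    using v_power[OF base_y_in_E base_y_nonzero, of 2] base_y_nonzero by (simp add: vge_def)
qed

lemma at_infinity_iff:
  assumes "P \<in> Pts"
  shows "is_at_infinity P \<longleftrightarrow> val P base_x < 0"
  using finite_y(1)[OF assms] val_\<phi>[of P coord_x] val_\<phi>[of P coord_y]
  unfolding is_at_infinity_def \<phi>_x \<phi>_y by linarith

text \<open>The square of \<open>y / x^3\<close> is the reversed polynomial of \<open>F\<close> at
  \<open>1 / x\<close>; its residue is the leading coefficient 1.\<close>

lemma infinite_branch:
  assumes "P \<in> Pts" "val P base_x < 0"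
  shows "vge_at P 1 (base_y / base_x ^ 3 - fls_const 1) \<or> vge_at P 1 (base_y / base_x ^ 3 - fls_const (- 1))"
proof -
  interpret valued K E "val P" by (rule valued_point[OF assms(1)])
  have u: "vge 1 (inverse base_x)"
    using assms base_x_in_E by (intro vge_self) (auto simp: E_closed v_inverse)
  have "vge 1 (eval_fls (inverse base_x) (reflect_poly F) - fls_const (coeff (reflect_poly F) 0))"
    by (intro residue_eval poly_over_reflect F_over u)
  moreover have "eval_fls (inverse base_x) (reflect_poly F) = (base_y / base_x ^ 3)\<^sup>2"
    using eval_fls_reflect[of base_x F] F_degree
    by (simp add: power_divide base_y_square base_x_nonzero flip: power_mult)
  ultimately have "vge 1 ((base_y / base_x ^ 3)\<^sup>2 - fls_const (1\<^sup>2))"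
    using F_monic by simp
  then show ?thesis
    using base_x_in_E base_y_in_E by (intro residue_square) (auto simp: E_closed K_closed)
qed

text \<open>The unramified case with parameter \<open>1 / x\<close> and the unit
  \<open>y / x^3\<close>.\<close>

lemma infinite_unique:
  assumes P: "P \<in> Pts" "val P base_x < 0" "vge_at P 1 (base_y / base_x ^ 3 - fls_const s)"
    and Q: "Q \<in> Pts" "val Q base_x < 0" "vge_at Q 1 (base_y / base_x ^ 3 - fls_const s)"
    and s: "s \<in> K" "s \<noteq> 0"
  shows "P = Q" "val P base_x = - 1"
proof -
  define u where "u = inverse base_x"
  have v: "val R u = - val R base_x" if "R \<in> Pts" for R
    using valued.v_inverse[OF valued_point[OF that] base_x_in_E] by (simp add: u_def)
  have u: "u \<in> E" "base_x \<in> Rat u" "u \<noteq> 0" "u ^ 3 \<noteq> 0" "u ^ 3 \<in> Rat u"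
    using E_field(5)[OF base_x_in_E] Rat_inverse[OF Rat_self, of u]
    by (auto simp: u_def base_x_nonzero intro!: Rat_power Rat_self)
  have w: "base_y * u ^ 3 = base_y / base_x ^ 3"
    by (simp add: u_def power_inverse divide_inverse)
  have "P = Q \<and> val P u = 1"
    using unramified_unique[of P u "u ^ 3" s Q] assms u by (simp add: w v)
  then show "P = Q" "val P base_x = - 1" using v[OF P(1)] by auto
qed

lemma infinite_fiber:
  shows "finite {P \<in> Pts. val P base_x < 0}" "(\<Sum>P | P \<in> Pts \<and> val P base_x < 0. - val P base_x) \<le> 2"
proof -
  define S where "S s = {P \<in> Pts. val P base_x < 0 \<and> vge_at P 1 (base_y / base_x ^ 3 - fls_const s)}" for s
  have S: "finite (S s)" "(\<Sum>P \<in> S s. - val P base_x) \<le> 1" if "s \<in> K" "s \<noteq> 0" for s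
    using subsingleton_sum[of "S s" "\<lambda>P. - val P base_x" 1] infinite_unique[of _ s] that
    by (auto simp: S_def)
  have eq: "{P \<in> Pts. val P base_x < 0} = S 1 \<union> S (- 1)"
    using infinite_branch by (auto simp: S_def)
  have "(\<Sum>P \<in> S 1 \<union> S (- 1). - val P base_x) \<le> (\<Sum>P \<in> S 1. - val P base_x) + (\<Sum>P \<in> S (- 1). - val P base_x)"
    using S[of 1] S[of "- 1"] K_closed by (intro sum_Un_le) (auto simp: S_def)
  then show "finite {P \<in> Pts. val P base_x < 0}" "(\<Sum>P | P \<in> Pts \<and> val P base_x < 0. - val P base_x) \<le> 2"
    using S[of 1] S[of "- 1"] K_closed by (auto simp: eq)
qed

text \<open>Write \<open>F = (x - c)^k F1\<close> and divide \<open>y\<close> by \<open>u^m\<close>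
  with \<open>m = k div 2\<close>. For even \<open>k\<close> the quotient is a unit whose residue is
  one of the two roots of \<open>F1(c)\<close>, each allowing at most one point with
  \<open>u\<close> of order one. For odd \<open>k\<close> its order is half that of
  \<open>u\<close>, and at most one point occurs, with \<open>u\<close> of order two.\<close>

lemma finite_fiber:
  assumes K: "K = UNIV"
  shows "finite {P \<in> Pts. 0 < val P (base_x - fls_const c)}"
    and "(\<Sum>P | P \<in> Pts \<and> 0 < val P (base_x - fls_const c). val P (base_x - fls_const c)) \<le> 2"
proof -
  define u where "u = base_x - fls_const c"
  have x: "base_x = u + fls_const c" by (simp add: u_def)
  have u: "u \<in> E" "u \<noteq> 0" "base_x \<in> Rat u"
    using x_shift_nonzero[of c] E_field(2)[OF base_x_in_E E_field(1)[of "- c"]] Rat_add[OF Rat_self Rat_const, of c u] K x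
    by (auto simp: u_def)
  define k where "k = order c F"
  obtain F1 where F1: "F = [:- c, 1:] ^ k * F1" "\<not> [:- c, 1:] dvd F1"
    using order_decomp[of F c] F_degree unfolding k_def by fastforce
  define r where "r = poly F1 c"
  have r: "r \<noteq> 0" using F1(2) by (simp add: r_def poly_eq_0_iff_dvd)
  have Y2: "base_y\<^sup>2 = u ^ k * eval_fls base_x F1"
    unfolding base_y_square by (subst F1(1)) (simp add: eval_fls_mult eval_fls_power u_def)
  have res: "vge_at P 1 (eval_fls base_x F1 - fls_const r)" if "P \<in> Pts" "0 < val P u" for P
  proof -
    interpret valued K E "val P" by (rule valued_point[OF that(1)])
    have "vge 1 (eval_fls u (pcompose F1 [:c, 1:]) - fls_const (coeff (pcompose F1 [:c, 1:]) 0))"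
      using u that K by (intro residue_eval vge_self) (auto simp: poly_over_def)
    moreover have "coeff (pcompose F1 [:c, 1:]) 0 = r"
      by (simp add: r_def poly_pcompose flip: poly_0_coeff_0)
    ultimately show ?thesis by (simp add: u_def eval_fls_shift[of base_x F1 c])
  qed
  define m where "m = k div 2"
  define w where "w = inverse (u ^ m)"
  have w: "w \<noteq> 0" "w \<in> Rat u" "w \<in> E"
    using u valued.E_power E_field(5) by (auto simp: w_def intro!: Rat_inverse Rat_power Rat_self)
      (induction m; use u E_field(4) E_field(1)[OF K_1] in auto)
  have mw: "u ^ m * w = 1" using u by (simp add: w_def)
  define S where "S = {P \<in> Pts. 0 < val P u}"
  have "finite S \<and> (\<Sum>P \<in> S. val P u) \<le> 2"
  proof (cases "even k")
    case True
    then have k: "k = m + m" by (auto simp: m_def)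
    have "(base_y * w)\<^sup>2 = eval_fls base_x F1"
    proof -
      have "(base_y * w)\<^sup>2 = (u ^ m * w) * (u ^ m * w) * eval_fls base_x F1"
        by (simp only: power_mult_distrib Y2) (simp add: k power_add power2_eq_square mult_ac)
      then show ?thesis by (simp add: mw)
    qed
    define s where "s = csqrt r"
    have s: "s \<noteq> 0" "s\<^sup>2 = r" using r by (simp_all add: s_def)
    define T where "T t = {P \<in> Pts. 0 < val P u \<and> vge_at P 1 (base_y * w - fls_const t)}" for t
    have T: "finite (T t)" "(\<Sum>P \<in> T t. val P u) \<le> 1" if "t \<noteq> 0" for t
      using subsingleton_sum[of "T t" "\<lambda>P. val P u" 1] unramified_unique[of _ u w t] u w that K
      by (auto simp: T_def)
    have "vge_at P 1 (base_y * w - fls_const s) \<or> vge_at P 1 (base_y * w - fls_const (- s))" if "P \<in> Pts" "0 < val P u" for P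
      using res[OF that] s \<open>(base_y * w)\<^sup>2 = _\<close> w base_y_in_E E_field(4) K
      by (intro valued.residue_square[OF valued_point[OF that(1)]]) auto
    then have eq: "S = T s \<union> T (- s)" by (auto simp: S_def T_def)
    have "(\<Sum>P \<in> T s \<union> T (- s). val P u) \<le> (\<Sum>P \<in> T s. val P u) + (\<Sum>P \<in> T (- s). val P u)"
      using T[of s] T[of "- s"] s by (intro sum_Un_le) (auto simp: T_def)
    then show ?thesis using T[of s] T[of "- s"] s by (auto simp: eq)
  next
    case False
    then have k: "k = Suc (m + m)" unfolding m_def by presburger
    have zz: "(base_y * w)\<^sup>2 = u * eval_fls base_x F1"
    proof -
      have "(base_y * w)\<^sup>2 = (u ^ m * w) * (u ^ m * w) * (u * eval_fls base_x F1)"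
        by (simp only: power_mult_distrib Y2) (simp add: k power_add power2_eq_square mult_ac)
      then show ?thesis by (simp add: mw)
    qed
    have v: "2 * val P (base_y * w) = 1 * val P u" if "P \<in> Pts" "0 < val P u" for P
    proof -
      interpret valued K E "val P" by (rule valued_point[OF that(1)])
      note f1 = v_unit[OF _ r res[OF that]]
      have "val P ((base_y * w)\<^sup>2) = 2 * val P (base_y * w)"
        using v_power[of "base_y * w" 2] w base_y_in_E base_y_nonzero by (simp add: E_mult)
      moreover have "val P ((base_y * w)\<^sup>2) = val P u"
        unfolding zz using f1 u K by (simp add: v_mult)
      ultimately show ?thesis by simp
    qed
    have "P = Q \<and> val P u = 2" if "P \<in> S" "Q \<in> S" for P Q
      using ramified_unique[of P u w 1 Q] that v[of P] v[of Q] u w by (auto simp: S_def)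
    then show ?thesis using subsingleton_sum[of S "\<lambda>P. val P u" 2] by simp
  qed
  then show "finite {P \<in> Pts. 0 < val P (base_x - fls_const c)}"
    "(\<Sum>P | P \<in> Pts \<and> 0 < val P (base_x - fls_const c). val P (base_x - fls_const c)) \<le> 2"
    by (simp_all add: S_def u_def)
qed

text \<open>Otherwise every \<open>x - c\<close> has order zero, and so does every nonzero rational
  function of \<open>x\<close>, since complex polynomials split. An element \<open>f\<close> of
  order one then has a conjugate \<open>g\<close> of order minus one, the norm having order zero.
  Hence the trace \<open>f + g\<close> has order minus one although it is a rational function of
  \<open>x\<close>.\<close>

lemma finite_center:
  assumes K: "K = UNIV" and P: "P \<in> Pts" "0 \<le> val P base_x"
  obtains c where "0 < val P (base_x - fls_const c)"
proof (rule ccontr)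
  assume "\<not> thesis"
  then have no: "val P (base_x - fls_const c) \<le> 0" for c using that not_le by blast
  interpret valued K E "val P" by (rule valued_point[OF P(1)])
  have "vge 0 (base_x - fls_const c)" for c
    using P base_x_in_E K by (intro vge_diff vge_const vge_self) auto
  then have lin: "val P (base_x - fls_const c) = 0" for c
    using no[of c] x_shift_nonzero[of c] by (force simp: vge_def)
  have inE: "eval_fls base_x p \<in> E" for p
    using base_x_in_E K by (intro eval_in_E) (auto simp: poly_over_def)
  have pol: "val P (eval_fls base_x p) = 0" if "p \<noteq> 0" for p
    using that
  proof (induction "degree p" arbitrary: p)
    case 0
    then obtain a where "p = [:a:]" "a \<noteq> 0" by (metis degree_0_id pCons_0_0 of_nat_0 degree_eq_zeroE)
    then show ?case using K v_const[of a] by simp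
  next
    case (Suc n)
    then obtain c where "poly p c = 0"
      using fundamental_theorem_of_algebra_alt[of p] by (metis degree_pCons_0 nat.distinct(1) pCons_0_0)
    then obtain q where q: "p = [:- c, 1:] * q" by (auto simp: poly_eq_0_iff_dvd elim: dvdE)
    then have "q \<noteq> 0" using Suc by auto
    then have "degree q = n" using Suc q by (simp del: mult_pCons_left add: degree_mult_eq)
    have "eval_fls base_x p = (base_x - fls_const c) * eval_fls base_x q"
      unfolding q eval_fls_mult by simp
    moreover have "eval_fls base_x q \<noteq> 0"
      using \<open>q \<noteq> 0\<close> by (simp add: eval_fls_eq_0_iff[OF transcendental_base_x])
    moreover have "base_x - fls_const c \<in> E"
      using base_x_in_E K by (intro E_closed) auto
    ultimately show ?case
      using Suc(1)[of q] \<open>degree q = n\<close> \<open>q \<noteq> 0\<close> lin[of c] x_shift_nonzero[of c] inE[of q]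
      by (simp add: v_mult del: right_minus_eq)
  qed
  have rat: "val P a = 0" if "a \<in> Rat base_x" "a \<noteq> 0" for a
    using that(1)
  proof (rule RatE)
    fix p q assume "eval_fls base_x q \<noteq> 0" "a = eval_fls base_x p / eval_fls base_x q"
    then show ?thesis using pol[of p] pol[of q] inE that(2)
      by (auto simp: v_divide eval_fls_eq_0_iff[OF transcendental_base_x])
  qed
  obtain f where f: "f \<in> E" "f \<noteq> 0" "val P f = 1" by (rule val_surj[OF P(1)])
  obtain a b where ab: "a \<in> Rat base_x" "b \<in> Rat base_x" "f = a + b * base_y"
    using f(1) by (rule E_decompose)
  define g where "g = a - b * base_y"
  have g: "g \<in> E" "g \<noteq> 0"
    using E_conj_nonzero ab f E_compose[of a "- b"] Rat_diff[OF Rat_0, of b] by (auto simp: g_def)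
  have "f * g = a\<^sup>2 - b\<^sup>2 * base_y\<^sup>2" by (simp add: g_def ab algebra_simps power2_eq_square)
  also have "\<dots> \<in> Rat base_x"
    unfolding base_y_square by (intro Rat_diff Rat_mult Rat_power ab Rat_eval F_over)
  finally have "val P f + val P g = 0"
    using rat[of "f * g"] f g v_mult[of f g] by simp
  then have "val P g = - 1" using f by simp
  then have "val P (g + f) = - 1" "g + f \<noteq> 0"
    using v_add_eq[of g f] f g by (auto simp: vge_def)
  moreover have "g + f \<in> Rat base_x"
    using Rat_add[OF ab(1) ab(1)] by (simp add: g_def ab)
  ultimately show False using rat[of "g + f"] by simp
qed

end

section \<open>Regular functions\<close>

lemma subdegree_eval_near:
  assumes "0 < fls_subdegree (\<xi> - fls_const a)"
  shows "p \<noteq> 0 \<Longrightarrow> poly p a = 0 \<Longrightarrow> 0 < fls_subdegree (eval_fls \<xi> p)"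
    and "poly p a \<noteq> 0 \<Longrightarrow> fls_subdegree (eval_fls \<xi> p) = 0"
    and "0 \<le> fls_subdegree (eval_fls \<xi> p)"
    and "transcendental \<xi>"
proof -
  interpret v: valued UNIV UNIV fls_subdegree by (rule valued_subdegree[OF constants_UNIV])
  show tr: "transcendental \<xi>"
    by (rule transcendental_shift[OF transcendental_positive[OF assms]])
  have "v.vge 1 (eval_fls (\<xi> - fls_const a) (pcompose p [:a, 1:])
      - fls_const (coeff (pcompose p [:a, 1:]) 0))"
    using assms by (intro v.residue_eval v.vge_self) (auto simp: poly_over_def)
  moreover have "coeff (pcompose p [:a, 1:]) 0 = poly p a"
    by (simp add: poly_pcompose flip: poly_0_coeff_0)
  ultimately have *: "v.vge 1 (eval_fls \<xi> p - fls_const (poly p a))"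
    by (simp add: eval_fls_shift[of \<xi> p a])
  show 1: "0 < fls_subdegree (eval_fls \<xi> p)" if "p \<noteq> 0" "poly p a = 0"
    using * that eval_fls_eq_0_iff[OF tr] by (auto simp: v.vge_def)
  show 2: "fls_subdegree (eval_fls \<xi> p) = 0" if "poly p a \<noteq> 0"
    using v.v_unit(2)[OF _ that *] by simp
  show "0 \<le> fls_subdegree (eval_fls \<xi> p)"
    using 1 2 by (cases "p = 0"; cases "poly p a = 0") auto
qed

context double_cover
begin

sublocale L: field L
  by (rule field_L)

lemma subalgebraI:
  assumes "V \<subseteq> carrier L" "\<zero>\<^bsub>L\<^esub> \<in> V"
    and "\<And>f g. f \<in> V \<Longrightarrow> g \<in> V \<Longrightarrow> f \<oplus>\<^bsub>L\<^esub> g \<in> V"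
    and smult: "\<And>c f. c \<in> K \<Longrightarrow> f \<in> V \<Longrightarrow> const c \<otimes>\<^bsub>L\<^esub> f \<in> V"
  shows "subalgebra (const ` K) V L"
proof -
  have "\<ominus>\<^bsub>L\<^esub> f \<in> V" if "f \<in> V" for f
  proof -
    have "const (- 1) \<oplus>\<^bsub>L\<^esub> \<one>\<^bsub>L\<^esub> = \<zero>\<^bsub>L\<^esub>"
      by (simp add: const_add const_0 flip: const_1)
    then have "const (- 1) = \<ominus>\<^bsub>L\<^esub> \<one>\<^bsub>L\<^esub>"
      using const_in_L[of "- 1"] K_closed by (intro L.minus_equality[symmetric]) auto
    then have "const (- 1) \<otimes>\<^bsub>L\<^esub> f = \<ominus>\<^bsub>L\<^esub> f"
      using that assms(1) by (auto simp: L.l_minus)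
    then show ?thesis using smult[of "- 1" f] that K_closed by simp
  qed
  then have "subgroup V (add_monoid L)"
    using assms by (intro L.add.subgroupI) (auto simp: a_inv_def)
  then show ?thesis
    using smult by (auto simp: subalgebra_def subalgebra_axioms_def)
qed

lemma x_in_L: "coord_x \<in> carrier L" and y_in_L: "coord_y \<in> carrier L"
  by (auto simp: coord_x_def coord_y_def carrier_L poly_over_pCons poly_over_0 K_closed intro!: rf_closed)

lemma x_nonzero: "coord_x \<noteq> \<zero>\<^bsub>L\<^esub>"
  using \<phi>_eq_0_iff[of coord_x] base_x_nonzero by (simp add: \<phi>_x del: base_x_nonzero)

lemma conj_embedding: "embedding base_x (- base_y)"
  using base_embedding by (simp add: embedding_def)

section \<open>The hyperelliptic involution on functions and points\<close>

lemma involution_fun_involution: "involution_fun (involution_fun f) = f"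
  by (cases f) (simp add: involution_fun_def)

lemma involution_fun_carrier: "f \<in> carrier L \<Longrightarrow> involution_fun f \<in> carrier L"
  by (cases f) (auto simp: involution_fun_def carrier_L rf_uminus)

lemma involution_fun_hom:
  "involution_fun (f \<oplus>\<^bsub>L\<^esub> g) = involution_fun f \<oplus>\<^bsub>L\<^esub> involution_fun g"
  "involution_fun (f \<otimes>\<^bsub>L\<^esub> g) = involution_fun f \<otimes>\<^bsub>L\<^esub> involution_fun g"
  by (cases f; cases g; simp add: involution_fun_def add_L mult_L)+

lemma involution_fun_const: "involution_fun (const c) = const c"
  by (simp add: involution_fun_def const_def)

lemma involution_fun_eq_0_iff: "involution_fun f = \<zero>\<^bsub>L\<^esub> \<longleftrightarrow> f = \<zero>\<^bsub>L\<^esub>"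
  by (cases f) (simp add: involution_fun_def zero_L)

lemma involution_point:
  assumes "P \<in> Pts"
  shows "involution P \<in> Pts"
proof (rule pointI)
  fix n
  obtain f where "f \<in> carrier L" "f \<noteq> \<zero>\<^bsub>L\<^esub>" "P f = n" using point_surj[OF assms, of n] by blast
  then show "\<exists>f \<in> carrier L. f \<noteq> \<zero>\<^bsub>L\<^esub> \<and> involution P f = n"
    by (intro bexI[of _ "involution_fun f"])
      (auto simp: involution_def involution_fun_involution involution_fun_eq_0_iff involution_fun_carrier)
next
  show "involution P \<in> extensional (carrier L - {\<zero>\<^bsub>L\<^esub>})"
    unfolding extensional_def mem_Collect_eq
  proof (intro allI impI)
    fix f assume "f \<notin> carrier L - {\<zero>\<^bsub>L\<^esub>}"
    then have "involution_fun f \<notin> carrier L - {\<zero>\<^bsub>L\<^esub>}"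
      using involution_fun_carrier[of "involution_fun f"]
      by (auto simp: involution_fun_involution involution_fun_eq_0_iff)
    then show "involution P f = undefined"
      using extensional_arb[OF point_extensional[OF assms]] by (simp add: involution_def)
  qed
next
  fix f g
  assume fg: "f \<in> carrier L" "f \<noteq> \<zero>\<^bsub>L\<^esub>" "g \<in> carrier L" "g \<noteq> \<zero>\<^bsub>L\<^esub>"
  then show "involution P (f \<otimes>\<^bsub>L\<^esub> g) = involution P f + involution P g"
    unfolding involution_def involution_fun_hom
    by (intro point_mult[OF assms]) (auto simp: involution_fun_carrier involution_fun_eq_0_iff)
  assume "f \<oplus>\<^bsub>L\<^esub> g \<noteq> \<zero>\<^bsub>L\<^esub>"
  then have "involution_fun f \<oplus>\<^bsub>L\<^esub> involution_fun g \<noteq> \<zero>\<^bsub>L\<^esub>"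
    using involution_fun_eq_0_iff[of "f \<oplus>\<^bsub>L\<^esub> g"] by (simp add: involution_fun_hom)
  then show "min (involution P f) (involution P g) \<le> involution P (f \<oplus>\<^bsub>L\<^esub> g)"
    unfolding involution_def involution_fun_hom using fg
    by (intro point_add[OF assms]) (auto simp: involution_fun_carrier involution_fun_eq_0_iff)
next
  fix c :: complex assume "c \<in> K" "c \<noteq> 0"
  then show "involution P (const c) = 0"
    using point_const[OF assms] by (simp add: involution_def involution_fun_const)
qed

section \<open>Riemann-Roch spaces as subspaces of the function field\<close>

lemma vge_at_\<phi>: "P \<in> Pts \<Longrightarrow> f \<in> carrier L \<Longrightarrow> vge_at P n (\<phi> f) \<longleftrightarrow> f = \<zero>\<^bsub>L\<^esub> \<or> n \<le> P f"
  by (simp add: valued.vge_def[OF valued_point] \<phi>_in_E \<phi>_eq_0_iff val_\<phi>)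

text \<open>Away from the points both \<open>D\<close> and \<open>div_of\<close> are zero by
  convention, so the comparison of divisors is one between orders at points.\<close>

lemma riemann_roch_iff:
  assumes "D \<in> divisors L (const ` K)"
  shows "f \<in> riemann_roch_space L (const ` K) D \<longleftrightarrow>
    f \<in> carrier L \<and> (\<forall>P \<in> Pts. vge_at P (- D P) (\<phi> f))"
proof -
  have "D P = 0" if "P \<notin> Pts" for P using assms that by (auto simp: divisors_def)
  then have "(\<lambda>P. - D P) \<le> div_of L (const ` K) f \<longleftrightarrow> (\<forall>P \<in> Pts. - D P \<le> P f)"
    by (auto simp: le_fun_def div_of_def)
  then show ?thesis by (auto simp: riemann_roch_space_def vge_at_\<phi>)
qed

lemma riemann_roch_subalgebra:
  assumes "D \<in> divisors L (const ` K)"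
  shows "subalgebra (const ` K) (riemann_roch_space L (const ` K) D) L"
proof (rule subalgebraI)
  show "riemann_roch_space L (const ` K) D \<subseteq> carrier L"
    by (auto simp: riemann_roch_space_def)
  show "\<zero>\<^bsub>L\<^esub> \<in> riemann_roch_space L (const ` K) D"
    by (simp add: riemann_roch_space_def)
next
  fix f g assume "f \<in> riemann_roch_space L (const ` K) D" "g \<in> riemann_roch_space L (const ` K) D"
  then show "f \<oplus>\<^bsub>L\<^esub> g \<in> riemann_roch_space L (const ` K) D"
    by (simp add: riemann_roch_iff[OF assms] \<phi>_add valued.vge_add[OF valued_point])
next
  fix c f assume c: "c \<in> K" and f: "f \<in> riemann_roch_space L (const ` K) D"
  have "vge_at P (0 + - D P) (fls_const c * \<phi> f)" if "P \<in> Pts" for P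
  proof -
    interpret valued K E "val P" by (rule valued_point[OF that])
    show ?thesis using f c that by (intro vge_mult vge_const) (auto simp: riemann_roch_iff[OF assms])
  qed
  then show "const c \<otimes>\<^bsub>L\<^esub> f \<in> riemann_roch_space L (const ` K) D"
    using c f by (simp add: riemann_roch_iff[OF assms] \<phi>_mult \<phi>_const const_in_L)
qed

lemma multiple_of_point_divisor: "P \<in> Pts \<Longrightarrow> multiple_of_point n P \<in> divisors L (const ` K)"
  by (auto simp: divisors_def multiple_of_point_def intro: finite_subset[of _ "{P}"])

section \<open>Functions without poles over the affine line, or without any poles\<close>

text \<open>At a root \<open>a\<close> of the reduced denominator the numerator is nonzero, so the
  function would have a pole along \<open>a + t^2\<close>. A complex polynomial without roots is
  constant.\<close>

lemma Fract_is_poly: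
  fixes A :: "complex poly fract"
  assumes "\<And>a \<xi>. \<xi> = fls_const a + fls_X ^ 2 \<Longrightarrow> 0 \<le> fls_subdegree (eval_fract \<xi> A)"
  obtains p where "A = Fract p 1"
proof -
  obtain p q where pq: "A = Fract p q" "q \<noteq> 0" "coprime p q"
    by (rule quot_of_fract_cases)
  have "poly q a \<noteq> 0" for a
  proof
    assume qa: "poly q a = 0"
    then have "poly p a \<noteq> 0"
      using \<open>coprime p q\<close> coprime_poly_0 by blast
    define \<xi> where "\<xi> = fls_const a + (fls_X :: complex fls) ^ 2"
    have \<xi>: "0 < fls_subdegree (\<xi> - fls_const a)" by (simp add: \<xi>_def fls_subdegree_pow)
    note r = subdegree_eval_near[OF \<xi>]
    have "eval_fract \<xi> A * eval_fls \<xi> q = eval_fls \<xi> p"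
      using pq by (simp add: eval_fract_Fract[OF r(4)] eval_fls_eq_0_iff[OF r(4)])
    moreover have "eval_fls \<xi> p \<noteq> 0"
      using \<open>poly p a \<noteq> 0\<close> eval_fls_eq_0_iff[OF r(4)] by force
    ultimately have "fls_subdegree (eval_fract \<xi> A) + fls_subdegree (eval_fls \<xi> q) = 0"
      using r(2)[OF \<open>poly p a \<noteq> 0\<close>] by (metis fls_subdegree_mult mult_eq_0_iff)
    moreover have "0 < fls_subdegree (eval_fls \<xi> q)" by (rule r(1)) (use qa pq in auto)
    ultimately show False using assms[OF \<xi>_def] by simp
  qed
  then have "degree q = 0"
    using fundamental_theorem_of_algebra_alt[of q] by (metis degree_pCons_0)
  then obtain c where "q = [:c:]" "c \<noteq> 0" using pq(2) by (metis degree_eq_zeroE pCons_0_0)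
  then have "A = Fract (smult (inverse c) p) 1" using pq by (simp add: eq_fract)
  then show ?thesis by (rule that)
qed

lemma embedding_at:
  obtains \<eta> where "embedding (fls_const a + fls_X ^ 2) \<eta>"
proof -
  define \<xi> where "\<xi> = fls_const a + (fls_X :: complex fls) ^ 2"
  have \<xi>: "0 < fls_subdegree (\<xi> - fls_const a)" by (simp add: \<xi>_def fls_subdegree_pow)
  obtain G where G: "F = [:- a, 1:] ^ order a F * G" "\<not> [:- a, 1:] dvd G"
    using order_decomp[of F a] F_degree by fastforce
  have "poly G a \<noteq> 0" using G(2) by (simp add: poly_eq_0_iff_dvd)
  then have "fls_subdegree (eval_fls \<xi> G) = 0" "G \<noteq> 0"
    using subdegree_eval_near(2)[OF \<xi>] by auto
  moreover have "eval_fls \<xi> F = (fls_X ^ 2) ^ order a F * eval_fls \<xi> G"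
    by (subst G(1)) (simp add: eval_fls_mult eval_fls_power \<xi>_def)
  ultimately have "even (fls_subdegree (eval_fls \<xi> F))"
    by (cases "eval_fls \<xi> G = 0") (simp_all add: fls_subdegree_pow)
  then obtain \<eta> where "\<eta>\<^sup>2 = eval_fls \<xi> F" using fls_sqrt_exists by blast
  then show ?thesis
    using that subdegree_eval_near(4)[OF \<xi>] by (simp add: embedding_def \<xi>_def)
qed

lemma subdegree_add_nonneg: "0 \<le> fls_subdegree a \<Longrightarrow> 0 \<le> fls_subdegree b \<Longrightarrow> 0 \<le> fls_subdegree (a + b :: complex fls)"
  using fls_plus_subdegree[of a b] by (cases "a + b = 0") auto

text \<open>A negative order along a parametrization would produce a point where the function has a
  pole. Applied to the function and its conjugate, this shows that \<open>A\<close>, half their sum,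
  and the square of \<open>B y\<close> have no poles over finite values of \<open>x\<close>. At this
  stage only \<open>B^2 F\<close> is known to be a polynomial; that \<open>B\<close> is one needs
  \<open>F\<close> squarefree.\<close>

lemma regular_affine:
  assumes f: "(A, B) \<in> carrier L"
    and reg: "\<And>P. P \<in> Pts \<Longrightarrow> 0 \<le> val P base_x \<Longrightarrow> vge_at P 0 (\<phi> (A, B))"
  obtains p h where "A = Fract p 1" "B * B * Fract F 1 = Fract h 1"
proof -
  have *: "0 \<le> fls_subdegree (embed \<xi> \<eta> g)"
    if emb: "embedding \<xi> \<eta>" and \<xi>: "0 \<le> fls_subdegree \<xi>" and g: "g \<in> carrier L"
      and gr: "\<And>P. P \<in> Pts \<Longrightarrow> 0 \<le> val P base_x \<Longrightarrow> vge_at P 0 (\<phi> g)" for \<xi> \<eta> g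
  proof (rule ccontr)
    assume neg: "\<not> ?thesis"
    then obtain P d where P: "P \<in> Pts" "0 < d"
      "\<And>f. f \<in> carrier L \<Longrightarrow> f \<noteq> \<zero>\<^bsub>L\<^esub> \<Longrightarrow> fls_subdegree (embed \<xi> \<eta> f) = d * P f"
      using point_of_embedding[OF emb g] by (metis not_le)
    have "0 \<le> d * P coord_x" using P(3)[OF x_in_L x_nonzero] \<xi> by (simp add: embed_x[OF emb])
    then have "0 \<le> val P base_x" using P(2) by (simp add: zero_le_mult_iff val_\<phi> flip: \<phi>_x)
    then have "g = \<zero>\<^bsub>L\<^esub> \<or> 0 \<le> P g" using gr[OF P(1)] vge_at_\<phi>[OF P(1) g] by simp
    moreover have "g \<noteq> \<zero>\<^bsub>L\<^esub>" using neg by (auto simp: embed_0[OF emb])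
    ultimately have "0 \<le> fls_subdegree (embed \<xi> \<eta> g)" using P(2) by (simp add: P(3)[OF g])
    then show False using neg by simp
  qed
  \<comment> \<open>The regularity hypothesis covers all finite points, and the involution permutes
    them, so it passes to the conjugate.\<close>
  have conj: "vge_at P 0 (\<phi> (A, - B))" if "P \<in> Pts" "0 \<le> val P base_x" for P
  proof -
    have "val (involution P) base_x = val P base_x"
      unfolding \<phi>_x[symmetric] val_\<phi> by (simp add: involution_def involution_fun_def coord_x_def)
    then have "vge_at (involution P) 0 (\<phi> (A, B))"
      using reg[OF involution_point] that by simp
    then show ?thesis
      using vge_at_\<phi>[OF involution_point[OF that(1)] f] vge_at_\<phi>[OF that(1) involution_fun_carrier[OF f]]
      by (auto simp: involution_def involution_fun_def zero_L)
  qed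
  have f': "(A, - B) \<in> carrier L" using involution_fun_carrier[OF f] by (simp add: involution_fun_def)
  have key: "0 \<le> fls_subdegree (eval_fract \<xi> A) \<and> 0 \<le> fls_subdegree (eval_fract \<xi> (B * B * Fract F 1))"
    if \<xi>: "\<xi> = fls_const a + fls_X ^ 2" for a \<xi>
  proof -
    obtain \<eta> where emb: "embedding \<xi> \<eta>" using embedding_at[of a] \<xi> by blast
    note tr = embed_trans[OF emb]
    have "0 \<le> fls_subdegree \<xi>"
      unfolding \<xi> by (intro subdegree_add_nonneg) (simp_all add: fls_subdegree_pow)
    then have e: "0 \<le> fls_subdegree (embed \<xi> \<eta> (A, B))" "0 \<le> fls_subdegree (embed \<xi> \<eta> (A, - B))"
      using *[OF emb _ f reg] *[OF emb _ f' conj] by auto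
    have "2 * eval_fract \<xi> A = embed \<xi> \<eta> (A, B) + embed \<xi> \<eta> (A, - B)"
      by (simp add: embed_def eval_fract_uminus[OF tr])
    then have "0 \<le> fls_subdegree (2 * eval_fract \<xi> A)" using e by (simp add: subdegree_add_nonneg)
    then have A: "0 \<le> fls_subdegree (eval_fract \<xi> A)"
      by (cases "eval_fract \<xi> A = 0") (simp_all flip: fls_const_numeral)
    define b where "b = eval_fract \<xi> B * \<eta>"
    have "b = embed \<xi> \<eta> (A, B) + - eval_fract \<xi> A"
      by (simp add: embed_def b_def)
    then have "0 \<le> fls_subdegree b" using e A by (simp add: subdegree_add_nonneg del: add_uminus_conv_diff)
    moreover have "eval_fract \<xi> (B * B * Fract F 1) = b * b"
      using embed_square[OF emb]
      by (simp add: eval_fract_mult[OF tr] eval_fract_poly[OF tr] b_def power2_eq_square mult_ac)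
    ultimately have "0 \<le> fls_subdegree (eval_fract \<xi> (B * B * Fract F 1))"
      by (cases "b = 0") simp_all
    then show ?thesis using A by simp
  qed
  obtain p where "A = Fract p 1" using Fract_is_poly[of A] key by blast
  moreover obtain h where "B * B * Fract F 1 = Fract h 1"
    using Fract_is_poly[of "B * B * Fract F 1"] key by blast
  ultimately show ?thesis by (rule that)
qed

text \<open>The embeddings with \<open>base_y\<close> and \<open>- base_y\<close> test both branches
  at infinity. They force the polynomials \<open>A\<close> and \<open>B^2 F\<close> to have degree
  zero. If \<open>B\<close> were nonzero, \<open>F\<close> would be a constant over a square, hence
  a square. This works before \<open>F\<close> is known to be squarefree.\<close>

lemma regular_imp_const:
  assumes f: "f \<in> carrier L" and reg: "\<And>P. P \<in> Pts \<Longrightarrow> vge_at P 0 (\<phi> f)"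
  obtains c where "c \<in> K" "f = const c"
proof -
  obtain A B where AB: "f = (A, B)" by fastforce
  obtain p h where p: "A = Fract p 1" and h: "B * B * Fract F 1 = Fract h 1"
    using regular_affine[of A B] f reg unfolding AB by blast
  have *: "0 \<le> fls_subdegree (embed base_x \<eta> f)" if emb: "embedding base_x \<eta>" for \<eta>
  proof (rule ccontr)
    assume neg: "\<not> ?thesis"
    then obtain P d where P: "P \<in> Pts" "0 < d"
      "\<And>f. f \<in> carrier L \<Longrightarrow> f \<noteq> \<zero>\<^bsub>L\<^esub> \<Longrightarrow> fls_subdegree (embed base_x \<eta> f) = d * P f"
      using point_of_embedding[OF emb f] by (metis not_le)
    have "f \<noteq> \<zero>\<^bsub>L\<^esub>" using neg by (auto simp: embed_0[OF emb])
    then have "0 \<le> fls_subdegree (embed base_x \<eta> f)"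
      using P(2) vge_at_\<phi>[OF P(1) f] reg[OF P(1)] by (simp add: P(3)[OF f])
    then show False using neg by simp
  qed
  note tr = transcendental_base_x
  have e: "0 \<le> fls_subdegree (embed base_x base_y f)" "0 \<le> fls_subdegree (embed base_x (- base_y) f)"
    by (intro * base_embedding conj_embedding)+
  have "fls_const 2 * eval_fls base_x p = embed base_x base_y f + embed base_x (- base_y) f"
    by (simp add: embed_def AB p eval_fract_poly[OF tr])
  then have s: "0 \<le> fls_subdegree (fls_const 2 * eval_fls base_x p)" using e by (simp only: subdegree_add_nonneg)
  then have p0: "0 \<le> fls_subdegree (eval_fls base_x p)"
    by (cases "eval_fls base_x p = 0") (simp_all del: fls_const_numeral)
  then have "degree p = 0"
    using subdegree_base_x_eval[of p] by (cases "p = 0") auto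
  then obtain c where c: "p = [:c:]" by (metis degree_eq_zeroE)
  define b where "b = eval_fract base_x B * base_y"
  have "b = embed base_x base_y f + - eval_fls base_x p"
    by (simp add: embed_def b_def AB p eval_fract_poly[OF tr])
  then have "0 \<le> fls_subdegree b" using e p0 by (simp add: subdegree_add_nonneg del: add_uminus_conv_diff)
  moreover have "eval_fls base_x h = b * b"
  proof -
    have "eval_fract base_x B * eval_fract base_x B * eval_fls base_x F = eval_fls base_x h"
      using arg_cong[OF h, of "eval_fract base_x"]
      unfolding eval_fract_mult[OF tr] eval_fract_poly[OF tr] .
    then show ?thesis
      unfolding base_y_square[symmetric] by (simp only: b_def power2_eq_square mult_ac)
  qed
  ultimately have "0 \<le> fls_subdegree (eval_fls base_x h)"
    by (cases "b = 0") simp_all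
  then have "degree h = 0"
    using subdegree_base_x_eval[of h] by (cases "h = 0") auto
  then obtain d where d: "h = [:d:]" by (metis degree_eq_zeroE)
  have "B = 0"
  proof (rule ccontr)
    assume "B \<noteq> 0"
    have "Fract [:csqrt d:] 1 * Fract [:csqrt d:] 1 = Fract [:d:] 1"
      using power2_csqrt[of d] by (simp add: power2_eq_square)
    then have "(Fract [:csqrt d:] 1 / B) * (Fract [:csqrt d:] 1 / B) = Fract F 1"
      using h d \<open>B \<noteq> 0\<close> by (simp add: field_simps)
    then show False using F_nonsquare by blast
  qed
  then have fc: "f = const c" using AB p c by (simp add: const_def)
  \<comment> \<open>So far \<open>c\<close> is just a complex number; being a quotient of
    polynomials over \<open>K\<close> places it in \<open>K\<close>.\<close>
  have "Fract [:c:] 1 \<in> rational_functions K" using f AB p c by (simp add: carrier_L)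
  then obtain r s where rs: "Fract [:c:] 1 = Fract r s" "s \<noteq> 0" "poly_over K r" "poly_over K s"
    by (rule rational_functionsE)
  then have "r = s * [:c:]" by (simp add: eq_fract)
  then have "poly_over K [:c:]"
    using poly_over_factor[OF rs(4,2), of "[:c:]"] rs(3) by metis
  then show ?thesis using that[of c] fc by (simp add: poly_over_pCons)
qed

end

section \<open>Dimensions of Riemann-Roch spaces\<close>

lemma degree_of_superset:
  assumes "finite S" "{P. D P \<noteq> 0} \<subseteq> S"
  shows "degree_of D = (\<Sum>P \<in> S. D P)"
  unfolding degree_of_def by (rule sum.mono_neutral_left) (use assms in auto)

context double_cover
begin

abbreviation RR :: "((double_cover_function \<Rightarrow> int) \<Rightarrow> int) \<Rightarrow> double_cover_function set" where
  "RR \<equiv> riemann_roch_space L (const ` K)"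

abbreviation Div :: "((double_cover_function \<Rightarrow> int) \<Rightarrow> int) set" where
  "Div \<equiv> divisors L (const ` K)"

text \<open>Over the complex numbers every point has a parameter of the form \<open>x - c\<close> or
  \<open>1 / x\<close>, to which \<open>residue_exists\<close> applies.\<close>

lemma residue_at_point:
  assumes K: "K = UNIV" and P: "P \<in> Pts" and f: "vge_at P 0 f"
  obtains c where "vge_at P 1 (f - fls_const c)"
proof -
  note v = valued_point[OF P]
  note finish = that
  have "f \<in> E" using valued.vge_E[OF v f] .
  then obtain a b where ab: "a \<in> Rat base_x" "b \<in> Rat base_x" "f = a + b * base_y"
    by (rule E_decompose)
  have *: thesis if u: "u \<in> E" "u \<noteq> 0" "base_x \<in> Rat u" "0 < val P u" for u
  proof -
    have "a \<in> Rat u" "b \<in> Rat u" using ab u by (auto intro: Rat_trans)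
    moreover have "base_y\<^sup>2 \<in> Rat u"
      unfolding base_y_square by (intro eval_in_Rat F_over u)
    ultimately obtain c where "vge_at P 1 (a + b * base_y - fls_const c)"
      using residue_exists[OF K _ _ _ u(2) v u(1,4) base_y_in_E, of a b] f unfolding ab by blast
    then show thesis using finish ab(3) by blast
  qed
  show thesis
  proof (cases "0 \<le> val P base_x")
    case True
    obtain c where "0 < val P (base_x - fls_const c)" by (rule finite_center[OF K P True])
    moreover have "base_x - fls_const c \<in> E"
      using base_x_in_E K by (intro valued.E_closed[OF v]) auto
    moreover have "base_x \<in> Rat (base_x - fls_const c)"
      using Rat_add[OF Rat_self Rat_const[of c], of "base_x - fls_const c"] K by simp
    ultimately show thesis using * x_shift_nonzero by blast
  next
    case False
    then show thesis
      using *[of "inverse base_x"] Rat_inverse[OF Rat_self, of "inverse base_x"] base_x_in_E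
      by (simp add: E_field valued.v_inverse[OF v])
  qed
qed

lemma RR_mono: "D \<in> Div \<Longrightarrow> D' \<in> Div \<Longrightarrow> D \<le> D' \<Longrightarrow> RR D \<subseteq> RR D'"
  unfolding subset_iff riemann_roch_iff le_fun_def
  by (metis neg_le_iff_le valued.vge_mono valued_point)

text \<open>Take \<open>g\<close> in the larger space only; it has exactly the lowest order allowed
  at \<open>P\<close>. For any other \<open>f\<close>, the quotient \<open>f / g\<close> has a
  residue \<open>c\<close> there, and \<open>f - c g\<close> lies in the smaller space.\<close>

lemma RR_step:
  assumes K: "K = UNIV" and D: "D \<in> Div" "D' \<in> Div" and P: "P \<in> Pts" "D' = D(P := D P + 1)"
    and dim: "L.dimension n (const ` K) (RR D)"
  shows "\<exists>m \<le> n + 1. L.dimension m (const ` K) (RR D')"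
proof (cases "RR D' = RR D")
  case True
  then show ?thesis using dim by (intro exI[of _ n]) simp
next
  case False
  have sub: "RR D \<subseteq> RR D'"
    using D P by (intro RR_mono) (auto simp: le_fun_def)
  then obtain g where g: "g \<in> RR D'" "g \<notin> RR D" using False by blast
  interpret valued K E "val P" by (rule valued_point[OF P(1)])
  define k where "k = - D P"
  have D'_eq: "- D' P = k - 1" "\<And>Q. Q \<noteq> P \<Longrightarrow> D' Q = D Q"
    using P(2) by (simp_all add: k_def)
  have RR': "f \<in> carrier L \<and> vge (k - 1) (\<phi> f) \<and> (\<forall>Q \<in> Pts. Q \<noteq> P \<longrightarrow> vge_at Q (- D Q) (\<phi> f))"
    if "f \<in> RR D'" for f
    using that P(1) D'_eq unfolding riemann_roch_iff[OF D(2)] by metis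
  have gD: "g \<in> carrier L" "vge (k - 1) (\<phi> g)"
    and gQ: "\<And>Q. Q \<in> Pts \<Longrightarrow> Q \<noteq> P \<Longrightarrow> vge_at Q (- D Q) (\<phi> g)"
    using RR'[OF g(1)] by blast+
  have gk: "\<not> vge k (\<phi> g)"
    using g(2) gD gQ unfolding riemann_roch_iff[OF D(1)] k_def by metis
  have vg: "\<phi> g \<in> E" "\<phi> g \<noteq> 0" "val P (\<phi> g) = k - 1"
    using gD(2) gk by (auto simp: vge_def)
  have "L.line_extension (const ` K) g (RR D) = RR D'"
  proof (intro equalityI subsetI)
    fix f assume "f \<in> L.line_extension (const ` K) g (RR D)"
    then obtain c h where ch: "c \<in> K" "h \<in> RR D" "f = const c \<otimes>\<^bsub>L\<^esub> g \<oplus>\<^bsub>L\<^esub> h"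
      using L.line_extension_mem_iff[of f "const ` K" g "RR D"] by blast
    interpret S: subalgebra "const ` K" "RR D'" L by (rule riemann_roch_subalgebra[OF D(2)])
    have "const c \<otimes>\<^bsub>L\<^esub> g \<in> RR D'" using ch g by (intro S.smult_closed) auto
    then have "const c \<otimes>\<^bsub>L\<^esub> g \<oplus>\<^bsub>L\<^esub> h \<in> RR D'" using S.m_closed[of _ h] ch(2) sub by (simp add: subsetD)
    then show "f \<in> RR D'" unfolding ch(3) .
  next
    fix f assume f: "f \<in> RR D'"
    then have fc: "f \<in> carrier L" "vge (k - 1) (\<phi> f)"
      and fQ: "\<And>Q. Q \<in> Pts \<Longrightarrow> Q \<noteq> P \<Longrightarrow> vge_at Q (- D Q) (\<phi> f)"
      using RR'[OF f] by blast+
    have "vge (k - 1 - val P (\<phi> g)) (\<phi> f / \<phi> g)" by (rule vge_divide[OF fc(2) vg(1,2)])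
    then obtain c where c: "vge 1 (\<phi> f / \<phi> g - fls_const c)"
      using residue_at_point[OF K P(1)] vg by auto
    then have "vge (1 + (k - 1)) ((\<phi> f / \<phi> g - fls_const c) * \<phi> g)"
      using gD(2) by (rule vge_mult)
    then have "vge k (\<phi> f - fls_const c * \<phi> g)"
      using vg by (simp add: left_diff_distrib)
    define h where "h = f \<ominus>\<^bsub>L\<^esub> const c \<otimes>\<^bsub>L\<^esub> g"
    have cK: "c \<in> K" using K by simp
    then have cL: "const c \<otimes>\<^bsub>L\<^esub> g \<in> carrier L" using gD(1) by (simp add: const_in_L)
    have f_eq: "f = const c \<otimes>\<^bsub>L\<^esub> g \<oplus>\<^bsub>L\<^esub> h"
      using fc(1) cL unfolding h_def by (simp add: a_minus_def L.a_lcomm L.r_neg del: L.r_neg1)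
    have hL: "h \<in> carrier L" using fc(1) cL by (simp add: h_def)
    have \<phi>h: "\<phi> h = \<phi> f - fls_const c * \<phi> g"
      using f_eq by (simp add: \<phi>_add \<phi>_mult \<phi>_const)
    have "vge_at Q (- D Q) (\<phi> h)" if "Q \<in> Pts" for Q
    proof (cases "Q = P")
      case True
      then show ?thesis using \<open>vge k (\<phi> f - fls_const c * \<phi> g)\<close> by (simp add: \<phi>h k_def)
    next
      case False
      interpret Q: valued K E "val Q" by (rule valued_point[OF that])
      have "Q.vge (0 + - D Q) (fls_const c * \<phi> g)"
        by (intro Q.vge_mult Q.vge_const cK gQ[OF that False] order_refl)
      then show ?thesis using fQ[OF that False] by (simp add: \<phi>h Q.vge_diff)
    qed
    then have "h \<in> RR D" using hL by (simp add: riemann_roch_iff[OF D(1)])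
    then show "f \<in> L.line_extension (const ` K) g (RR D)"
      using f_eq cK unfolding L.line_extension_mem_iff by blast
  qed
  then have "L.dimension (Suc n) (const ` K) (RR D')"
    using L.Suc_dim[OF gD(1) g(2) dim] by simp
  then show ?thesis by auto
qed

text \<open>Climbs from \<open>D\<close> to \<open>D'\<close> one point at a time; finite
  dimensionality is passed on together with the bound. In the base case \<open>D \<le> D'\<close>
  and equal degrees give equality.\<close>

lemma RR_dimension_mono:
  assumes K: "K = UNIV" and D: "D \<in> Div" "D' \<in> Div" "D \<le> D'"
    and dim: "L.dimension n (const ` K) (RR D)"
  shows "\<exists>m. L.dimension m (const ` K) (RR D') \<and> int m \<le> int n + degree_of D' - degree_of D"
  using D dim
proof (induction "nat (degree_of D' - degree_of D)" arbitrary: D n)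
  case (0 D n)
  define S where "S = {P. D P \<noteq> 0} \<union> {P. D' P \<noteq> 0}"
  have S: "finite S" using 0(2,3) unfolding S_def divisors_def by simp
  have deg: "degree_of D = (\<Sum>P \<in> S. D P)" "degree_of D' = (\<Sum>P \<in> S. D' P)"
    by (rule degree_of_superset[OF S]; simp add: S_def subset_iff)+
  have DD: "D P \<le> D' P" for P using 0(4) by (rule le_funD)
  have le: "(\<Sum>P \<in> S. D P) \<le> (\<Sum>P \<in> S. D' P)" by (intro sum_mono DD)
  then have "(\<Sum>P \<in> S. D' P - D P) = 0" using 0(1) deg by (simp add: sum_subtractf)
  then have "\<forall>P \<in> S. D' P - D P = 0"
    using S DD by (subst (asm) sum_nonneg_eq_0_iff) simp_all
  then have "D' P - D P = 0" if "P \<in> S" for P using that by (rule bspec)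
  moreover have "D' P - D P = 0" if "P \<notin> S" for P using that by (simp add: S_def)
  ultimately have "D' P - D P = 0" for P by blast
  then have "D P = D' P" for P by simp
  then have "D = D'" by (rule ext)
  then show ?case using 0(5) by (intro exI[of _ n]) simp
next
  case (Suc k D n)
  then have "D \<noteq> D'" by auto
  then obtain P where P: "D P < D' P" using Suc.prems(3) by (metis ext le_funD order_le_less)
  then have "D P \<noteq> 0 \<or> D' P \<noteq> 0" by auto
  then have PP: "P \<in> Pts" using Suc.prems(1,2) unfolding divisors_def by blast
  define D1 where "D1 = D(P := D P + 1)"
  have "{Q. D1 Q \<noteq> 0} \<subseteq> insert P {Q. D Q \<noteq> 0}" by (auto simp: D1_def)
  moreover have "finite {Q. D Q \<noteq> 0}" "{Q. D Q \<noteq> 0} \<subseteq> Pts"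
    using Suc.prems(1) unfolding divisors_def by simp_all
  ultimately have D1: "D1 \<in> Div"
    unfolding divisors_def mem_Collect_eq using PP
    by (meson finite.insertI finite_subset insert_subset order_trans)
  have D1': "D1 \<le> D'"
    using P le_funD[OF Suc.prems(3)] by (intro le_funI) (simp add: D1_def)
  define S where "S = insert P {Q. D Q \<noteq> 0}"
  have S: "finite S" "P \<in> S" using \<open>finite {Q. D Q \<noteq> 0}\<close> by (simp_all add: S_def)
  have deg: "degree_of D = (\<Sum>Q \<in> S. D Q)" "degree_of D1 = (\<Sum>Q \<in> S. D1 Q)"
    by (rule degree_of_superset[OF S(1)]; simp add: S_def D1_def subset_iff)+
  have "(\<Sum>Q \<in> S. D1 Q) = (\<Sum>Q \<in> S. D Q + (if Q = P then 1 else 0))"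
    by (rule sum.cong) (simp_all add: D1_def)
  then have deg1: "degree_of D1 = degree_of D + 1"
    using S by (simp add: deg sum.distrib)
  obtain m where m: "m \<le> n + 1" "L.dimension m (const ` K) (RR D1)"
    using RR_step[OF K Suc.prems(1) D1 PP D1_def Suc.prems(4)] by blast
  have "k = nat (degree_of D' - degree_of D1)" using Suc.hyps(2) deg1 by linarith
  then obtain m' where "L.dimension m' (const ` K) (RR D')" "int m' \<le> int m + degree_of D' - degree_of D1"
    using Suc.hyps(1)[OF _ D1 Suc.prems(2) D1' m(2)] by blast
  then show ?case using m(1) deg1 by (intro exI[of _ m']) simp
qed

text \<open>The bottom of the climb: below the zero divisor only constants remain.\<close>

lemma RR_nonpos_dimension:
  assumes D: "D \<in> Div" "D \<le> (\<lambda>_. 0)"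
  shows "\<exists>n. L.dimension n (const ` K) (RR D)"
proof -
  have sub: "RR D \<subseteq> const ` K"
  proof
    fix f assume "f \<in> RR D"
    then have "f \<in> carrier L" "\<And>P. P \<in> Pts \<Longrightarrow> vge_at P 0 (\<phi> f)"
      using D(2) valued.vge_mono[OF valued_point] by (auto simp: riemann_roch_iff[OF D(1)] le_fun_def)
    then obtain c where "c \<in> K" "f = const c" by (rule regular_imp_const)
    then show "f \<in> const ` K" by blast
  qed
  have "L.finite_dimension (const ` K) (const ` K)"
    using L.dimension_one[OF subfield_const] by (rule L.finite_dimensionI)
  then have "L.finite_dimension (const ` K) (RR D)"
    using L.subalbegra_incl_imp_finite_dimension[OF subfield_const _ riemann_roch_subalgebra[OF D(1)] sub] by blast
  then show ?thesis by (simp add: L.finite_dimension_def)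
qed

text \<open>Each \<open>w n\<close> leaves the subspace \<open>W n\<close> containing its
  predecessors. The list is reversed because independence is extended at the head.\<close>

lemma independent_of_filtration:
  assumes "\<And>n. subalgebra (const ` K) (W n) L"
    and "\<And>i n. i < n \<Longrightarrow> n \<le> N \<Longrightarrow> w i \<in> W n" "\<And>n. n < N \<Longrightarrow> w n \<notin> W n"
  shows "L.independent (const ` K) (map w (rev [0..<N]))"
  using assms(2,3)
proof (induction N)
  case (Suc N)
  have "L.Span (const ` K) (map w (rev [0..<N])) \<subseteq> W N"
    using Suc.prems by (intro L.subalgebra_Span_incl[OF subfield_const assms(1)]) auto
  moreover have "w N \<in> carrier L"
    using Suc.prems(1)[of N "Suc N"] subgroup.mem_carrier[OF subalgebra.axioms(1)[OF assms(1)]] by auto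
  ultimately show ?case
    using Suc by (auto intro!: L.li_Cons simp del: L.Span.simps)
qed simp

end

section \<open>A double root lowers the genus\<close>

lemma Fract_add_same: "q \<noteq> 0 \<Longrightarrow> Fract p q + Fract r q = Fract (p + r) (q :: 'a :: idom)"
  by (simp add: eq_fract distrib_right)

context double_cover
begin

context
  fixes a :: complex and F2 :: "complex poly"
  assumes K: "K = UNIV" and F2: "F = [:- a, 1:]\<^sup>2 * F2"
begin

lemma cK: "c \<in> K"
  using K by simp

lemma poly_over_UNIV: "poly_over K p"
  by (simp add: poly_over_def K)

definition reduced_y :: "complex fls" where
  "reduced_y = base_y / (base_x - fls_const a)"

lemma x_shift_E: "base_x - fls_const c \<in> E"
  using E_field(2)[OF base_x_in_E E_field(1)[OF cK[of "- c"]]] by simp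

lemma reduced_y_E: "reduced_y \<in> E"
  unfolding reduced_y_def divide_inverse by (intro E_field base_y_in_E x_shift_E)

lemma reduced_y_square: "reduced_y\<^sup>2 = eval_fls base_x F2"
proof -
  have e: "eval_fls base_x ([:- a, 1:]\<^sup>2) = (base_x - fls_const a)\<^sup>2"
    by (simp add: eval_fls_power)
  have "base_y\<^sup>2 = (base_x - fls_const a)\<^sup>2 * eval_fls base_x F2"
    using base_y_square arg_cong[OF F2, of "eval_fls base_x"] unfolding eval_fls_mult e by (rule trans)
  then show ?thesis using x_shift_nonzero[of a] by (simp add: reduced_y_def power_divide)
qed

lemma degree_F2: "degree F2 = 4"
proof -
  have "F2 \<noteq> 0" using F2 F_degree by auto
  then have "degree F = 2 + degree F2"
    unfolding F2 by (subst degree_mult_eq) (simp_all add: degree_power_eq)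
  then show ?thesis using F_degree by simp
qed

text \<open>The square of \<open>reduced_y\<close> is a polynomial of degree four in
  \<open>x\<close>, so its order is bounded below by half of the bound for that polynomial.\<close>

lemma reduced_y_vge:
  assumes P: "P \<in> Pts"
  shows "0 \<le> val P base_x \<Longrightarrow> vge_at P 0 reduced_y"
    and "val P base_x < 0 \<Longrightarrow> vge_at P (2 * val P base_x) reduced_y"
proof -
  interpret valued K E "val P" by (rule valued_point[OF P])
  have *: "vge n reduced_y" if "vge (2 * n) (eval_fls base_x F2)" for n
    using that v_power[OF reduced_y_E, of 2] reduced_y_E unfolding reduced_y_square[symmetric]
    by (cases "reduced_y = 0") (simp_all add: vge_def)
  show "vge 0 reduced_y" if "0 \<le> val P base_x"
    using *[of 0] finite_y(2)[OF P that poly_over_UNIV] by simp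
  show "vge (2 * val P base_x) reduced_y" if "val P base_x < 0"
    using *[of "2 * val P base_x"] vge_eval_neg[OF poly_over_UNIV, of F2 4 base_x] that base_x_in_E
    by (simp add: degree_F2)
qed

lemma val_shift_infinite:
  assumes P: "P \<in> Pts" "val P base_x < 0"
  shows "val P (base_x - fls_const c) = val P base_x"
proof -
  interpret valued K E "val P" by (rule valued_point[OF P(1)])
  have "vge (val P base_x + 1) (fls_const (- c))"
    using P(2) by (intro vge_const cK) simp
  then show ?thesis using v_add_eq(2)[OF base_x_in_E base_x_nonzero, of "fls_const (- c)"] by simp
qed

lemma val_shift_finite:
  assumes P: "P \<in> Pts" "0 \<le> val P base_x"
  shows "0 \<le> val P (base_x - fls_const c)"
  using finite_y(2)[OF P poly_over_UNIV, of "[:- c, 1:]"] x_shift_nonzero[of c]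
  by (simp add: valued.vge_def[OF valued_point[OF P(1)]])

lemma val_prod_shift:
  assumes P: "P \<in> Pts" and S: "finite S"
  shows "val P (eval_fls base_x (\<Prod>c \<in> S. [:- c, 1:] ^ N)) = int N * (\<Sum>c \<in> S. val P (base_x - fls_const c))"
  using S
proof (induction S rule: finite_induct)
  case empty
  then show ?case using valued.v_1[OF valued_point[OF P]] by simp
next
  case (insert c S)
  interpret valued K E "val P" by (rule valued_point[OF P])
  define H where "H = (\<Prod>c \<in> S. [:- c, 1:] ^ N)"
  have "H \<noteq> 0" by (simp add: H_def insert(1))
  then have H: "eval_fls base_x H \<noteq> 0" "eval_fls base_x H \<in> E"
    using eval_in_E[OF poly_over_UNIV base_x_in_E] by (simp_all add: eval_fls_eq_0_iff[OF transcendental_base_x])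
  have "eval_fls base_x (\<Prod>c \<in> insert c S. [:- c, 1:] ^ N) = (base_x - fls_const c) ^ N * eval_fls base_x H"
    using insert(1,2) by (simp add: H_def eval_fls_mult eval_fls_power)
  moreover have "val P ((base_x - fls_const c) ^ N * eval_fls base_x H)
      = int N * val P (base_x - fls_const c) + val P (eval_fls base_x H)"
    using H x_shift_nonzero[of c] E_power[OF x_shift_E]
    by (simp add: v_mult v_power[OF x_shift_E] del: right_minus_eq)
  ultimately show ?case
    using insert by (simp add: H_def[symmetric] distrib_left)
qed

text \<open>Stands for \<open>(p + q * reduced_y) / H\<close>: the factor \<open>x - a\<close> in
  the second denominator turns \<open>y\<close> into \<open>reduced_y\<close>.\<close>

definition scaled_pair :: "complex poly \<Rightarrow> complex poly \<Rightarrow> complex poly \<Rightarrow> double_cover_function" where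
  "scaled_pair H p q = (Fract p H, Fract q (H * [:- a, 1:]))"

lemma scaled_pair_carrier: "H \<noteq> 0 \<Longrightarrow> scaled_pair H p q \<in> carrier L"
  by (simp add: scaled_pair_def carrier_L rational_functionsI poly_over_UNIV del: mult_pCons_right)

lemma scaled_pair_add: "H \<noteq> 0 \<Longrightarrow> scaled_pair H p q \<oplus>\<^bsub>L\<^esub> scaled_pair H r s = scaled_pair H (p + r) (q + s)"
  by (simp add: scaled_pair_def add_L Fract_add_same del: mult_pCons_right add_fract)

lemma scaled_pair_smult: "const c \<otimes>\<^bsub>L\<^esub> scaled_pair H p q = scaled_pair H (smult c p) (smult c q)"
  by (simp add: scaled_pair_def const_def mult_L del: mult_pCons_right)

lemma scaled_pair_inj:
  "H \<noteq> 0 \<Longrightarrow> scaled_pair H p q = scaled_pair H r s \<longleftrightarrow> p = r \<and> q = s"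
  by (simp add: scaled_pair_def eq_fract del: mult_pCons_right)

lemma \<phi>_scaled_pair:
  "H \<noteq> 0 \<Longrightarrow> \<phi> (scaled_pair H p q) = (eval_fls base_x p + eval_fls base_x q * reduced_y) / eval_fls base_x H"
  by (simp add: scaled_pair_def \<phi>_pair eval_fract_Fract[OF transcendental_base_x] eval_fls_mult
      reduced_y_def add_divide_distrib del: mult_pCons_right)

text \<open>
  The function \<open>y\<^sub>1 = y / (x - a)\<close> has pole order at most two at infinity, so
  \<open>x\<^sup>i\<close> for \<open>i \<le> M\<close> and \<open>x\<^sup>j y\<^sub>1\<close> for \<open>j \<le> M - 2\<close> are \<open>2 M\<close> functions with poles of order at
  most \<open>M\<close> there.
\<close>

lemma scaled_pair_independent:
  fixes M :: nat
  assumes H: "H \<noteq> 0"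
  defines "w \<equiv> \<lambda>i. if i \<le> M then scaled_pair H (monom 1 i) 0 else scaled_pair H 0 (monom 1 (i - Suc M))"
  shows "L.independent (const ` K) (map w (rev [0..<2 * M]))"
proof (rule independent_of_filtration)
  \<comment> \<open>Monomials are numbered with those of \<open>p\<close> at positions 0 to
    \<open>M\<close> and \<open>x^j\<close> of \<open>q\<close> at position
    \<open>j + Suc M\<close>; \<open>W n\<close> allows the positions below \<open>n\<close>, at any
    degree.\<close>
  define W where "W n = {scaled_pair H p q | p q.
    (\<forall>i \<ge> n. coeff p i = 0) \<and> (\<forall>j. n \<le> j + Suc M \<longrightarrow> coeff q j = 0)}" for n
  have WI: "scaled_pair H p q \<in> W n"
    if "\<And>i. i \<ge> n \<Longrightarrow> coeff p i = 0" "\<And>j. n \<le> j + Suc M \<Longrightarrow> coeff q j = 0" for p q n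
    using that unfolding W_def by blast
  have WE: "\<exists>p q. f = scaled_pair H p q \<and> (\<forall>i \<ge> n. coeff p i = 0) \<and> (\<forall>j. n \<le> j + Suc M \<longrightarrow> coeff q j = 0)"
    if "f \<in> W n" for f n
    using that unfolding W_def by blast
  show "subalgebra (const ` K) (W n) L" for n
  proof (rule subalgebraI)
    show "W n \<subseteq> carrier L" using scaled_pair_carrier[OF H] unfolding W_def by blast
    have "scaled_pair H 0 0 = \<zero>\<^bsub>L\<^esub>"
      using H by (simp add: scaled_pair_def zero_L Zero_fract_def eq_fract del: mult_pCons_right)
    then show "\<zero>\<^bsub>L\<^esub> \<in> W n" using WI[of n 0 0] by simp
    show "f \<oplus>\<^bsub>L\<^esub> g \<in> W n" if fg: "f \<in> W n" "g \<in> W n" for f g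
    proof -
      obtain p q where p: "f = scaled_pair H p q" "\<forall>i \<ge> n. coeff p i = 0" "\<forall>j. n \<le> j + Suc M \<longrightarrow> coeff q j = 0"
        using WE[OF fg(1)] by blast
      obtain r s where r: "g = scaled_pair H r s" "\<forall>i \<ge> n. coeff r i = 0" "\<forall>j. n \<le> j + Suc M \<longrightarrow> coeff s j = 0"
        using WE[OF fg(2)] by blast
      show ?thesis unfolding p(1) r(1) scaled_pair_add[OF H] by (rule WI) (use p r in simp_all)
    qed
    show "const c \<otimes>\<^bsub>L\<^esub> f \<in> W n" if f: "f \<in> W n" for c f
    proof -
      obtain p q where p: "f = scaled_pair H p q" "\<forall>i \<ge> n. coeff p i = 0" "\<forall>j. n \<le> j + Suc M \<longrightarrow> coeff q j = 0"
        using WE[OF f] by blast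
      show ?thesis unfolding p(1) scaled_pair_smult by (rule WI) (use p in simp_all)
    qed
  qed
  show "w i \<in> W n" if "i < n" for i n
    unfolding w_def using that by (auto intro!: WI simp: coeff_monom)
  show "w n \<notin> W n" for n
  proof
    assume "w n \<in> W n"
    then obtain p q where p: "w n = scaled_pair H p q" "\<forall>i \<ge> n. coeff p i = 0" "\<forall>j. n \<le> j + Suc M \<longrightarrow> coeff q j = 0"
      using WE by blast
    show False
    proof (cases "n \<le> M")
      case True
      then have "p = monom 1 n" using p(1) scaled_pair_inj[OF H] by (simp add: w_def)
      then show False using p(2) by (auto simp: coeff_monom)
    next
      case False
      then have "q = monom 1 (n - Suc M)" using p(1) scaled_pair_inj[OF H] by (simp add: w_def)
      then show False using p(3)[rule_format, of "n - Suc M"] False by (simp add: coeff_monom)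
    qed
  qed
qed

text \<open>Enlarge \<open>D\<close> to \<open>D'\<close>, which is \<open>N\<close> times the sum
  of the fibres of \<open>x\<close> over \<open>S\<close> and over infinity. Fibres have degree at
  most two, so \<open>deg D' \<le> 2 M\<close>, and \<open>2 M\<close> independent functions lie in
  the space of \<open>D'\<close>. Descending from \<open>D'\<close> to \<open>D\<close> loses at
  most one dimension for each unit of degree.\<close>

lemma dimension_ge_degree:
  assumes D: "D \<in> Div"
  shows "\<exists>m. L.dimension m (const ` K) (RR D) \<and> degree_of D \<le> int m"
proof -
  define supp where "supp = {P. D P \<noteq> 0}"
  have supp: "finite supp" "supp \<subseteq> Pts" using D unfolding supp_def divisors_def by simp_all
  define cen where "cen P = (SOME c. 0 < val P (base_x - fls_const c))" for P
  have cen: "0 < val P (base_x - fls_const (cen P))" if P: "P \<in> Pts" "0 \<le> val P base_x" for P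
  proof -
    obtain c where "0 < val P (base_x - fls_const c)" by (rule finite_center[OF K P])
    then show ?thesis unfolding cen_def by (rule someI)
  qed
  define S where "S = cen ` {P \<in> supp. 0 \<le> val P base_x}"
  have S: "finite S" using supp by (simp add: S_def)
  \<comment> \<open>\<open>N\<close> bounds every coefficient of \<open>D\<close>; the summand 2
    gives \<open>2 \<le> M\<close>, so that the subtraction in \<open>M - 2\<close> is not
    truncated.\<close>
  define N where "N = nat (\<Sum>P \<in> supp. \<bar>D P\<bar>) + 2"
  have N: "D P \<le> int N" for P
  proof (cases "P \<in> supp")
    case True
    have "\<bar>D P\<bar> \<le> (\<Sum>P \<in> supp. \<bar>D P\<bar>)" by (rule member_le_sum[OF True _ supp(1)]) simp
    then show ?thesis by (simp add: N_def)
  qed (simp add: supp_def)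
  define M where "M = N * (card S + 1)"
  have M: "2 \<le> M" by (simp add: M_def N_def)
  \<comment> \<open>The multiplicity of \<open>P\<close> in the zeros of all \<open>x - c\<close>
    with \<open>c\<close> in \<open>S\<close>, together with the poles of \<open>x\<close>.\<close>
  define ex where "ex P = (\<Sum>c \<in> S. max 0 (val P (base_x - fls_const c))) + max 0 (- val P base_x)" for P
  have ex0: "0 \<le> ex P" for P by (simp add: ex_def sum_nonneg)
  define D' where "D' P = (if P \<in> Pts then int N * ex P else 0)" for P
  define fib where "fib c = {P \<in> Pts. 0 < val P (base_x - fls_const c)}" for c
  define inf where "inf = {P \<in> Pts. val P base_x < 0}"
  define U where "U = (\<Union>c \<in> S. fib c) \<union> inf"
  have fib: "finite (fib c)" "(\<Sum>P \<in> fib c. val P (base_x - fls_const c)) \<le> 2" for c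
    unfolding fib_def by (rule finite_fiber[OF K])+
  have inf: "finite inf" "(\<Sum>P \<in> inf. - val P base_x) \<le> 2"
    unfolding inf_def by (rule infinite_fiber)+
  have U: "finite U" "U \<subseteq> Pts" using S fib inf by (auto simp: U_def fib_def inf_def)
  have "D' P = 0" if "P \<notin> U" for P
  proof (cases "P \<in> Pts")
    case True
    then have "ex P = 0" using that by (auto simp: U_def fib_def inf_def ex_def intro!: sum.neutral)
    then show ?thesis by (simp add: D'_def)
  qed (simp add: D'_def)
  then have suppD': "{P. D' P \<noteq> 0} \<subseteq> U" by blast
  then have D': "D' \<in> Div" unfolding divisors_def using U by (auto intro: finite_subset)
  have DD': "D \<le> D'"
  proof (rule le_funI)
    fix P
    show "D P \<le> D' P"
    proof (cases "P \<in> supp")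
      case True
      then have P: "P \<in> Pts" using supp by blast
      have "1 \<le> ex P"
      proof (cases "0 \<le> val P base_x")
        case fin: True
        have "cen P \<in> S" using True fin by (simp add: S_def)
        then have "max 0 (val P (base_x - fls_const (cen P))) \<le> (\<Sum>c \<in> S. max 0 (val P (base_x - fls_const c)))"
          by (rule member_le_sum[OF _ _ S]) simp
        then show ?thesis using cen[OF P fin] by (simp add: ex_def)
      next
        case False
        have "0 \<le> (\<Sum>c \<in> S. max 0 (val P (base_x - fls_const c)))" by (simp add: sum_nonneg)
        then show ?thesis using False by (simp add: ex_def)
      qed
      then have "int N * 1 \<le> int N * ex P" by (intro mult_left_mono) simp_all
      then show ?thesis using N[of P] P by (simp add: D'_def)
    next
      case False
      then show ?thesis using ex0[of P] by (simp add: supp_def D'_def)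
    qed
  qed
  have degD': "degree_of D' \<le> 2 * int M"
  proof -
    have "degree_of D' = (\<Sum>P \<in> U. D' P)" by (rule degree_of_superset[OF U(1) suppD'])
    also have "\<dots> = (\<Sum>P \<in> U. int N * ex P)" using U(2) by (intro sum.cong) (auto simp: D'_def)
    also have "\<dots> = int N * ((\<Sum>c \<in> S. \<Sum>P \<in> U. max 0 (val P (base_x - fls_const c))) + (\<Sum>P \<in> U. max 0 (- val P base_x)))"
      unfolding ex_def sum_distrib_left[symmetric] sum.distrib by (subst sum.swap) (rule refl)
    also have "\<dots> \<le> int N * ((\<Sum>c \<in> S. 2) + 2)"
    proof (intro mult_left_mono add_mono sum_mono)
      show "(\<Sum>P \<in> U. max 0 (val P (base_x - fls_const c))) \<le> 2" if "c \<in> S" for c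
      proof -
        have "(\<Sum>P \<in> U. max 0 (val P (base_x - fls_const c))) = (\<Sum>P \<in> fib c. val P (base_x - fls_const c))"
          using U that by (intro sum.mono_neutral_cong_right) (auto simp: U_def fib_def)
        then show ?thesis using fib by simp
      qed
      have "(\<Sum>P \<in> U. max 0 (- val P base_x)) = (\<Sum>P \<in> inf. - val P base_x)"
        using U by (intro sum.mono_neutral_cong_right) (auto simp: U_def inf_def)
      then show "(\<Sum>P \<in> U. max 0 (- val P base_x)) \<le> 2" using inf by simp
    qed simp
    also have "\<dots> = 2 * int M" by (simp add: M_def algebra_simps)
    finally show ?thesis .
  qed
  \<comment> \<open>Dividing by \<open>H\<close> supplies the poles over \<open>S\<close> and zeros
    at infinity. These raise the degree allowed in the numerator from \<open>N\<close> to
    \<open>M = N * (card S + 1)\<close>.\<close>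
  define H where "H = (\<Prod>c \<in> S. [:- c, 1:] ^ N)"
  have H: "H \<noteq> 0" using S by (simp add: H_def)
  have mem: "scaled_pair H p q \<in> RR D'" if pq: "degree p \<le> M" "degree q \<le> M - 2" for p q
    unfolding riemann_roch_iff[OF D']
  proof (intro conjI ballI scaled_pair_carrier H)
    fix P assume P: "P \<in> Pts"
    interpret valued K E "val P" by (rule valued_point[OF P])
    have HE: "eval_fls base_x H \<in> E" "eval_fls base_x H \<noteq> 0"
      using eval_in_E[OF poly_over_UNIV base_x_in_E] H by (simp_all add: eval_fls_eq_0_iff[OF transcendental_base_x])
    have vH: "val P (eval_fls base_x H) = int N * (\<Sum>c \<in> S. val P (base_x - fls_const c))"
      unfolding H_def by (rule val_prod_shift[OF P S])
    have "\<exists>n. vge n (eval_fls base_x p + eval_fls base_x q * reduced_y) \<and> n - val P (eval_fls base_x H) = - D' P"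
    proof (cases "0 \<le> val P base_x")
      case True
      have "vge (0 + 0) (eval_fls base_x q * reduced_y)"
        by (intro vge_mult finite_y(2)[OF P True] poly_over_UNIV reduced_y_vge(1)[OF P True])
      then have "vge 0 (eval_fls base_x p + eval_fls base_x q * reduced_y)"
        by (intro vge_add finite_y(2)[OF P True] poly_over_UNIV) simp
      moreover have "ex P = (\<Sum>c \<in> S. val P (base_x - fls_const c))"
        using True val_shift_finite[OF P True] by (simp add: ex_def)
      ultimately show ?thesis using P vH by (intro exI[of _ 0]) (simp add: D'_def)
    next
      case False
      then have neg: "val P base_x < 0" "val P base_x \<le> 0" by simp_all
      have "vge (int (M - 2) * val P base_x + 2 * val P base_x) (eval_fls base_x q * reduced_y)"
        by (intro vge_mult vge_eval_neg poly_over_UNIV pq base_x_in_E neg base_x_nonzero reduced_y_vge(2)[OF P])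
      moreover have "int (M - 2) * val P base_x + 2 * val P base_x = int M * val P base_x"
        using M by (simp add: of_nat_diff algebra_simps)
      ultimately have "vge (int M * val P base_x) (eval_fls base_x p + eval_fls base_x q * reduced_y)"
        by (intro vge_add vge_eval_neg poly_over_UNIV pq base_x_in_E neg base_x_nonzero) simp
      moreover have "ex P = - val P base_x"
        using neg by (simp add: ex_def val_shift_infinite[OF P neg(1)])
      moreover have "val P (eval_fls base_x H) = int N * (int (card S) * val P base_x)"
        using vH by (simp add: val_shift_infinite[OF P neg(1)])
      ultimately show ?thesis
        using P by (intro exI[of _ "int M * val P base_x"]) (simp add: D'_def M_def algebra_simps)
    qed
    then show "vge (- D' P) (\<phi> (scaled_pair H p q))"
      unfolding \<phi>_scaled_pair[OF H] using vge_divide[OF _ HE] by metis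
  qed
  \<comment> \<open>Below \<open>2 M\<close> there are \<open>M + 1\<close> indices for powers of
    \<open>x\<close> and \<open>M - 1\<close> for multiples of \<open>reduced_y\<close>, the last
    being \<open>x^(M - 2) * reduced_y\<close>.\<close>
  define w where "w = (\<lambda>i. if i \<le> M then scaled_pair H (monom 1 i) 0 else scaled_pair H 0 (monom 1 (i - Suc M)))"
  have ind: "L.independent (const ` K) (map w (rev [0..<2 * M]))"
    unfolding w_def by (rule scaled_pair_independent[OF H])
  have "w i \<in> RR D'" if "i < 2 * M" for i
    unfolding w_def using that by (auto intro!: mem simp: degree_monom_eq)
  then have wR: "set (map w (rev [0..<2 * M])) \<subseteq> RR D'" by (simp add: image_subset_iff)
  \<comment> \<open>The negative part of \<open>D\<close> is the starting point from which the space
    of \<open>D\<close> is shown to be finite-dimensional.\<close>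
  define D0 where "D0 P = min (D P) 0" for P
  have "{P. D0 P \<noteq> 0} \<subseteq> supp" unfolding D0_def supp_def by force
  then have D0: "D0 \<in> Div" unfolding divisors_def using supp by (auto intro: finite_subset)
  obtain n0 where n0: "L.dimension n0 (const ` K) (RR D0)"
    using RR_nonpos_dimension[OF D0] by (auto simp: le_fun_def D0_def)
  obtain n where n: "L.dimension n (const ` K) (RR D)"
    using RR_dimension_mono[OF K D0 D _ n0] by (auto simp: le_fun_def D0_def)
  obtain m where m: "L.dimension m (const ` K) (RR D')" "int m \<le> int n + degree_of D' - degree_of D"
    using RR_dimension_mono[OF K D D' DD' n] by blast
  have "2 * M \<le> m"
    using L.independent_length_le_dimension[OF subfield_const m(1) ind wR] by simp
  then show ?thesis using n m(2) degD' by (intro exI[of _ n]) linarith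
qed

text \<open>The quantity \<open>deg D - l(D) + 1\<close> never exceeds one, so the maximum required
  for genus two is not attained.\<close>

lemma not_genus_two: "\<not> has_genus L (const ` K) 2"
proof
  assume "has_genus L (const ` K) 2"
  then obtain D where D: "D \<in> Div" "degree_of D - int (L.dim (const ` K) (RR D)) + 1 = 2"
    unfolding has_genus_def of_nat_numeral by blast
  obtain m where m: "L.dimension m (const ` K) (RR D)" "degree_of D \<le> int m"
    using dimension_ge_degree[OF D(1)] by blast
  have "L.dim (const ` K) (RR D) = m"
    using L.dimI[OF subfield_const m(1)] by (simp add: over_def)
  then show False using D(2) m(2) by simp
qed

end

end

section \<open>Expansions at infinity\<close>

context valued
begin

text \<open>After reversal the leading coefficient of \<open>p\<close> becomes the residue, so the
  bound of \<open>vge_eval_neg\<close> is exact.\<close>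

lemma v_eval_neg:
  assumes "poly_over K p" "p \<noteq> 0" "x \<in> E" "x \<noteq> 0" "v x < 0"
  shows "v (eval_fls x p) = int (degree p) * v x" "eval_fls x p \<noteq> 0"
proof -
  have "vge 1 (inverse x)" using assms by (intro vge_self) (simp_all add: E_inverse v_inverse)
  then have "vge 1 (eval_fls (inverse x) (reflect_poly p) - fls_const (coeff (reflect_poly p) 0))"
    by (intro residue_eval poly_over_reflect assms)
  moreover have "lead_coeff p \<in> K" using assms(1) by (auto simp: poly_over_def)
  ultimately have u: "eval_fls (inverse x) (reflect_poly p) \<noteq> 0"
    "v (eval_fls (inverse x) (reflect_poly p)) = 0" "eval_fls (inverse x) (reflect_poly p) \<in> E"
    using v_unit[of "lead_coeff p"] assms(2) by simp_all
  show "v (eval_fls x p) = int (degree p) * v x" "eval_fls x p \<noteq> 0"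
    unfolding eval_fls_reflect[OF assms(4), of p] using u assms by (simp_all add: v_mult v_power E_power)
qed

text \<open>
  At a pole of \<open>x\<close> where \<open>y / x\<^sup>3 = 1\<close>, the polynomial \<open>2 p\<close> is the polynomial part of the square root
  \<open>y\<close>, so \<open>f3 = p + y / 2\<close> has order \<open>-3\<close>, whereas its conjugate \<open>g3\<close> vanishes because
  \<open>f3 g3 = p\<^sup>2 - F / 4\<close> has degree at most two. The constants \<open>c4\<close> and \<open>c5\<close> cancel the values of
  \<open>x g3\<close> and \<open>x g4\<close>.
\<close>

lemma expansion_at_infinity:
  assumes x: "x \<in> E" "x \<noteq> 0" "v x = - 1" and y: "y \<in> E" "vge 1 (y / x ^ 3 - fls_const 1)"
    and sq: "y\<^sup>2 = eval_fls x F" and p: "p = [:b0, b1, b2, 1 / 2:]" "poly_over K p"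
    and c: "c4 \<in> K" "c5 \<in> K"
    and R: "p * p - smult (1 / 4) F = R" "poly_over K R" "degree R \<le> 2"
    and S: "smult (2 * c4) p + pCons 0 R = S" "poly_over K S" "degree S \<le> 2"
    and T: "smult (2 * c5) p + pCons 0 S = T" "poly_over K T" "degree T \<le> 2"
    and f3: "f3 = eval_fls x p + fls_const (1 / 2) * y" and f4: "f4 = fls_const c4 + x * f3"
    and f5: "f5 = fls_const c5 + x * f4"
    and g3: "g3 = eval_fls x p - fls_const (1 / 2) * y" and g4: "g4 = fls_const c4 + x * g3"
    and g5: "g5 = fls_const c5 + x * g4"
  shows "f3 \<noteq> 0 \<and> v f3 = - 3" "f4 \<noteq> 0 \<and> v f4 = - 4" "f5 \<noteq> 0 \<and> v f5 = - 5"
    "vge 1 g3" "vge 1 g4" "vge 1 g5"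
proof -
  have half: "1 / 2 \<in> K" by (intro K_closed)
  have two: "2 \<in> K" by (intro K_closed)
  define h where "h = fls_const (1 / 2 :: complex)"
  have hh: "h + h = 1" unfolding h_def by (simp add: fls_plus_const)
  have bK: "b0 \<in> K" "b1 \<in> K" "b2 \<in> K" using p by (simp_all add: poly_over_pCons)
  define low where "low = [:b0, b1, b2:]"
  have low: "vge (- 2) (eval_fls x low)"
    using vge_eval_neg[of low 2 x] x bK by (simp add: low_def poly_over_pCons poly_over_0)
  have P: "eval_fls x p = h * x ^ 3 + eval_fls x low"
    by (simp add: p h_def low_def algebra_simps power3_eq_cube)
  have x3: "x ^ 3 \<in> E" "x ^ 3 \<noteq> 0" "v (x ^ 3) = - 3" using x by (simp_all add: E_power v_power)
  have "vge (- 3 + 1) (x ^ 3 * (y / x ^ 3 - fls_const 1))"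
    by (rule vge_mult[OF vge_self[OF x3(1)] y(2)]) (simp add: x3)
  then have yx: "vge (- 2) (y - x ^ 3)" using x3 by (simp add: right_diff_distrib)
  have "vge (0 + - 2) (h * (y - x ^ 3))"
    unfolding h_def by (intro vge_mult vge_const half yx) simp
  then have rest: "vge (- 2) (eval_fls x low + h * (y - x ^ 3))"
    using low by (intro vge_add) simp_all
  have f3x: "f3 = x ^ 3 + (eval_fls x low + h * (y - x ^ 3))"
  proof -
    have "f3 = (h + h) * x ^ 3 + (eval_fls x low + h * (y - x ^ 3))"
      unfolding f3 P h_def[symmetric] by (simp add: algebra_simps)
    then show ?thesis by (simp add: hh)
  qed
  show F3: "f3 \<noteq> 0 \<and> v f3 = - 3"
    using v_add_eq[OF x3(1,2), of "eval_fls x low + h * (y - x ^ 3)"] rest x3 unfolding f3x by simp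
  have f3E: "f3 \<in> E" unfolding f3x by (rule E_add[OF x3(1) vge_E[OF rest]])
  have step: "f' \<noteq> 0 \<and> v f' = v f - 1 \<and> f' \<in> E"
    if "f \<in> E" "f \<noteq> 0" "v f < 0" "c \<in> K" "f' = fls_const c + x * f" for f f' c
  proof -
    have xf: "x * f \<in> E" "x * f \<noteq> 0" "v (x * f) = v f - 1"
      using that x by (simp_all add: E_mult v_mult)
    have "vge (v (x * f) + 1) (fls_const c)" using that xf by (intro vge_const) simp_all
    then show ?thesis
      using v_add_eq[OF xf(1,2)] xf that(4,5) E_add[OF E_const xf(1), of c] by (simp add: add.commute)
  qed
  have F4: "f4 \<noteq> 0 \<and> v f4 = v f3 - 1 \<and> f4 \<in> E" using step[OF f3E _ _ c(1) f4] F3 by simp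
  then show "f4 \<noteq> 0 \<and> v f4 = - 4" using F3 by simp
  have "f5 \<noteq> 0 \<and> v f5 = v f4 - 1 \<and> f5 \<in> E" using step[OF _ _ _ c(2) f5] F4 F3 by simp
  then show "f5 \<noteq> 0 \<and> v f5 = - 5" using F4 F3 by simp
  have fg: "f3 * g3 = eval_fls x R"
  proof -
    have "h * h = fls_const (1 / 4)" by (simp add: h_def)
    moreover have "(A + h * y) * (A - h * y) = A * A - h * h * y\<^sup>2" for A
      by (simp add: algebra_simps power2_eq_square)
    ultimately have "f3 * g3 = eval_fls x p * eval_fls x p - fls_const (1 / 4) * y\<^sup>2"
      unfolding f3 g3 h_def[symmetric] by metis
    then show ?thesis
      unfolding sq R(1)[symmetric] by (simp only: eval_fls_diff eval_fls_mult eval_fls_smult)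
  qed
  have deg: "vge (- 2) (eval_fls x A)" if "poly_over K A" "degree A \<le> 2" for A
    using vge_eval_neg[OF that x(1)] x by simp
  have G3: "vge 1 g3"
  proof -
    have "vge (- 2 - v f3) (eval_fls x R / f3)" using F3 f3E R by (intro vge_divide deg) auto
    then show ?thesis using F3 fg[symmetric] by simp
  qed
  then show "vge 1 g3" .
  \<comment> \<open>The sum \<open>2 p\<close> has the same order as \<open>f3\<close> but is a
    polynomial in \<open>x\<close>, so that \<open>q * g4\<close> and \<open>q * g5\<close> are
    polynomials of degree at most two up to multiples of the small term
    \<open>g3\<^sup>2\<close>.\<close>
  define q where "q = f3 + g3"
  have q: "q = fls_const 2 * eval_fls x p" by (simp add: q_def f3 g3)
  have cq: "fls_const c * q = fls_const (2 * c) * eval_fls x p" for c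
    unfolding q mult.assoc[symmetric] fls_const_mult_const by (simp only: mult.commute)
  have qv: "q \<in> E" "q \<noteq> 0" "v q = - 3"
    using v_add_eq[of f3 g3] F3 f3E G3 E_add[OF f3E vge_E[OF G3]] by (simp_all add: q_def vge_mono[OF G3])
  have g32: "vge 2 (g3\<^sup>2)" using vge_power[OF G3, of 2] by simp
  have qg3: "q * g3 = eval_fls x R + g3\<^sup>2"
    by (simp add: q_def distrib_right fg power2_eq_square)
  have qg4: "q * g4 = eval_fls x S + x * g3\<^sup>2"
  proof -
    have "q * g4 = fls_const c4 * q + x * (q * g3)" by (simp add: g4 algebra_simps)
    also have "\<dots> = fls_const (2 * c4) * eval_fls x p + x * eval_fls x R + x * g3\<^sup>2"
      unfolding qg3 cq by (simp add: distrib_left)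
    also have "\<dots> = eval_fls x S + x * g3\<^sup>2"
      unfolding S(1)[symmetric] by (simp add: eval_fls_add eval_fls_smult)
    finally show ?thesis .
  qed
  have qg5: "q * g5 = eval_fls x T + x * (x * g3\<^sup>2)"
  proof -
    have "q * g5 = fls_const c5 * q + x * (q * g4)" by (simp add: g5 algebra_simps)
    also have "\<dots> = fls_const (2 * c5) * eval_fls x p + x * eval_fls x S + x * (x * g3\<^sup>2)"
      unfolding qg4 cq by (simp add: distrib_left)
    also have "\<dots> = eval_fls x T + x * (x * g3\<^sup>2)"
      unfolding T(1)[symmetric] by (simp add: eval_fls_add eval_fls_smult)
    finally show ?thesis .
  qed
  have xv: "vge (- 1) x" using x by (intro vge_self) simp_all
  have x1: "vge (- 1 + 2) (x * g3\<^sup>2)" by (intro vge_mult xv g32)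
  have x2: "vge (- 1 + (- 1 + 2)) (x * (x * g3\<^sup>2))" by (intro vge_mult[OF xv x1])
  have quot: "vge 1 g" if "vge (- 2) (q * g)" for g
    using vge_divide[OF that qv(1,2)] qv by simp
  show "vge 1 g4"
    by (rule quot) (unfold qg4, intro vge_add deg S vge_mono[OF x1], simp)
  show "vge 1 g5"
    by (rule quot) (unfold qg5, intro vge_add deg T vge_mono[OF x2], simp)
qed

end

context double_cover
begin

section \<open>Functions \<open>p + q y\<close> with polynomials \<open>p\<close> and
  \<open>q\<close>\<close>

definition poly_pair :: "complex poly \<Rightarrow> complex poly \<Rightarrow> double_cover_function" where
  "poly_pair p q = (Fract p 1, Fract q 1)"

lemma poly_pair_carrier: "poly_over K p \<Longrightarrow> poly_over K q \<Longrightarrow> poly_pair p q \<in> carrier L"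
  by (simp add: poly_pair_def carrier_L rf_poly)

lemma \<phi>_poly_pair: "\<phi> (poly_pair p q) = eval_fls base_x p + eval_fls base_x q * base_y"
  by (simp add: poly_pair_def \<phi>_pair eval_fract_poly[OF transcendental_base_x])

lemma involution_poly_pair: "involution_fun (poly_pair p q) = poly_pair p (- q)"
  by (simp add: poly_pair_def involution_fun_def)

lemma polar_part_eqI:
  assumes P: "P \<in> Pts" and f: "f \<in> carrier L" "f \<noteq> \<zero>\<^bsub>L\<^esub>" "P f = - n" "0 \<le> n"
    and reg: "\<And>Q. Q \<in> Pts \<Longrightarrow> Q \<noteq> P \<Longrightarrow> vge_at Q 0 (\<phi> f)"
  shows "polar_part (div_of L (const ` K) f) = multiple_of_point n P"
proof (rule ext)
  fix Q
  show "polar_part (div_of L (const ` K) f) Q = multiple_of_point n P Q"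
  proof (cases "Q \<in> Pts \<and> Q \<noteq> P")
    case True
    then have "0 \<le> Q f" using reg[of Q] vge_at_\<phi>[of Q f 0] f by blast
    then show ?thesis using True by (simp add: polar_part_def div_of_def multiple_of_point_def)
  next
    case False
    then consider "Q = P" | "Q \<notin> Pts" by blast
    then show ?thesis
    proof cases
      case 2
      then have "Q \<noteq> P" using P by blast
      then show ?thesis using 2 by (simp add: polar_part_def div_of_def multiple_of_point_def)
    qed (use P f in \<open>simp add: polar_part_def div_of_def multiple_of_point_def\<close>)
  qed
qed

lemma rf_poly_imp_poly_over:
  assumes "Fract p 1 \<in> rational_functions K"
  shows "poly_over K p"
proof -
  obtain r s where rs: "Fract p 1 = Fract r s" "s \<noteq> 0" "poly_over K r" "poly_over K s"
    using assms by (rule rational_functionsE)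
  then have "r = s * p" by (simp add: eq_fract mult.commute)
  then show ?thesis using poly_over_factor[OF rs(4,2), of p] rs(3) by metis
qed

text \<open>For a root \<open>a\<close> of the reduced denominator \<open>s\<close>, the square of
  \<open>x - a\<close> divides \<open>r\<^sup>2 * F\<close> and is coprime to \<open>r\<close>, so
  it would divide \<open>F\<close>.\<close>

lemma squarefree_denominator:
  assumes sqf: "\<And>a. \<not> [:- a, 1:]\<^sup>2 dvd F" and h: "B * B * Fract F 1 = Fract h 1"
  obtains q where "B = Fract q 1"
proof -
  obtain r s where rs: "B = Fract r s" "s \<noteq> 0" "coprime r s"
    by (rule quot_of_fract_cases)
  have eq: "r\<^sup>2 * F = s\<^sup>2 * h"
    using h rs by (simp add: eq_fract power2_eq_square mult_ac)
  have "poly s a \<noteq> 0" for a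
  proof
    assume "poly s a = 0"
    then have d: "[:- a, 1:] dvd s" by (simp add: poly_eq_0_iff_dvd)
    then have "coprime ([:- a, 1:]\<^sup>2) (r\<^sup>2)"
      using coprime_divisors[OF dvd_refl d rs(3)] by (simp add: coprime_commute)
    moreover have "[:- a, 1:]\<^sup>2 dvd r\<^sup>2 * F"
      unfolding eq using dvd_power_same[OF d, of 2] by (rule dvd_mult2)
    ultimately have "[:- a, 1:]\<^sup>2 dvd F" by (simp add: coprime_dvd_mult_right_iff)
    then show False using sqf by blast
  qed
  then have "degree s = 0"
    using fundamental_theorem_of_algebra_alt[of s] by (metis degree_pCons_0)
  then obtain c where "s = [:c:]" "c \<noteq> 0" using rs(2) by (metis degree_eq_zeroE pCons_0_0)
  then have "B = Fract (smult (inverse c) r) 1" using rs by (simp add: eq_fract)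
  then show ?thesis by (rule that)
qed

end

section \<open>The three functions attached to the sextic and the point \<open>P0\<close>\<close>

locale sextic = double_cover +
  fixes a0 a1 a2 a3 a4 a5 :: complex and P0 :: "double_cover_function \<Rightarrow> int"
  assumes F_eq: "F = [:a0, a1, a2, a3, a4, a5, 1:]"
    and P0: "P0 \<in> Pts" "val P0 base_x < 0" "vge_at P0 1 (base_y / base_x ^ 3 - fls_const 1)"
begin

text \<open>The coefficients of \<open>x^5\<close>, \<open>x^4\<close>, \<open>x^3\<close> in
  \<open>p3 * p3 = F / 4\<close> determine \<open>b2\<close>, \<open>b1\<close> and
  \<open>b0\<close> in this order.\<close>

definition "b0 = (8 * a3 - 4 * a4 * a5 + a5 ^ 3) / 32"
definition "b1 = (4 * a4 - a5 ^ 2) / 16"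
definition "b2 = a5 / 4"
text \<open>Minus the coefficient of \<open>x^2\<close> in \<open>p3 * p3 - F / 4\<close>. As
  \<open>f3\<close> behaves like \<open>x^3\<close> at \<open>P0\<close>, this coefficient is the
  value there of \<open>x\<close> times the conjugate of \<open>f3\<close>.\<close>

definition "c4 = (64 * a2 - 16 * a4 ^ 2 - 32 * a3 * a5 + 24 * a4 * a5 ^ 2 - 5 * a5 ^ 4) / 256"
definition "c5 = (128 * a1 - 64 * a3 * a4 - 64 * a2 * a5 + 48 * a4 ^ 2 * a5
        + 48 * a3 * a5 ^ 2 - 40 * a4 * a5 ^ 3 + 7 * a5 ^ 5) / 512"
definition "p3 = [:b0, b1, b2, 1 / 2:]"
definition "p4 = pCons c4 p3"
definition "p5 = pCons c5 p4"
definition "fun3 = poly_pair p3 [:1 / 2:]"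
definition "fun4 = poly_pair p4 [:0, 1 / 2:]"
definition "fun5 = poly_pair p5 [:0, 0, 1 / 2:]"

text \<open>\<open>remR\<close> is the product of \<open>fun3\<close> and its conjugate. Multiplying
  by \<open>x\<close> and adding \<open>2 * c4 * p3\<close> cancels the cubic term and gives
  \<open>remS\<close>, whose coefficient of \<open>x^2\<close> defines \<open>- c5\<close>;
  \<open>remT\<close> arises in the same way from \<open>remS\<close> and \<open>c5\<close>.\<close>

definition "remR = [:b0\<^sup>2 - a0 / 4, 2 * b0 * b1 - a1 / 4, - c4:]"
definition "remS = [:2 * c4 * b0, 2 * c4 * b1 + (b0\<^sup>2 - a0 / 4), - c5:]"
definition "remT = [:2 * c5 * b0, 2 * c5 * b1 + 2 * c4 * b0, 2 * c5 * b2 + (2 * c4 * b1 + (b0\<^sup>2 - a0 / 4)):]"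

lemma coeffs_K: "a0 \<in> K" "a1 \<in> K" "a2 \<in> K" "a3 \<in> K" "a4 \<in> K" "a5 \<in> K"
  using F_over by (simp_all add: F_eq poly_over_pCons)

lemma constants_K: "b0 \<in> K" "b1 \<in> K" "b2 \<in> K" "c4 \<in> K" "c5 \<in> K" "1 / 2 \<in> K"
  unfolding b0_def b1_def b2_def c4_def c5_def by (intro K_closed coeffs_K)+

lemma polys_over:
  "poly_over K p3" "poly_over K p4" "poly_over K p5" "poly_over K remR" "poly_over K remS" "poly_over K remT"
  unfolding p3_def p4_def p5_def remR_def remS_def remT_def poly_over_pCons
  by (intro conjI poly_over_0 K_closed constants_K coeffs_K)+

lemma square_root_coeffs:
  "b1 + b2 * b2 = a4 / 4" "b0 + 2 * (b1 * b2) = a3 / 4" "2 * (b0 * b2) + b1 * b1 - a2 / 4 = - c4"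
  "2 * (b0 * b1) + 2 * (b2 * c4) - a1 / 4 = - c5"
proof -
  \<comment> \<open>In terms of quarters of the coefficients all denominators disappear, and the
    identities become ones between integer polynomials.\<close>
  define k w r p s where a: "k = a1 / 4" "w = a2 / 4" "r = a3 / 4" "p = a4 / 4" "s = a5 / 4"
  have a': "a1 = 4 * k" "a2 = 4 * w" "a3 = 4 * r" "a4 = 4 * p" "a5 = 4 * s" by (simp_all add: a)
  have b: "b0 = r - 2 * p * s + 2 * s ^ 3" "b1 = p - s ^ 2" "b2 = s"
    "c4 = w - p ^ 2 - 2 * r * s + 6 * p * s ^ 2 - 5 * s ^ 4"
    "c5 = k - 2 * r * p - 2 * w * s + 6 * p ^ 2 * s + 6 * r * s ^ 2 - 20 * p * s ^ 3 + 14 * s ^ 5"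
    unfolding b0_def b1_def b2_def c4_def c5_def unfolding a'
    by (simp_all add: power_mult_distrib diff_divide_distrib add_divide_distrib)
  show "b1 + b2 * b2 = a4 / 4" unfolding b a[symmetric] by (simp add: algebra_simps power2_eq_square power3_eq_cube eval_nat_numeral)
  show "b0 + 2 * (b1 * b2) = a3 / 4" unfolding b a[symmetric] by (simp add: algebra_simps power2_eq_square power3_eq_cube eval_nat_numeral)
  show "2 * (b0 * b2) + b1 * b1 - a2 / 4 = - c4" unfolding b a[symmetric] by (simp add: algebra_simps power2_eq_square power3_eq_cube eval_nat_numeral)
  show "2 * (b0 * b1) + 2 * (b2 * c4) - a1 / 4 = - c5" unfolding b a[symmetric] by (simp add: algebra_simps power2_eq_square power3_eq_cube eval_nat_numeral)
qed

lemma p3_square: "p3 * p3 - smult (1 / 4) F = remR"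
proof -
  have "p3 * p3 - smult (1 / 4) F = [:b0 * b0 - a0 / 4, 2 * (b0 * b1) - a1 / 4,
      2 * (b0 * b2) + b1 * b1 - a2 / 4, (b0 + 2 * (b1 * b2)) - a3 / 4, (b1 + b2 * b2) - a4 / 4, b2 - a5 / 4:]"
    by (simp add: p3_def F_eq algebra_simps)
  then show ?thesis
    unfolding square_root_coeffs(1-3) by (simp add: remR_def b2_def power2_eq_square)
qed

lemma remS_eq: "smult (2 * c4) p3 + pCons 0 remR = remS"
  using square_root_coeffs(4) by (simp add: p3_def remR_def remS_def algebra_simps)

lemma remT_eq: "smult (2 * c5) p3 + pCons 0 remS = remT"
  by (simp add: p3_def remS_def remT_def)

lemma rem_degree: "degree remR \<le> 2" "degree remS \<le> 2" "degree remT \<le> 2"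
  by (simp_all add: remR_def remS_def remT_def)

lemma fun_carrier: "fun3 \<in> carrier L" "fun4 \<in> carrier L" "fun5 \<in> carrier L"
  unfolding fun3_def fun4_def fun5_def
  by (intro poly_pair_carrier polys_over; simp add: poly_over_pCons poly_over_0 K_0 constants_K)+

lemma \<phi>_fun:
  "\<phi> fun3 = eval_fls base_x p3 + fls_const (1 / 2) * base_y"
  "\<phi> fun4 = fls_const c4 + base_x * \<phi> fun3"
  "\<phi> fun5 = fls_const c5 + base_x * \<phi> fun4"
  by (simp_all add: fun3_def fun4_def fun5_def \<phi>_poly_pair p4_def p5_def algebra_simps)

lemma \<phi>_involution_fun:
  "\<phi> (involution_fun fun3) = eval_fls base_x p3 - fls_const (1 / 2) * base_y"
  "\<phi> (involution_fun fun4) = fls_const c4 + base_x * \<phi> (involution_fun fun3)"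
  "\<phi> (involution_fun fun5) = fls_const c5 + base_x * \<phi> (involution_fun fun4)"
  by (simp_all add: fun3_def fun4_def fun5_def involution_poly_pair \<phi>_poly_pair eval_fls_uminus
      p4_def p5_def algebra_simps del: minus_pCons)

lemma base_x_P0: "val P0 base_x = - 1"
  using infinite_unique(2)[OF P0 P0] K_1 by simp

lemma orders_at_P0:
  "\<phi> fun3 \<noteq> 0 \<and> val P0 (\<phi> fun3) = - 3" "\<phi> fun4 \<noteq> 0 \<and> val P0 (\<phi> fun4) = - 4"
  "\<phi> fun5 \<noteq> 0 \<and> val P0 (\<phi> fun5) = - 5"
  "vge_at P0 1 (\<phi> (involution_fun fun3))" "vge_at P0 1 (\<phi> (involution_fun fun4))"
  "vge_at P0 1 (\<phi> (involution_fun fun5))"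
  using valued.expansion_at_infinity[OF valued_point[OF P0(1)] base_x_in_E base_x_nonzero base_x_P0
      base_y_in_E P0(3) base_y_square p3_def polys_over(1) constants_K(4,5) p3_square polys_over(4) rem_degree(1)
      remS_eq polys_over(5) rem_degree(2) remT_eq polys_over(6) rem_degree(3) \<phi>_fun \<phi>_involution_fun]
  by blast+

text \<open>Over the affine line the functions are polynomials in \<open>x\<close> and
  \<open>y\<close>. The only other kind of point has \<open>y / x^3 = -1\<close>, and there they
  even vanish.\<close>

lemma regular_away_from_P0:
  assumes Q: "Q \<in> Pts" "Q \<noteq> P0"
  shows "vge_at Q 0 (\<phi> fun3)" "vge_at Q 0 (\<phi> fun4)" "vge_at Q 0 (\<phi> fun5)"
proof -
  interpret valued K E "val Q" by (rule valued_point[OF Q(1)])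
  have "vge 0 (\<phi> fun3) \<and> vge 0 (\<phi> fun4) \<and> vge 0 (\<phi> fun5)"
  proof (cases "0 \<le> val Q base_x")
    case True
    have y: "vge 0 base_y" using finite_y(1)[OF Q(1) True] base_y_in_E by (rule vge_self[rotated])
    have *: "vge 0 (\<phi> (poly_pair p q))" if "poly_over K p" "poly_over K q" for p q
    proof -
      have "vge (0 + 0) (eval_fls base_x q * base_y)"
        by (intro vge_mult y finite_y(2)[OF Q(1) True] that)
      then show ?thesis
        unfolding \<phi>_poly_pair by (intro vge_add finite_y(2)[OF Q(1) True] that) simp
    qed
    show ?thesis
      unfolding fun3_def fun4_def fun5_def
      by (intro conjI *; simp add: polys_over poly_over_pCons poly_over_0 K_0 constants_K)
  next
    case False
    then have neg: "val Q base_x < 0" by simp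
    have "\<not> vge 1 (base_y / base_x ^ 3 - fls_const 1)"
      using infinite_unique(1)[OF Q(1) neg _ P0] Q(2) K_1 by (metis one_neq_zero)
    then have b: "vge 1 (base_y / base_x ^ 3 - fls_const (- 1))"
      using infinite_branch[OF Q(1) neg] by blast
    have x1: "val Q base_x = - 1"
      using infinite_unique(2)[OF Q(1) neg b Q(1) neg b] K_closed by simp
    \<comment> \<open>Replacing \<open>y\<close> by \<open>- y\<close> gives this branch the value 1
      and puts \<open>fun3\<close>, \<open>fun4\<close>, \<open>fun5\<close> in the place of the
      conjugates, for which the expansion shows vanishing.\<close>
    have b': "vge 1 (- base_y / base_x ^ 3 - fls_const 1)"
      using vge_uminus[OF b] by simp
    have sq: "(- base_y)\<^sup>2 = eval_fls base_x F" using base_y_square by (simp only: power2_minus)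
    have f3: "\<phi> fun3 = eval_fls base_x p3 - fls_const (1 / 2) * (- base_y)"
      by (simp add: \<phi>_fun(1))
    have "vge 1 (\<phi> fun3)" "vge 1 (\<phi> fun4)" "vge 1 (\<phi> fun5)"
      using expansion_at_infinity(4-6)[OF base_x_in_E base_x_nonzero x1 E_uminus[OF base_y_in_E] b' sq
          p3_def polys_over(1) constants_K(4,5) p3_square polys_over(4) rem_degree(1)
          remS_eq polys_over(5) rem_degree(2) remT_eq polys_over(6) rem_degree(3)
          refl refl refl f3 \<phi>_fun(2,3)]
      by blast+
    then show ?thesis using vge_mono by (meson zero_le_one)
  qed
  then show "vge 0 (\<phi> fun3)" "vge 0 (\<phi> fun4)" "vge 0 (\<phi> fun5)" by blast+
qed

lemma vanishes_at_involution:
  "vanishes_at L (involution P0) fun3" "vanishes_at L (involution P0) fun4" "vanishes_at L (involution P0) fun5"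
proof -
  have "vanishes_at L (involution P0) f" if "f \<in> carrier L" "vge_at P0 1 (\<phi> (involution_fun f))" for f
    using that vge_at_\<phi>[OF P0(1) involution_fun_carrier[OF that(1)], of 1]
    by (simp add: vanishes_at_def involution_def involution_fun_eq_0_iff int_one_le_iff_zero_less)
  then show "vanishes_at L (involution P0) fun3" "vanishes_at L (involution P0) fun4"
    "vanishes_at L (involution P0) fun5"
    using fun_carrier orders_at_P0(4-6) by blast+
qed

lemma fun_orders:
  "fun3 \<noteq> \<zero>\<^bsub>L\<^esub>" "P0 fun3 = - 3" "fun4 \<noteq> \<zero>\<^bsub>L\<^esub>" "P0 fun4 = - 4" "fun5 \<noteq> \<zero>\<^bsub>L\<^esub>" "P0 fun5 = - 5"
  using orders_at_P0(1-3) by (simp_all add: \<phi>_eq_0_iff val_\<phi>)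

lemma polar_parts:
  "polar_part (div_of L (const ` K) fun3) = multiple_of_point 3 P0"
  "polar_part (div_of L (const ` K) fun4) = multiple_of_point 4 P0"
  "polar_part (div_of L (const ` K) fun5) = multiple_of_point 5 P0"
  by (rule polar_part_eqI[OF P0(1)]; simp add: fun_carrier fun_orders regular_away_from_P0)+

text \<open>\<open>fun3\<close> has a pole at \<open>P0\<close> and a zero at the conjugate
  point.\<close>

lemma involution_P0_neq: "involution P0 \<noteq> P0"
proof
  assume eq: "involution P0 = P0"
  have "involution_fun fun3 = \<zero>\<^bsub>L\<^esub> \<or> 1 \<le> P0 (involution_fun fun3)"
    using orders_at_P0(4) vge_at_\<phi>[OF P0(1) involution_fun_carrier[OF fun_carrier(1)]] by blast
  then have "1 \<le> involution P0 fun3"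
    using fun_orders(1) by (simp add: involution_def involution_fun_eq_0_iff)
  then show False using eq fun_orders(2) by simp
qed

lemma RR_multiple_iff:
  "f \<in> RR (multiple_of_point n P0) \<longleftrightarrow>
    f \<in> carrier L \<and> vge_at P0 (- n) (\<phi> f) \<and> (\<forall>Q \<in> Pts. Q \<noteq> P0 \<longrightarrow> vge_at Q 0 (\<phi> f))"
  unfolding riemann_roch_iff[OF multiple_of_point_divisor[OF P0(1)]]
  using P0(1) by (auto simp: multiple_of_point_def)

text \<open>For \<open>f = p + q y\<close>, the conjugate is regular at \<open>P0\<close>, so the
  pole of the difference \<open>2 q y\<close> there bounds the degree of \<open>q\<close> by
  \<open>n - 3\<close>. Subtracting multiples of the three functions removes \<open>q\<close> and
  leaves a polynomial in \<open>x\<close>. It is regular at \<open>P0\<close> by the conjugate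
  relation, hence constant.\<close>

lemma RR_decompose:
  assumes sqf: "\<And>a. \<not> [:- a, 1:]\<^sup>2 dvd F" and f: "f \<in> RR (multiple_of_point n P0)" and n: "n \<le> 5"
  shows "\<exists>k0 k3 k4 k5. {k0, k3, k4, k5} \<subseteq> K \<and> (n < 4 \<longrightarrow> k4 = 0) \<and> (n < 5 \<longrightarrow> k5 = 0) \<and>
    \<phi> f = fls_const k0 + fls_const k3 * \<phi> fun3 + fls_const k4 * \<phi> fun4 + fls_const k5 * \<phi> fun5"
proof -
  interpret valued K E "val P0" by (rule valued_point[OF P0(1)])
  obtain A B where AB: "f = (A, B)" by (rule prod.exhaust)
  have fc: "(A, B) \<in> carrier L" and f0: "vge (- n) (\<phi> (A, B))"
    and fQ: "\<And>Q. Q \<in> Pts \<Longrightarrow> Q \<noteq> P0 \<Longrightarrow> vge_at Q 0 (\<phi> (A, B))"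
    using f unfolding RR_multiple_iff AB by blast+
  have "vge_at Q 0 (\<phi> (A, B))" if "Q \<in> Pts" "0 \<le> val Q base_x" for Q
    using fQ[OF that(1)] that(2) P0(2) by force
  then obtain p h where p: "A = Fract p 1" and h: "B * B * Fract F 1 = Fract h 1"
    using regular_affine[OF fc] by blast
  obtain q where q: "B = Fract q 1" by (rule squarefree_denominator[OF sqf h])
  have over: "poly_over K p" "poly_over K q"
    using fc p q rf_poly_imp_poly_over by (simp_all add: carrier_L)
  have f_eq: "(A, B) = poly_pair p q" by (simp add: p q poly_pair_def)
  have conj: "vge 0 (\<phi> (involution_fun (A, B)))"
    using fQ[OF involution_point[OF P0(1)] involution_P0_neq]
      vge_at_\<phi>[OF involution_point[OF P0(1)] fc] vge_at_\<phi>[OF P0(1) involution_fun_carrier[OF fc]]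
    by (simp add: involution_def involution_fun_eq_0_iff)
  have deg: "int (degree q) + 3 \<le> n" if "q \<noteq> 0"
  proof -
    note qv = v_eval_neg[OF over(2) that base_x_in_E base_x_nonzero P0(2)]
    note z = v_unit[OF K_1 one_neq_zero P0(3)]
    have "base_y = base_y / base_x ^ 3 * base_x ^ 3" by simp
    then have vy: "val P0 base_y = - 3"
      using z v_mult[OF z(3) E_power[OF base_x_in_E, of 3]] v_power[OF base_x_in_E, of 3] base_x_P0 by simp
    have "\<phi> (A, B) - \<phi> (involution_fun (A, B)) = fls_const 2 * (eval_fls base_x q * base_y)"
      by (simp add: f_eq involution_poly_pair \<phi>_poly_pair eval_fls_uminus)
    moreover have "vge (min (- n) 0) (\<phi> (A, B) - \<phi> (involution_fun (A, B)))"
      by (intro vge_diff vge_mono[OF f0] vge_mono[OF conj]) simp_all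
    ultimately have "vge (min (- n) 0) (fls_const 2 * (eval_fls base_x q * base_y))" by simp
    moreover have "val P0 (fls_const 2 * (eval_fls base_x q * base_y)) = - int (degree q) - 3"
    proof -
      have "2 \<in> K" by (intro K_closed)
      then have "val P0 (fls_const 2) = 0" "fls_const 2 \<in> E"
        by (intro v_const E_const; simp)+
      then show ?thesis
        using qv vy base_x_P0 eval_in_E[OF over(2) base_x_in_E] base_y_in_E base_y_nonzero
        by (simp add: v_mult E_mult)
    qed
    ultimately have "min (- n) 0 \<le> - int (degree q) - 3"
      using qv(2) base_y_nonzero by (simp add: vge_def)
    then show ?thesis by simp
  qed
  \<comment> \<open>The coefficients of \<open>y\<close> in the three functions are
    \<open>1 / 2\<close>, \<open>x / 2\<close> and \<open>x^2 / 2\<close>, whence the factor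
    2.\<close>
  define k3 k4 k5 where k: "k3 = 2 * coeff q 0" "k4 = 2 * coeff q 1" "k5 = 2 * coeff q 2"
  have cq: "coeff q i = 0" if "n < int i + 3" for i
    using deg that by (cases "q = 0") (auto intro!: coeff_eq_0)
  have q_eq: "q = smult k3 [:1 / 2:] + smult k4 [:0, 1 / 2:] + smult k5 [:0, 0, 1 / 2:]"
  proof (rule poly_eqI)
    fix i :: nat
    consider "i = 0" | "i = 1" | "i = 2" | "2 < i" by linarith
    then show "coeff q i = coeff (smult k3 [:1 / 2:] + smult k4 [:0, 1 / 2:] + smult k5 [:0, 0, 1 / 2:]) i"
      by cases (use n cq[of i] in \<open>simp_all add: k numeral_2_eq_2 coeff_pCons split: nat.split\<close>)
  qed
  have "coeff q i \<in> K" for i using over(2) by (auto simp: poly_over_def)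
  then have kK: "k3 \<in> K" "k4 \<in> K" "k5 \<in> K" unfolding k by (intro K_closed; simp)+
  define g where "g = p - smult k3 p3 - smult k4 p4 - smult k5 p5"
  have g_over: "poly_over K g"
  proof -
    have sm: "poly_over K (smult c r)" if "c \<in> K" "poly_over K r" for c r
      using that by (auto simp: poly_over_def intro: K_mult)
    show ?thesis unfolding g_def by (intro poly_over_diff sm over polys_over kK)
  qed
  have eq: "eval_fls base_x q = fls_const k3 * eval_fls base_x [:1 / 2:]
      + fls_const k4 * eval_fls base_x [:0, 1 / 2:] + fls_const k5 * eval_fls base_x [:0, 0, 1 / 2:]"
    by (subst q_eq) (simp only: eval_fls_add eval_fls_smult)
  have eg: "eval_fls base_x g = eval_fls base_x p - fls_const k3 * eval_fls base_x p3
      - fls_const k4 * eval_fls base_x p4 - fls_const k5 * eval_fls base_x p5"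
    by (simp only: g_def eval_fls_diff eval_fls_smult)
  have main: "\<phi> f = eval_fls base_x g + fls_const k3 * \<phi> fun3 + fls_const k4 * \<phi> fun4 + fls_const k5 * \<phi> fun5"
    unfolding AB f_eq fun3_def fun4_def fun5_def \<phi>_poly_pair eq eg
    by (simp add: algebra_simps del: eval_fls_pCons fls_const_mult_const)
  \<comment> \<open>Conjugation fixes \<open>g\<close> and turns everything on the right into
    functions regular at \<open>P0\<close>, so the regularity at the conjugate point is used without
    leaving \<open>P0\<close>.\<close>
  have main': "eval_fls base_x g = \<phi> (involution_fun (A, B)) - (fls_const k3 * \<phi> (involution_fun fun3)
      + fls_const k4 * \<phi> (involution_fun fun4) + fls_const k5 * \<phi> (involution_fun fun5))"
    unfolding f_eq fun3_def fun4_def fun5_def involution_poly_pair \<phi>_poly_pair eval_fls_uminus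
      eq eg
    by (simp add: algebra_simps del: eval_fls_pCons fls_const_mult_const)
  have "vge (0 + 1) (fls_const k3 * \<phi> (involution_fun fun3))" "vge (0 + 1) (fls_const k4 * \<phi> (involution_fun fun4))"
    "vge (0 + 1) (fls_const k5 * \<phi> (involution_fun fun5))"
    by (intro vge_mult vge_const kK orders_at_P0 order_refl)+
  then have "vge 0 (fls_const k3 * \<phi> (involution_fun fun3)
      + fls_const k4 * \<phi> (involution_fun fun4) + fls_const k5 * \<phi> (involution_fun fun5))"
    by (intro vge_add) (auto intro: vge_mono)
  then have "vge 0 (eval_fls base_x g)" unfolding main' by (intro vge_diff conj)
  then have "degree g = 0"
    using v_eval_neg[OF g_over _ base_x_in_E base_x_nonzero P0(2)] base_x_P0
    by (cases "g = 0") (auto simp: vge_def)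
  then obtain k0 where k0: "g = [:k0:]" by (rule degree_eq_zeroE)
  then have "k0 \<in> K" using g_over by (simp add: poly_over_pCons)
  then show ?thesis
    using main k0 kK cq[of 1] cq[of 2] by (intro exI[of _ k0] exI[of _ k3] exI[of _ k4] exI[of _ k5]) (simp add: k)
qed

lemma RR_Span:
  assumes sqf: "\<And>a. \<not> [:- a, 1:]\<^sup>2 dvd F"
  shows "RR (multiple_of_point 3 P0) = L.Span (const ` K) [\<one>\<^bsub>L\<^esub>, fun3]"
    and "RR (multiple_of_point 4 P0) = L.Span (const ` K) [\<one>\<^bsub>L\<^esub>, fun3, fun4]"
    and "RR (multiple_of_point 5 P0) = L.Span (const ` K) [\<one>\<^bsub>L\<^esub>, fun3, fun4, fun5]"
proof -
  have gen: "\<one>\<^bsub>L\<^esub> \<in> RR (multiple_of_point n P0)" "3 \<le> n \<Longrightarrow> fun3 \<in> RR (multiple_of_point n P0)"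
    "4 \<le> n \<Longrightarrow> fun4 \<in> RR (multiple_of_point n P0)" "5 \<le> n \<Longrightarrow> fun5 \<in> RR (multiple_of_point n P0)"
    if "0 \<le> n" for n
  proof -
    have "vge_at Q m (\<phi> \<one>\<^bsub>L\<^esub>)" if "Q \<in> Pts" "m \<le> 0" for Q m
      using valued.vge_const[OF valued_point[OF that(1)] K_1 that(2)] by (simp add: \<phi>_1)
    then show "\<one>\<^bsub>L\<^esub> \<in> RR (multiple_of_point n P0)"
      unfolding RR_multiple_iff using \<open>0 \<le> n\<close> P0(1) L.one_closed by simp
    show "fun3 \<in> RR (multiple_of_point n P0)" if "3 \<le> n"
      unfolding RR_multiple_iff vge_at_\<phi>[OF P0(1) fun_carrier(1)]
      using that by (simp add: fun_carrier fun_orders regular_away_from_P0)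
    show "fun4 \<in> RR (multiple_of_point n P0)" if "4 \<le> n"
      unfolding RR_multiple_iff vge_at_\<phi>[OF P0(1) fun_carrier(2)]
      using that by (simp add: fun_carrier fun_orders regular_away_from_P0)
    show "fun5 \<in> RR (multiple_of_point n P0)" if "5 \<le> n"
      unfolding RR_multiple_iff vge_at_\<phi>[OF P0(1) fun_carrier(3)]
      using that by (simp add: fun_carrier fun_orders regular_away_from_P0)
  qed
  have sup: "L.Span (const ` K) us \<subseteq> RR (multiple_of_point n P0)"
    if "set us \<subseteq> RR (multiple_of_point n P0)" for us n
    by (rule L.subalgebra_Span_incl[OF subfield_const riemann_roch_subalgebra[OF multiple_of_point_divisor[OF P0(1)]] that])
  have sub: "f \<in> L.Span (const ` K) us"
    if us: "set us \<subseteq> carrier L" "{\<one>\<^bsub>L\<^esub>, fun3} \<subseteq> set us" "4 \<le> n \<Longrightarrow> fun4 \<in> set us" "5 \<le> n \<Longrightarrow> fun5 \<in> set us"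
      and n: "n \<le> 5" and f: "f \<in> RR (multiple_of_point n P0)" for f us n
  proof -
    obtain k0 k3 k4 k5 where k: "{k0, k3, k4, k5} \<subseteq> K" "n < 4 \<longrightarrow> k4 = 0" "n < 5 \<longrightarrow> k5 = 0"
      "\<phi> f = fls_const k0 + fls_const k3 * \<phi> fun3 + fls_const k4 * \<phi> fun4 + fls_const k5 * \<phi> fun5"
      using RR_decompose[OF sqf f n] by blast
    have "\<phi> f = \<phi> (const k0 \<otimes>\<^bsub>L\<^esub> \<one>\<^bsub>L\<^esub> \<oplus>\<^bsub>L\<^esub> const k3 \<otimes>\<^bsub>L\<^esub> fun3 \<oplus>\<^bsub>L\<^esub> const k4 \<otimes>\<^bsub>L\<^esub> fun4 \<oplus>\<^bsub>L\<^esub> const k5 \<otimes>\<^bsub>L\<^esub> fun5)"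
      unfolding \<phi>_add \<phi>_mult \<phi>_const \<phi>_1 k(4) by simp
    then have f_eq: "f = const k0 \<otimes>\<^bsub>L\<^esub> \<one>\<^bsub>L\<^esub> \<oplus>\<^bsub>L\<^esub> const k3 \<otimes>\<^bsub>L\<^esub> fun3 \<oplus>\<^bsub>L\<^esub> const k4 \<otimes>\<^bsub>L\<^esub> fun4 \<oplus>\<^bsub>L\<^esub> const k5 \<otimes>\<^bsub>L\<^esub> fun5"
      by (rule injD[OF \<phi>_inj])
    interpret S: subalgebra "const ` K" "L.Span (const ` K) us" L
      by (rule L.Span_is_subalgebra[OF subfield_const us(1)])
    have base: "set us \<subseteq> L.Span (const ` K) us" by (rule L.Span_base_incl[OF subfield_const us(1)])
    have smult: "const c \<otimes>\<^bsub>L\<^esub> g \<in> L.Span (const ` K) us" if "c \<in> K" "c = 0 \<or> g \<in> set us" "g \<in> carrier L" for c g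
    proof (cases "c = 0")
      case True
      then show ?thesis using that(3) S.one_closed by (simp add: const_0 del: L.Span.simps)
    next
      case False
      then have "g \<in> L.Span (const ` K) us" using that(2) base by blast
      then show ?thesis using that(1) by (intro S.smult_closed) blast+
    qed
    have "const k0 \<otimes>\<^bsub>L\<^esub> \<one>\<^bsub>L\<^esub> \<in> L.Span (const ` K) us" "const k3 \<otimes>\<^bsub>L\<^esub> fun3 \<in> L.Span (const ` K) us"
      "const k4 \<otimes>\<^bsub>L\<^esub> fun4 \<in> L.Span (const ` K) us" "const k5 \<otimes>\<^bsub>L\<^esub> fun5 \<in> L.Span (const ` K) us"
      using k(1-3) us(2-4) by (intro smult fun_carrier L.one_closed; force)+
    then show ?thesis unfolding f_eq using S.m_closed by (simp del: L.Span.simps)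
  qed
  have eq: "RR (multiple_of_point n P0) = L.Span (const ` K) us"
    if "set us \<subseteq> carrier L" "{\<one>\<^bsub>L\<^esub>, fun3} \<subseteq> set us" "4 \<le> n \<Longrightarrow> fun4 \<in> set us" "5 \<le> n \<Longrightarrow> fun5 \<in> set us"
      "n \<le> 5" "set us \<subseteq> RR (multiple_of_point n P0)" for n us
    using sub[OF that(1-5)] sup[OF that(6)] by blast
  show "RR (multiple_of_point 3 P0) = L.Span (const ` K) [\<one>\<^bsub>L\<^esub>, fun3]"
    by (rule eq) (simp_all add: fun_carrier gen)
  show "RR (multiple_of_point 4 P0) = L.Span (const ` K) [\<one>\<^bsub>L\<^esub>, fun3, fun4]"
    by (rule eq) (simp_all add: fun_carrier gen)
  show "RR (multiple_of_point 5 P0) = L.Span (const ` K) [\<one>\<^bsub>L\<^esub>, fun3, fun4, fun5]"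
    by (rule eq) (simp_all add: fun_carrier gen)
qed

end

context double_cover
begin

section \<open>Translation of ring expressions and of the hypotheses on \<open>K\<close> and
  \<open>F\<close>\<close>

lemma \<phi>_pow: "\<phi> (f [^]\<^bsub>L\<^esub> (n :: nat)) = \<phi> f ^ n"
  by (induction n) (simp_all add: \<phi>_1 \<phi>_mult)

lemma \<phi>_minus:
  assumes "f \<in> carrier L" "g \<in> carrier L"
  shows "\<phi> (f \<ominus>\<^bsub>L\<^esub> g) = \<phi> f - \<phi> g"
proof -
  have "f = (f \<ominus>\<^bsub>L\<^esub> g) \<oplus>\<^bsub>L\<^esub> g"
    using assms by (simp add: a_minus_def L.a_assoc L.l_neg)
  then have "\<phi> f = \<phi> (f \<ominus>\<^bsub>L\<^esub> g) + \<phi> g" using \<phi>_add by metis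
  then show ?thesis by simp
qed

lemma \<phi>_inv:
  assumes "f \<in> carrier L" "f \<noteq> \<zero>\<^bsub>L\<^esub>"
  shows "inv\<^bsub>L\<^esub> f \<in> carrier L" "\<phi> (inv\<^bsub>L\<^esub> f) = inverse (\<phi> f)"
proof -
  have u: "f \<in> Units L" using assms by (simp add: L.field_Units)
  show "inv\<^bsub>L\<^esub> f \<in> carrier L" by (rule L.Units_inv_closed[OF u])
  have "\<phi> f * \<phi> (inv\<^bsub>L\<^esub> f) = 1" using L.Units_r_inv[OF u] by (simp add: \<phi>_1 flip: \<phi>_mult)
  then show "\<phi> (inv\<^bsub>L\<^esub> f) = inverse (\<phi> f)" by (simp add: inverse_unique)
qed

lemma has_value_at_infinity_iff:
  assumes P: "P \<in> Pts"
  shows "has_value_at L P (coord_y \<otimes>\<^bsub>L\<^esub> inv\<^bsub>L\<^esub> (coord_x [^]\<^bsub>L\<^esub> (3 :: nat))) \<one>\<^bsub>L\<^esub>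
    \<longleftrightarrow> vge_at P 1 (base_y / base_x ^ 3 - fls_const 1)"
proof -
  define x3 where "x3 = coord_x [^]\<^bsub>L\<^esub> (3 :: nat)"
  have px: "\<phi> x3 = base_x ^ 3" by (simp add: x3_def \<phi>_pow \<phi>_x)
  have x3: "x3 \<in> carrier L" "x3 \<noteq> \<zero>\<^bsub>L\<^esub>"
    using x_in_L px \<phi>_eq_0_iff[of x3] by (simp_all add: x3_def)
  define g where "g = coord_y \<otimes>\<^bsub>L\<^esub> inv\<^bsub>L\<^esub> x3"
  have g: "g \<in> carrier L" using \<phi>_inv[OF x3] y_in_L by (simp add: g_def)
  then have c: "g \<ominus>\<^bsub>L\<^esub> \<one>\<^bsub>L\<^esub> \<in> carrier L" by simp
  have "\<phi> (g \<ominus>\<^bsub>L\<^esub> \<one>\<^bsub>L\<^esub>) = base_y / base_x ^ 3 - fls_const 1"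
    using \<phi>_minus[OF g L.one_closed] by (simp add: g_def \<phi>_mult \<phi>_inv[OF x3] \<phi>_1 \<phi>_y px divide_inverse)
  then show ?thesis
    using vge_at_\<phi>[OF P c, of 1]
    by (simp add: has_value_at_def vanishes_at_def int_one_le_iff_zero_less flip: x3_def g_def)
qed

end

context sextic
begin

lemma fun3_eq: "const b0 \<oplus>\<^bsub>L\<^esub> const b1 \<otimes>\<^bsub>L\<^esub> coord_x \<oplus>\<^bsub>L\<^esub> const b2 \<otimes>\<^bsub>L\<^esub> (coord_x [^]\<^bsub>L\<^esub> (2 :: nat))
    \<oplus>\<^bsub>L\<^esub> const (1 / 2) \<otimes>\<^bsub>L\<^esub> (coord_x [^]\<^bsub>L\<^esub> (3 :: nat)) \<oplus>\<^bsub>L\<^esub> const (1 / 2) \<otimes>\<^bsub>L\<^esub> coord_y = fun3"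
  by (rule injD[OF \<phi>_inj])
    (simp add: \<phi>_add \<phi>_mult \<phi>_const \<phi>_pow \<phi>_x \<phi>_y \<phi>_fun p3_def algebra_simps power2_eq_square power3_eq_cube)

lemma fun4_eq: "const c4 \<oplus>\<^bsub>L\<^esub> coord_x \<otimes>\<^bsub>L\<^esub> fun3 = fun4"
  and fun5_eq: "const c5 \<oplus>\<^bsub>L\<^esub> coord_x \<otimes>\<^bsub>L\<^esub> fun4 = fun5"
  by (rule injD[OF \<phi>_inj]; simp only: \<phi>_add \<phi>_mult \<phi>_const \<phi>_x \<phi>_fun(2,3))+

end

lemma constants_of_subfield:
  assumes "subfield K (ring_of_type_algebra :: complex ring)"
  shows "constants K"
proof -
  let ?R = "ring_of_type_algebra :: complex ring"
  have ops: "x \<otimes>\<^bsub>?R\<^esub> y = x * y" "x \<oplus>\<^bsub>?R\<^esub> y = x + y" "\<zero>\<^bsub>?R\<^esub> = 0" "\<one>\<^bsub>?R\<^esub> = 1" "carrier ?R = UNIV" for x y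
    by (simp_all add: ring_of_type_algebra_def)
  interpret R: ring ?R by (rule ring_from_type_algebra)
  note sub = subringE[OF subfieldE(1)[OF assms]]
  show ?thesis
  proof
    show "1 \<in> K" using sub(3) by (simp add: ops)
    show "a * b \<in> K" if "a \<in> K" "b \<in> K" for a b using sub(6)[OF that] by (simp add: ops)
    show "a - b \<in> K" if "a \<in> K" "b \<in> K" for a b
    proof -
      have "b + (\<ominus>\<^bsub>?R\<^esub> b) = 0" using R.r_neg[of b] by (simp add: ops)
      then have "\<ominus>\<^bsub>?R\<^esub> b = - b" by (simp add: eq_neg_iff_add_eq_0 add.commute)
      then show ?thesis using sub(7)[OF that(1) sub(5)[OF that(2)]] by (simp add: ops)
    qed
    show "inverse a \<in> K" if "a \<in> K" for a
    proof (cases "a = 0")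
      case False
      then have a: "a \<in> K - {\<zero>\<^bsub>?R\<^esub>}" using that by (simp add: ops)
      have "a * (inv\<^bsub>?R\<^esub> a) = 1" using R.subfield_m_inv(2)[OF assms a] by (simp add: ops)
      then have "inverse a = inv\<^bsub>?R\<^esub> a" by (rule inverse_unique)
      then show ?thesis using R.subfield_m_inv(1)[OF assms a] by simp
    qed (use that in simp)
  qed
qed

text \<open>A square root \<open>A\<close> of \<open>F\<close> would make \<open>A + y\<close> and
  \<open>A - y\<close> zero divisors.\<close>

lemma field_imp_nonsquare:
  assumes "field (function_field UNIV F)"
  shows "A * A \<noteq> Fract F 1"
proof
  assume sq: "A * A = Fract F 1"
  interpret field "function_field UNIV F" by (rule assms)
  have all: "B \<in> rational_functions UNIV" for B
    by (cases B) (auto simp: rational_functions_def)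
  have "(A, 1) \<otimes>\<^bsub>function_field UNIV F\<^esub> (A, - 1) = \<zero>\<^bsub>function_field UNIV F\<^esub>"
    using sq by (simp add: function_field_def fract_collapse)
  then have "(A, 1) = \<zero>\<^bsub>function_field UNIV F\<^esub> \<or> (A, - 1) = \<zero>\<^bsub>function_field UNIV F\<^esub>"
    by (intro integral) (simp_all add: function_field_def all)
  then show False by (simp add: function_field_def)
qed

theorem proposition1:
  fixes K :: "complex set"
    and a0 a1 a2 a3 a4 a5 :: complex
    and F :: "complex poly"
    and L :: "double_cover_function ring" (structure)
    and x y f3 f4 f5 :: double_cover_function
    and P0 :: "double_cover_function \<Rightarrow> int"
  assumes K: "subfield K (ring_of_type_algebra :: complex ring)"
    and coeffs: "{a0, a1, a2, a3, a4, a5} \<subseteq> K"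
    and F: "F = [:a0, a1, a2, a3, a4, a5, 1:]"
    and genus: "has_genus (function_field UNIV F) (range const) 2"
    and L: "L = function_field K F"
    and x: "x = coord_x"
    and y: "y = coord_y"
    and P0: "P0 \<in> points L (const ` K)" "is_at_infinity P0"
      "has_value_at L P0 (y \<otimes> inv (x [^] (3::nat))) \<one>"
    and f3: "f3 = const ((8 * a3 - 4 * a4 * a5 + a5 ^ 3) / 32)
      \<oplus> const ((4 * a4 - a5 ^ 2) / 16) \<otimes> x
      \<oplus> const (a5 / 4) \<otimes> (x [^] (2::nat))
      \<oplus> const (1 / 2) \<otimes> (x [^] (3::nat))
      \<oplus> const (1 / 2) \<otimes> y"
    and f4: "f4 = const ((64 * a2 - 16 * a4 ^ 2 - 32 * a3 * a5 + 24 * a4 * a5 ^ 2 - 5 * a5 ^ 4) / 256)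
      \<oplus> x \<otimes> f3"
    and f5: "f5 = const ((128 * a1 - 64 * a3 * a4 - 64 * a2 * a5 + 48 * a4 ^ 2 * a5
        + 48 * a3 * a5 ^ 2 - 40 * a4 * a5 ^ 3 + 7 * a5 ^ 5) / 512)
      \<oplus> x \<otimes> f4"
  shows "(\<forall>f \<in> {f3, f4, f5}. vanishes_at L (involution P0) f)
    \<and> polar_part (div_of L (const ` K) f3) = multiple_of_point 3 P0
    \<and> polar_part (div_of L (const ` K) f4) = multiple_of_point 4 P0
    \<and> polar_part (div_of L (const ` K) f5) = multiple_of_point 5 P0
    \<and> riemann_roch_space L (const ` K) (multiple_of_point 3 P0)
        = ring.Span L (const ` K) [\<one>, f3]
    \<and> riemann_roch_space L (const ` K) (multiple_of_point 4 P0)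
        = ring.Span L (const ` K) [\<one>, f3, f4]
    \<and> riemann_roch_space L (const ` K) (multiple_of_point 5 P0)
        = ring.Span L (const ` K) [\<one>, f3, f4, f5]"
proof -
  \<comment> \<open>Having a genus includes that the complex function ring is a field, which is
    where the irreducibility of the curve comes from.\<close>
  have nonsquare: "A * A \<noteq> Fract F 1" for A
    using genus by (intro field_imp_nonsquare) (simp add: has_genus_def)
  have F_props: "degree F = 6" "lead_coeff F = 1" by (simp_all add: F)
  interpret C: constants K by (rule constants_of_subfield[OF K])
  have "poly_over K F" using coeffs by (simp add: F C.poly_over_pCons C.poly_over_0 C.K_1)
  then interpret DK: double_cover K F by unfold_locales (use F_props nonsquare in auto)
  \<comment> \<open>The genus concerns the curve over the complex numbers. What it yields, that
    \<open>F\<close> has no double root, is a property of \<open>F\<close> alone and so can be used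
    over \<open>K\<close>.\<close>
  interpret DC: double_cover UNIV F
    by (intro double_cover.intro double_cover_axioms.intro constants_UNIV nonsquare F_props)
      (simp add: poly_over_def)
  have sqf: "\<not> [:- a, 1:]\<^sup>2 dvd F" for a
    using genus DC.not_genus_two[OF refl] by (auto elim: dvdE)
  have P0': "P0 \<in> points (function_field K F) (const ` K)" using P0(1) by (simp add: L)
  interpret S: sextic K F a0 a1 a2 a3 a4 a5 P0
  proof
    show "F = [:a0, a1, a2, a3, a4, a5, 1:]" by (rule F)
    show "P0 \<in> DK.Pts" by (rule P0')
    show "DK.val P0 DK.base_x < 0" using P0(2) DK.at_infinity_iff[OF P0'] by simp
    show "DK.vge_at P0 1 (DK.base_y / DK.base_x ^ 3 - fls_const 1)"
      using P0(3) DK.has_value_at_infinity_iff[OF P0'] by (simp add: L x y)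
  qed
  have f: "f3 = S.fun3" "f4 = S.fun4" "f5 = S.fun5"
    unfolding f5 f4 f3 x y L S.fun3_eq[symmetric] S.fun4_eq[symmetric] S.fun5_eq[symmetric]
      S.b0_def S.b1_def S.b2_def S.c4_def S.c5_def by (rule refl)+
  show ?thesis
    unfolding f L
    using S.vanishes_at_involution S.polar_parts S.RR_Span[OF sqf] by blast
qed

end
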